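(* Let $0<q<1$, $\alpha\in\mathbb R\setminus\{0\}$, and let $\Gamma$ be the sesquilinear contraction on left-invariant 1-forms of the $4D_+$ calculus on $\mathrm{SU}_q(2)$ whose only nonzero coefficients are $\Gamma(\omega_-,\omega_-)=\alpha$, $\Gamma(\omega_+,\omega_+)=q^2\alpha$, $\Gamma(\omega_0,\omega_z)=\Gamma(\omega_z,\omega_0)=\epsilon=(1-q^2)\alpha$, $\Gamma(\omega_z,\omega_z)=(1+q^2)\alpha$. Let $\star^L$ be the associated left $\mathcal A(\mathrm{SU}_q(2))$-linear Hodge duality, with the scale $m$ of the volume form normalised by $m^2q^2\alpha^2\epsilon^2=1$, and define the Laplacian $\Box^L x:=-\star^L\,\mathrm d\,\star^L\,\mathrm d\,x$. Then for every $x\in\mathcal A(\mathrm{SU}_q(2))$ $$\Box^L x=\alpha\{L_+L_-+q^2L_-L_++(1+q^2)L_zL_z-2(q^2-1)L_0L_z\}\triangleright x=2q\,\alpha\,L_0\triangleright x,$$ where $L_0$ is, up to an additive constant, the quantum Casimir of $\mathcal U_q(\mathfrak{su}(2))$, namely $C_q=L_0+[\tfrac12]^2-\tfrac14$. Moreover $L_0\triangleright\phi_{n,J,l}=[J][J+1]\,\phi_{n,J,l}$ on the vector space basis $\phi_{n,J,l}=(c^{J-n/2}a^{*\,J+n/2})\triangleleft E^l$ of $\mathcal A(\mathrm{SU}_q(2))$, with $n\in\mathbb Z$, $J\in\{|n|/2+k: k=0,1,2,\dots\}$, $l=0,\dots,2J$.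
   Context: **Algebras.** $[u]=(q^u-q^{-u})/(q-q^{-1})$. $\mathcal A=\mathcal A(\mathrm{SU}_q(2))$ is the unital $*$-algebra generated by $a,c$ with $ac=qca$, $ac^*=qc^*a$, $cc^*=c^*c$, $a^*a+c^*c=aa^*+q^2cc^*=1$, a Hopf $*$-algebra with $\Delta U=U\otimes U$ for $U=\begin{pmatrix}a&-qc^*\\c&a^*\end{pmatrix}$. $\mathcal U_q(\mathfrak{su}(2))$ is generated by $K^{\pm1},E,F$ with $K^{\pm1}E=q^{\pm1}EK^{\pm1}$, $K^{\pm1}F=q^{\mp1}FK^{\pm1}$, $[E,F]=(K^2-K^{-2})/(q-q^{-1})$, $\Delta K^{\pm1}=K^{\pm1}\otimes K^{\pm1}$, $\Delta E=E\otimes K+K^{-1}\otimes E$, $\Delta F=F\otimes K+K^{-1}\otimes F$. Its quantum Casimir is $C_q=\frac{qK^2-2+q^{-1}K^{-2}}{(q-q^{-1})^2}+FE-\frac14$. The algebras are dually paired by $\langle K^{\pm1},a\rangle=q^{\mp1/2}$, $\langle K^{\pm1},a^*\rangle=q^{\pm1/2}$, $\langle E,c\rangle=1$, $\langle F,c^*\rangle=-q^{-1}$ (other pairs of generators pair to $0$), and $h\triangleright x=x_{(1)}\langle h,x_{(2)}\rangle$, $x\triangleleft h=\langle h,x_{(1)}\rangle x_{(2)}$. **$4D_+$ calculus.** $L_-=q^{1/2}FK^{-1}$, $L_+=q^{-1/2}EK^{-1}$, $L_z=\frac{K^{-2}-1}{q-q^{-1}}$, $L_0=\frac{q(K^2-1)+q^{-1}(K^{-2}-1)}{(q-q^{-1})^2}+FE$.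 $\Omega^1(\mathrm{SU}_q(2))$ is the free left $\mathcal A$-module on left-invariant 1-forms $\omega_-,\omega_+,\omega_0,\omega_z$, with $\mathrm dx=\sum_a(L_a\triangleright x)\omega_a$ and $\omega_ax=\sum_b(f_{ab}\triangleright x)\omega_b$, where $\Delta(L_a)=1\otimes L_a+\sum_bL_b\otimes f_{ba}$. The antilinear involution has $\omega_-^*=-\omega_+$, $\omega_+^*=-\omega_-$, $\omega_0^*=-\omega_0$, $\omega_z^*=-\omega_z$. **Braiding.** Let $V=\mathrm{span}_{\mathbb C}\{\omega_-,\omega_+,\omega_0,\omega_z\}$, and write $ab$ for $\omega_a\otimes\omega_b$. The canonical ($\mathcal A$-bimodule) braiding $\sigma$ is on $V\otimes V$: $\sigma(--)=--$, $\sigma(++)=++$, $\sigma(00)=00$; $\sigma(-0)=(1-q^2)(-0)+(0-)$, $\sigma(0-)=q^2(-0)$, $\sigma(-z)=(1+q^2)(-0)+(z-)$, $\sigma(z-)=-(1+q^{-2})(-0)+q^{-2}(-z)+(1-q^{-2})(z-)$; $\sigma(+0)=(1-q^{-2})(+0)+(0+)$, $\sigma(0+)=q^{-2}(+0)$, $\sigma(+z)=-(1+q^{-2})(+0)+(z+)$, $\sigma(z+)=(1+q^2)(+0)+q^2(+z)+(1-q^2)(z+)$; $\sigma(z0)=(0z)-(q-q^{-1})^2[(z0)+(-+)-(+-)]$, $\sigma(0z)=(z0)$, $\sigma(zz)=(zz)+(q^2-q^{-2})[(z0)+(-+)-(+-)]$, $\sigma(-+)=-(z0)+(+-)$, $\sigma(+-)=(z0)+(-+)$.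 $\sigma_j$ is $\sigma$ acting on factors $j,j+1$. **Exterior algebra.** For a permutation $p$ with reduced word $\tau_{j_1}\cdots\tau_{j_r}$ in nearest-neighbour transpositions put $\mathfrak P(p)=\sigma_{j_1}\cdots\sigma_{j_r}$, and $A^{(k)}=\sum_{p\in P(k)}\mathrm{sign}(p)\mathfrak P(p)$ ($A^{(0)}=A^{(1)}=1$), where $P(k)$ is the permutation group of $k$ elements. $\Omega^k(\mathrm{SU}_q(2))$ is the range of $A^{(k)}$ on the $k$-fold tensor product of $\Omega^1$ over $\mathcal A$, with $\omega_{a_1}\wedge\dots\wedge\omega_{a_k}=A^{(k)}(\omega_{a_1}\otimes\dots\otimes\omega_{a_k})$; it is the free left $\mathcal A$-module on $\Omega^k_{\mathrm{inv}}=A^{(k)}(V^{\otimes k})$, and $\mathrm d$ extends uniquely to a graded derivation of degree one ($\mathrm d(\theta\wedge\theta')=\mathrm d\theta\wedge\theta'+(-1)^{k}\theta\wedge\mathrm d\theta'$ for $\theta\in\Omega^k$) with $\mathrm d^2=0$. On $V^{\otimes k}$ let $(v_1\otimes\dots\otimes v_k)^\dagger=(-1)^{k(k-1)/2}v_k^*\otimes\dots\otimes v_1^*$ (antilinear); the conjugation on $\Omega^k_{\mathrm{inv}}$ is $(A^{(k)}x)^*=A^{(k)}(x^\dagger)$. **Hodge duality.** $\Gamma$ is antilinear in the first and linear in the second argument and is extended for $k\le s$ by $\Gamma(\omega_{a_1}\otimes\dots\otimes\omega_{a_k},\omega_{b_1}\otimes\dots\otimes\omega_{b_s})=\big(\prod_{i=1}^k\Gamma(\omega_{a_i},\omega_{b_i})\big)\,\omega_{b_{k+1}}\otimes\dots\otimes\omega_{b_s}$.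 For $m\in\mathbb R\setminus\{0\}$ put $\vartheta=im\,\omega_-\otimes\omega_+\otimes\omega_0\otimes\omega_z$ and $\mu=A^{(4)}(\vartheta)$, the volume form. $B_{k,4-k}=\sum_p\mathrm{sign}(p)\mathfrak P(p)$ is the sum over the shuffles (the minimal-length representatives of $(P(k)\times P(4-k))\backslash P(4)$), so that $A^{(4)}=(A^{(k)}\otimes A^{(4-k)})B_{k,4-k}$. For $\eta\in\Omega^k_{\mathrm{inv}}\subset V^{\otimes k}$ with $A^{(k)}\eta=\lambda_\eta\eta$ (so that $A^{(k)}\eta^*=\lambda_{\eta^*}\eta^*$ for some $\lambda_{\eta^*}$), $\mathfrak T(\eta)=\frac{\lambda_{\eta^*}}{\lambda_\eta}\big(A^{(4-k)}(\Gamma(\eta,B_{k,4-k}\vartheta))\big)^*$, extended linearly, and $\star^L(x\,\eta)=x\,\mathfrak T(\eta)$ for $x\in\mathcal A$, $\eta\in\Omega^k_{\mathrm{inv}}$.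
   Formalization: The sign of the Laplacian formula is corrected: with the stated volume form, involution and Hodge duality, the Laplacian −⋆d⋆d x equals −α{…}▷x = −2qα L_0▷x, not +; e.g. for x = c the printed sign fails, since L_0▷c = [1/2][3/2]c ≠ 0. *)

theory Defs
  imports Complex_Main "HOL-Library.Poly_Mapping" "HOL-Combinatorics.Permutations"
begin

section \<open>Complex algebras\<close>

class complex_vector = ab_group_add +
  fixes scaleC :: "complex \<Rightarrow> 'a \<Rightarrow> 'a" (infixr "*\<^sub>C" 75)
  assumes scaleC_add_right: "r *\<^sub>C (x + y) = r *\<^sub>C x + r *\<^sub>C y"
    and scaleC_add_left: "(r + s) *\<^sub>C x = r *\<^sub>C x + s *\<^sub>C x"
    and scaleC_scaleC: "r *\<^sub>C s *\<^sub>C x = (r * s) *\<^sub>C x"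
    and scaleC_one: "1 *\<^sub>C x = x"

class complex_algebra_1 = complex_vector + ring_1 +
  assumes scaleC_mult_left: "(r *\<^sub>C x) * y = r *\<^sub>C (x * y)"
    and scaleC_mult_right: "x * (r *\<^sub>C y) = r *\<^sub>C (x * y)"

class complex_star_algebra = complex_algebra_1 +
  fixes star :: "'a \<Rightarrow> 'a"
  assumes star_add: "star (x + y) = star x + star y"
    and star_scaleC: "star (r *\<^sub>C x) = cnj r *\<^sub>C star x"
    and star_mult: "star (x * y) = star y * star x"
    and star_star: "star (star x) = x"

global_interpretation cv: vector_space "scaleC :: complex \<Rightarrow> 'a \<Rightarrow> 'a::complex_vector"
  by unfold_locales (simp_all add: scaleC_add_right scaleC_add_left scaleC_scaleC scaleC_one)

global_interpretation cvp: vector_space_pair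
  "scaleC :: complex \<Rightarrow> 'a \<Rightarrow> 'a::complex_vector" "scaleC :: complex \<Rightarrow> 'b \<Rightarrow> 'b::complex_vector"
  by unfold_locales

abbreviation clinear :: "('a::complex_vector \<Rightarrow> 'b::complex_vector) \<Rightarrow> bool" where
  "clinear \<equiv> Vector_Spaces.linear scaleC scaleC"

lemma clinear_iff:
  "clinear f \<longleftrightarrow> (\<forall>x y. f (x + y) = f x + f y) \<and> (\<forall>r x. f (r *\<^sub>C x) = r *\<^sub>C f x)"
  by (simp add: Vector_Spaces.linear_def module_hom_def module_hom_axioms_def
      cv.vector_space_axioms cv.module_axioms)

definition cbilinear ::
  "('a::complex_vector \<Rightarrow> 'b::complex_vector \<Rightarrow> 'c::complex_vector) \<Rightarrow> bool" where
  "cbilinear B \<longleftrightarrow> (\<forall>y. clinear (\<lambda>x. B x y)) \<and> (\<forall>x. clinear (B x))"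

instantiation complex :: complex_star_algebra
begin
definition scaleC_complex :: "complex \<Rightarrow> complex \<Rightarrow> complex" where "scaleC_complex = (*)"
definition star_complex :: "complex \<Rightarrow> complex" where "star_complex = cnj"
instance
  by standard (simp_all add: scaleC_complex_def star_complex_def algebra_simps)
end

definition algebra_hom :: "('a::complex_algebra_1 \<Rightarrow> 'b::complex_algebra_1) \<Rightarrow> bool" where
  "algebra_hom f \<longleftrightarrow> clinear f \<and> (\<forall>x y. f (x * y) = f x * f y) \<and> f 1 = 1"


section \<open>Free vector spaces and presentations of algebras\<close>

instantiation poly_mapping :: (type, complex_vector) complex_vector
begin
definition scaleC_poly_mapping :: "complex \<Rightarrow> ('a \<Rightarrow>\<^sub>0 'b) \<Rightarrow> 'a \<Rightarrow>\<^sub>0 'b" where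
  "scaleC_poly_mapping r = Poly_Mapping.map (scaleC r)"
lemma lookup_scaleC: "Poly_Mapping.lookup (r *\<^sub>C p) k = r *\<^sub>C Poly_Mapping.lookup p k" for p :: "'a \<Rightarrow>\<^sub>0 'b"
  unfolding scaleC_poly_mapping_def by transfer (simp add: when_def)
instance
  by standard (auto intro!: poly_mapping_eqI
      simp: lookup_scaleC lookup_add scaleC_add_right scaleC_add_left scaleC_scaleC scaleC_one)
end

definition free_lift :: "('x \<Rightarrow> 'v::complex_vector) \<Rightarrow> ('x \<Rightarrow>\<^sub>0 complex) \<Rightarrow> 'v" where
  "free_lift g p = (\<Sum>k\<in>Poly_Mapping.keys p. Poly_Mapping.lookup p k *\<^sub>C g k)"

lemma free_lift_superset:
  assumes "finite S" "Poly_Mapping.keys p \<subseteq> S"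
  shows "free_lift g p = (\<Sum>k\<in>S. Poly_Mapping.lookup p k *\<^sub>C g k)"
  unfolding free_lift_def using assms by (intro sum.mono_neutral_left) (auto simp: in_keys_iff)

lemma clinear_free_lift: "clinear (free_lift g)"
proof -
  have "free_lift g (p + p') = free_lift g p + free_lift g p'" for p p'
  proof -
    let ?S = "Poly_Mapping.keys p \<union> Poly_Mapping.keys p'"
    have "Poly_Mapping.keys (p + p') \<subseteq> ?S" by (rule Poly_Mapping.keys_add)
    then show ?thesis
      by (simp add: free_lift_superset[of ?S] lookup_add scaleC_add_left sum.distrib)
  qed
  moreover have "free_lift g (r *\<^sub>C p) = r *\<^sub>C free_lift g p" for r p
  proof -
    have "Poly_Mapping.keys (r *\<^sub>C p) \<subseteq> Poly_Mapping.keys p"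
      by (auto simp: in_keys_iff lookup_scaleC)
    then show ?thesis
      by (simp add: free_lift_superset[of "Poly_Mapping.keys p"] lookup_scaleC cv.scale_sum_right
          scaleC_scaleC scaleC_complex_def)
  qed
  ultimately show ?thesis by (simp add: clinear_iff)
qed

lemma free_lift_single: "free_lift g (Poly_Mapping.single k r) = r *\<^sub>C g k"
  by (cases "r = 0") (simp_all add: free_lift_def)

abbreviation monom :: "'x \<Rightarrow> 'x \<Rightarrow>\<^sub>0 complex" where
  "monom w \<equiv> Poly_Mapping.single w 1"

text \<open>The free unital algebra on letters \<open>'g\<close> is the free vector space on words.\<close>

definition free_eval :: "('g \<Rightarrow> 'a::complex_algebra_1) \<Rightarrow> ('g list \<Rightarrow>\<^sub>0 complex) \<Rightarrow> 'a" where
  "free_eval g = free_lift (\<lambda>w. prod_list (map g w))"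

definition free_ideal :: "('g list \<Rightarrow>\<^sub>0 complex) set \<Rightarrow> ('g list \<Rightarrow>\<^sub>0 complex) set" where
  "free_ideal R = cv.span {free_lift (\<lambda>w. monom (u @ w @ v)) r | u v r. r \<in> R}"

definition presented_by ::
  "('g \<Rightarrow> 'a::complex_algebra_1) \<Rightarrow> ('g list \<Rightarrow>\<^sub>0 complex) set \<Rightarrow> bool" where
  "presented_by g R \<longleftrightarrow>
     range (free_eval g) = UNIV \<and> (\<forall>p. free_eval g p = 0 \<longleftrightarrow> p \<in> free_ideal R)"


section \<open>Tensor products over the complex numbers\<close>

definition tensor_relations :: "('a::complex_vector \<times> 'b::complex_vector \<Rightarrow>\<^sub>0 complex) set" where
  "tensor_relations =
     {monom (x + x', y) - monom (x, y) - monom (x', y) | x x' y. True} \<union>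
     {monom (x, y + y') - monom (x, y) - monom (x, y') | x y y'. True} \<union>
     {monom (r *\<^sub>C x, y) - r *\<^sub>C monom (x, y) | r x y. True} \<union>
     {monom (x, r *\<^sub>C y) - r *\<^sub>C monom (x, y) | r x y. True}"

quotient_type (overloaded) ('a, 'b) tensor =
  "('a::complex_vector \<times> 'b::complex_vector) \<Rightarrow>\<^sub>0 complex" /
  "\<lambda>s t. s - t \<in> cv.span tensor_relations"
proof (rule equivpI)
  show "reflp (\<lambda>s t :: 'a \<times> 'b \<Rightarrow>\<^sub>0 complex. s - t \<in> cv.span tensor_relations)"
    by (simp add: reflp_def cv.span_zero)
  show "symp (\<lambda>s t :: 'a \<times> 'b \<Rightarrow>\<^sub>0 complex. s - t \<in> cv.span tensor_relations)"
    by (rule sympI) (metis cv.span_neg minus_diff_eq)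
  show "transp (\<lambda>s t :: 'a \<times> 'b \<Rightarrow>\<^sub>0 complex. s - t \<in> cv.span tensor_relations)"
  proof (rule transpI)
    fix s t u :: "'a \<times> 'b \<Rightarrow>\<^sub>0 complex"
    assume "s - t \<in> cv.span tensor_relations" "t - u \<in> cv.span tensor_relations"
    from cv.span_add[OF this] show "s - u \<in> cv.span tensor_relations" by simp
  qed
qed

instantiation tensor :: (complex_vector, complex_vector) complex_vector
begin
lift_definition zero_tensor :: "('a, 'b) tensor" is 0 .
lift_definition plus_tensor :: "('a, 'b) tensor \<Rightarrow> ('a, 'b) tensor \<Rightarrow> ('a, 'b) tensor" is "(+)"
  by (metis add_diff_add cv.span_add)
lift_definition minus_tensor :: "('a, 'b) tensor \<Rightarrow> ('a, 'b) tensor \<Rightarrow> ('a, 'b) tensor" is "(-)"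
proof -
  fix s s' t t' :: "'a \<times> 'b \<Rightarrow>\<^sub>0 complex"
  assume "s - s' \<in> cv.span tensor_relations" "t - t' \<in> cv.span tensor_relations"
  from cv.span_diff[OF this] show "(s - t) - (s' - t') \<in> cv.span tensor_relations"
    by (simp add: algebra_simps)
qed
lift_definition uminus_tensor :: "('a, 'b) tensor \<Rightarrow> ('a, 'b) tensor" is "uminus"
proof -
  fix s s' :: "'a \<times> 'b \<Rightarrow>\<^sub>0 complex"
  assume "s - s' \<in> cv.span tensor_relations"
  from cv.span_neg[OF this] show "(- s) - (- s') \<in> cv.span tensor_relations"
    by (simp add: algebra_simps)
qed
lift_definition scaleC_tensor :: "complex \<Rightarrow> ('a, 'b) tensor \<Rightarrow> ('a, 'b) tensor" is "scaleC"
  by (metis cv.span_scale cv.scale_right_diff_distrib)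
instance
  by standard (transfer; simp add: cv.span_zero algebra_simps scaleC_add_right scaleC_add_left
      scaleC_scaleC scaleC_one)+
end

lift_definition tensor_pure :: "'a::complex_vector \<Rightarrow> 'b::complex_vector \<Rightarrow> ('a, 'b) tensor"
  (infixr "\<otimes>" 70) is "\<lambda>x y. monom (x, y)" .

text \<open>\<open>tensor_lift B\<close> is the linear map induced by \<open>B\<close>; it is meant for bilinear \<open>B\<close>, where the
  choice of the representative is immaterial (\<open>tensor_lift_pure\<close>, \<open>clinear_tensor_lift\<close>).\<close>

definition tensor_lift ::
  "('a::complex_vector \<Rightarrow> 'b::complex_vector \<Rightarrow> 'c::complex_vector) \<Rightarrow> ('a, 'b) tensor \<Rightarrow> 'c" where
  "tensor_lift B t = free_lift (\<lambda>(x, y). B x y) (rep_tensor t)"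

lemma free_lift_tensor_relations:
  assumes B: "cbilinear B" and p: "p \<in> cv.span tensor_relations"
  shows "free_lift (\<lambda>(x, y). B x y) p = 0"
proof -
  let ?f = "free_lift (\<lambda>(x, y). B x y)"
  interpret f: Vector_Spaces.linear scaleC scaleC ?f by (rule clinear_free_lift)
  have bil: "B (x + x') y = B x y + B x' y" "B x (y + y') = B x y + B x y'"
    "B (r *\<^sub>C x) y = r *\<^sub>C B x y" "B x (r *\<^sub>C y) = r *\<^sub>C B x y" for x x' y y' r
    using B unfolding cbilinear_def clinear_iff by auto
  have "r \<in> {p. ?f p = 0}" if "r \<in> tensor_relations" for r
    using that unfolding tensor_relations_def
    by (auto simp: f.diff f.scale free_lift_single scaleC_one bil)
  then have "tensor_relations \<subseteq> {p. ?f p = 0}" by blast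
  moreover have "cv.subspace {p. ?f p = 0}"
    by (rule cv.subspaceI) (simp_all add: f.zero f.add f.scale)
  ultimately have "cv.span tensor_relations \<subseteq> {p. ?f p = 0}" by (rule cv.span_minimal)
  with p show ?thesis by blast
qed

lemma tensor_lift_abs:
  assumes "cbilinear B"
  shows "tensor_lift B (abs_tensor p) = free_lift (\<lambda>(x, y). B x y) p"
proof -
  interpret f: Vector_Spaces.linear scaleC scaleC "free_lift (\<lambda>(x, y). B x y)"
    by (rule clinear_free_lift)
  have "rep_tensor (abs_tensor p) - p \<in> cv.span tensor_relations"
    using Quotient_rel_abs[OF Quotient_tensor] Quotient_rep_abs[OF Quotient_tensor]
    by (metis Quotient3_tensor rep_abs_rsp_left cv.span_zero diff_self)
  from free_lift_tensor_relations[OF assms this] show ?thesis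
    by (simp add: tensor_lift_def f.diff)
qed

lemma tensor_lift_pure: "cbilinear B \<Longrightarrow> tensor_lift B (x \<otimes> y) = B x y"
  by (simp add: tensor_pure.abs_eq tensor_lift_abs free_lift_single scaleC_one)

lemma clinear_tensor_lift: "cbilinear B \<Longrightarrow> clinear (tensor_lift B)"
proof -
  assume B: "cbilinear B"
  interpret f: Vector_Spaces.linear scaleC scaleC "free_lift (\<lambda>(x, y). B x y)"
    by (rule clinear_free_lift)
  have "tensor_lift B (s + t) = tensor_lift B s + tensor_lift B t" for s t
    by (induction s; induction t) (simp add: plus_tensor.abs_eq tensor_lift_abs[OF B] f.add)
  moreover have "tensor_lift B (r *\<^sub>C t) = r *\<^sub>C tensor_lift B t" for r t
    by (induction t) (simp add: scaleC_tensor.abs_eq tensor_lift_abs[OF B] f.scale)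
  ultimately show ?thesis by (simp add: clinear_iff)
qed

lemma cbilinear_tensor_pure: "cbilinear (\<otimes>)"
  unfolding cbilinear_def clinear_iff
proof (intro conjI allI; transfer)
  show "monom (x + x', y) - (monom (x, y) + monom (x', y)) \<in> cv.span tensor_relations"
    for x x' :: 'a and y :: 'b
    by (rule cv.span_base) (force simp: tensor_relations_def diff_diff_eq)
  show "monom (x, y + y') - (monom (x, y) + monom (x, y')) \<in> cv.span tensor_relations"
    for x :: 'a and y y' :: 'b
    by (rule cv.span_base) (force simp: tensor_relations_def diff_diff_eq)
  show "monom (r *\<^sub>C x, y) - r *\<^sub>C monom (x, y) \<in> cv.span tensor_relations"
    for r and x :: 'a and y :: 'b
    by (rule cv.span_base) (force simp: tensor_relations_def)
  show "monom (x, r *\<^sub>C y) - r *\<^sub>C monom (x, y) \<in> cv.span tensor_relations"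
    for r and x :: 'a and y :: 'b
    by (rule cv.span_base) (force simp: tensor_relations_def)
qed

lemma tensor_pure_add_left: "(x + x') \<otimes> y = x \<otimes> y + x' \<otimes> y"
  and tensor_pure_add_right: "x \<otimes> (y + y') = x \<otimes> y + x \<otimes> y'"
  and tensor_pure_scaleC_left: "(r *\<^sub>C x) \<otimes> y = r *\<^sub>C (x \<otimes> y)"
  and tensor_pure_scaleC_right: "x \<otimes> (r *\<^sub>C y) = r *\<^sub>C (x \<otimes> y)"
  using cbilinear_tensor_pure unfolding cbilinear_def clinear_iff by blast+

lemma free_lift_monom: "free_lift monom p = p"
  by (rule poly_mapping_eqI)
    (simp add: free_lift_def lookup_sum lookup_scaleC lookup_single scaleC_complex_def when_def
      in_keys_iff if_distrib[of "(*) _"] sum.delta cong: if_cong)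

lemma abs_tensor_eq: "abs_tensor p = free_lift (\<lambda>(x, y). x \<otimes> y) p"
proof -
  have sum: "abs_tensor (sum g S) = (\<Sum>k\<in>S. abs_tensor (g k))"
    for g :: "'a \<times> 'b \<Rightarrow> 'a \<times> 'b \<Rightarrow>\<^sub>0 complex" and S
    by (induction S rule: infinite_finite_induct)
      (simp_all add: zero_tensor.abs_eq plus_tensor.abs_eq[symmetric])
  have "abs_tensor p = abs_tensor (free_lift monom p)" by (simp only: free_lift_monom)
  also have "\<dots> = free_lift (\<lambda>(x, y). x \<otimes> y) p"
    by (simp add: free_lift_def sum split_beta tensor_pure.abs_eq scaleC_tensor.abs_eq)
  finally show ?thesis .
qed

lemma tensor_induct [case_names pure add]:
  assumes pure: "\<And>x y. P (x \<otimes> y)" and add: "\<And>s t. P s \<Longrightarrow> P t \<Longrightarrow> P (s + t)"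
  shows "P t"
proof -
  obtain p where t: "t = abs_tensor p" by (induction t) blast
  have "(0 :: 'a) \<otimes> (0 :: 'b) = 0" using tensor_pure_scaleC_left[of 0 "0 :: 'a" "0 :: 'b"] by simp
  then have zero: "P 0" by (metis pure)
  have "P (\<Sum>k\<in>S. Poly_Mapping.lookup p k *\<^sub>C (fst k \<otimes> snd k))" for S
    by (induction S rule: infinite_finite_induct)
      (auto simp: zero tensor_pure_scaleC_left[symmetric] intro: pure add)
  then show ?thesis by (simp add: t abs_tensor_eq free_lift_def split_beta)
qed

lemma tensor_lift_fun_add:
  "tensor_lift (\<lambda>x y. B x y + C x y) t = tensor_lift B t + tensor_lift C t"
  by (simp add: tensor_lift_def free_lift_def split_beta scaleC_add_right sum.distrib)

lemma tensor_lift_fun_scaleC: "tensor_lift (\<lambda>x y. r *\<^sub>C B x y) t = r *\<^sub>C tensor_lift B t"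
  by (simp add: tensor_lift_def free_lift_def split_beta cv.scale_sum_right scaleC_scaleC mult.commute)

lemma complex_functional_exists:
  assumes "(x :: 'a::complex_vector) \<noteq> 0"
  shows "\<exists>g :: 'a \<Rightarrow> complex. clinear g \<and> g x = 1"
proof -
  have "cv.independent {x}" using assms by simp
  from cvp.linear_independent_extend[OF this, of "\<lambda>_. 1 :: complex"] show ?thesis by auto
qed

instantiation tensor :: (complex_algebra_1, complex_algebra_1) complex_algebra_1
begin

definition one_tensor :: "('a, 'b) tensor" where "1 = 1 \<otimes> 1"

definition times_tensor :: "('a, 'b) tensor \<Rightarrow> ('a, 'b) tensor \<Rightarrow> ('a, 'b) tensor" where
  "s * t = tensor_lift (\<lambda>x y. tensor_lift (\<lambda>x' y'. (x * x') \<otimes> (y * y')) t) s"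

lemma cbilinear_times_tensor_aux:
  "cbilinear (\<lambda>x' y'. (x * x') \<otimes> (y * y'))" for x :: 'a and y :: 'b
  unfolding cbilinear_def clinear_iff
  by (simp add: distrib_left scaleC_mult_right tensor_pure_add_left tensor_pure_add_right
      tensor_pure_scaleC_left tensor_pure_scaleC_right)

lemma cbilinear_times_tensor_aux2:
  "cbilinear (\<lambda>x y. tensor_lift (\<lambda>x' y'. (x * x') \<otimes> (y * y')) t)" for t :: "('a, 'b) tensor"
  unfolding cbilinear_def clinear_iff
  by (simp add: distrib_right scaleC_mult_left tensor_pure_add_left tensor_pure_add_right
      tensor_pure_scaleC_left tensor_pure_scaleC_right tensor_lift_fun_add tensor_lift_fun_scaleC)

lemma times_tensor_pure: "(x \<otimes> y) * (x' \<otimes> y') = (x * x') \<otimes> (y * y')"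
  for x x' :: 'a and y y' :: 'b
proof -
  have "(x \<otimes> y) * (x' \<otimes> y') = tensor_lift (\<lambda>x' y'. (x * x') \<otimes> (y * y')) (x' \<otimes> y')"
    unfolding times_tensor_def by (rule tensor_lift_pure[OF cbilinear_times_tensor_aux2])
  also have "\<dots> = (x * x') \<otimes> (y * y')"
    by (rule tensor_lift_pure[OF cbilinear_times_tensor_aux])
  finally show ?thesis .
qed

lemma times_tensor_left:
  "(s + s') * t = s * t + s' * t" "(r *\<^sub>C s) * t = r *\<^sub>C (s * t)" for s s' t :: "('a, 'b) tensor"
  using clinear_tensor_lift[OF cbilinear_times_tensor_aux2]
  by (auto simp: times_tensor_def clinear_iff)

lemma times_tensor_right:
  "t * (s + s') = t * s + t * s'" "t * (r *\<^sub>C s) = r *\<^sub>C (t * s)" for s s' t :: "('a, 'b) tensor"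
  using clinear_tensor_lift[OF cbilinear_times_tensor_aux]
  by (auto simp: times_tensor_def clinear_iff tensor_lift_fun_add tensor_lift_fun_scaleC)

instance
proof
  fix s t u :: "('a, 'b) tensor" and r
  show "s * t * u = s * (t * u)"
  proof (induction s rule: tensor_induct)
    case (pure x y)
    show ?case
    proof (induction t rule: tensor_induct)
      case (pure x' y')
      show ?case
        by (induction u rule: tensor_induct)
          (simp_all add: times_tensor_pure times_tensor_right mult.assoc)
    qed (simp add: times_tensor_left times_tensor_right)
  qed (simp add: times_tensor_left)
  show "1 * s = s"
    by (induction s rule: tensor_induct)
      (simp_all add: one_tensor_def times_tensor_pure times_tensor_right)
  show "s * 1 = s"
    by (induction s rule: tensor_induct)
      (simp_all add: one_tensor_def times_tensor_pure times_tensor_left)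
  show "(s + t) * u = s * u + t * u" "s * (t + u) = s * t + s * u"
    "(r *\<^sub>C s) * t = r *\<^sub>C (s * t)" "s * (r *\<^sub>C t) = r *\<^sub>C (s * t)"
    by (rule times_tensor_left times_tensor_right)+
  show "(0 :: ('a, 'b) tensor) \<noteq> 1"
  proof
    assume eq: "(0 :: ('a, 'b) tensor) = 1"
    obtain g :: "'a \<Rightarrow> complex" where g: "clinear g" "g 1 = 1"
      using complex_functional_exists[of "1 :: 'a"] by auto
    obtain h :: "'b \<Rightarrow> complex" where h: "clinear h" "h 1 = 1"
      using complex_functional_exists[of "1 :: 'b"] by auto
    have B: "cbilinear (\<lambda>x y. g x * h y)"
      using g h unfolding cbilinear_def clinear_iff by (simp add: algebra_simps scaleC_complex_def)
    interpret l: Vector_Spaces.linear scaleC scaleC "tensor_lift (\<lambda>x y. g x * h y)"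
      by (rule clinear_tensor_lift[OF B])
    have "(0 :: complex) = tensor_lift (\<lambda>x y. g x * h y) (1 :: ('a, 'b) tensor)"
      using l.zero eq by simp
    then show False by (simp add: one_tensor_def tensor_lift_pure[OF B] g h)
  qed
qed

end


section \<open>Hopf algebras\<close>

definition tensor_map :: "('a::complex_vector \<Rightarrow> 'c::complex_vector) \<Rightarrow>
    ('b::complex_vector \<Rightarrow> 'd::complex_vector) \<Rightarrow> ('a, 'b) tensor \<Rightarrow> ('c, 'd) tensor" where
  "tensor_map f g = tensor_lift (\<lambda>x y. f x \<otimes> g y)"

definition tensor_assoc ::
  "(('a::complex_vector, 'b::complex_vector) tensor, 'c::complex_vector) tensor \<Rightarrow>
     ('a, ('b, 'c) tensor) tensor" where
  "tensor_assoc = tensor_lift (\<lambda>t z. tensor_lift (\<lambda>x y. x \<otimes> (y \<otimes> z)) t)"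

locale hopf_algebra =
  fixes \<Delta> :: "'a::complex_algebra_1 \<Rightarrow> ('a, 'a) tensor"
    and \<epsilon> :: "'a \<Rightarrow> complex"
    and S :: "'a \<Rightarrow> 'a"
  assumes comult_hom: "algebra_hom \<Delta>"
    and counit_hom: "algebra_hom \<epsilon>"
    and coassoc: "tensor_assoc (tensor_map \<Delta> id (\<Delta> x)) = tensor_map id \<Delta> (\<Delta> x)"
    and counit_left: "tensor_lift (\<lambda>x1 x2. \<epsilon> x1 *\<^sub>C x2) (\<Delta> x) = x"
    and counit_right: "tensor_lift (\<lambda>x1 x2. \<epsilon> x2 *\<^sub>C x1) (\<Delta> x) = x"
    and antipode_linear: "clinear S"
    and antipode_left: "tensor_lift (\<lambda>x1 x2. S x1 * x2) (\<Delta> x) = \<epsilon> x *\<^sub>C 1"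
    and antipode_right: "tensor_lift (\<lambda>x1 x2. x1 * S x2) (\<Delta> x) = \<epsilon> x *\<^sub>C 1"

locale hopf_pairing =
  H: hopf_algebra \<Delta>U \<epsilon>U SU + A: hopf_algebra \<Delta>A \<epsilon>A SA
  for \<Delta>U :: "'u::complex_algebra_1 \<Rightarrow> ('u, 'u) tensor" and \<epsilon>U SU
    and \<Delta>A :: "'a::complex_algebra_1 \<Rightarrow> ('a, 'a) tensor" and \<epsilon>A SA +
  fixes pair :: "'u \<Rightarrow> 'a \<Rightarrow> complex"
  assumes pair_bilinear: "cbilinear pair"
    and pair_mult_left: "pair (h * k) x = tensor_lift (\<lambda>x1 x2. pair h x1 * pair k x2) (\<Delta>A x)"
    and pair_mult_right: "pair h (x * y) = tensor_lift (\<lambda>h1 h2. pair h1 x * pair h2 y) (\<Delta>U h)"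
    and pair_one_left: "pair 1 x = \<epsilon>A x"
    and pair_one_right: "pair h 1 = \<epsilon>U h"

text \<open>\<open>left_action\<close> is $h \triangleright x = x_{(1)} \langle h, x_{(2)}\rangle$ and \<open>right_action\<close> is
  $x \triangleleft h = \langle h, x_{(1)}\rangle x_{(2)}$.\<close>

definition left_action :: "('a::complex_algebra_1 \<Rightarrow> ('a, 'a) tensor) \<Rightarrow>
    ('u \<Rightarrow> 'a \<Rightarrow> complex) \<Rightarrow> 'u \<Rightarrow> 'a \<Rightarrow> 'a" where
  "left_action \<Delta>A pair h x = tensor_lift (\<lambda>x1 x2. pair h x2 *\<^sub>C x1) (\<Delta>A x)"

definition right_action :: "('a::complex_algebra_1 \<Rightarrow> ('a, 'a) tensor) \<Rightarrow>
    ('u \<Rightarrow> 'a \<Rightarrow> complex) \<Rightarrow> 'a \<Rightarrow> 'u \<Rightarrow> 'a" where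
  "right_action \<Delta>A pair x h = tensor_lift (\<lambda>x1 x2. pair h x1 *\<^sub>C x2) (\<Delta>A x)"


section \<open>The quantum group \<open>SU\<^sub>q(2)\<close> and its dual\<close>

abbreviation cr :: "real \<Rightarrow> complex" where "cr \<equiv> complex_of_real"

definition qnum :: "real \<Rightarrow> real \<Rightarrow> real" where
  "qnum q u = (q powr u - q powr (- u)) / (q - 1 / q)"

datatype suq2_letter = Ga | Ga_star | Gc | Gc_star

text \<open>The last two relations are the adjoints of the first two, the others being
  self-adjoint up to sign: a \<open>*\<close>-algebra presented by generators and relations is
  the algebra presented by the generators, their formal adjoints, the relations and their adjoints.\<close>

definition suq2_relations :: "real \<Rightarrow> (suq2_letter list \<Rightarrow>\<^sub>0 complex) set" where
  "suq2_relations q =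
     {monom [Ga, Gc] - cr q *\<^sub>C monom [Gc, Ga],
      monom [Ga, Gc_star] - cr q *\<^sub>C monom [Gc_star, Ga],
      monom [Gc, Gc_star] - monom [Gc_star, Gc],
      monom [Ga_star, Ga] + monom [Gc_star, Gc] - monom [],
      monom [Ga, Ga_star] + cr (q\<^sup>2) *\<^sub>C monom [Gc, Gc_star] - monom [],
      monom [Gc_star, Ga_star] - cr q *\<^sub>C monom [Ga_star, Gc_star],
      monom [Gc, Ga_star] - cr q *\<^sub>C monom [Ga_star, Gc]}"

primrec suq2_gen :: "'a \<Rightarrow> 'a \<Rightarrow> suq2_letter \<Rightarrow> 'a::complex_star_algebra" where
  "suq2_gen a c Ga = a"
| "suq2_gen a c Ga_star = star a"
| "suq2_gen a c Gc = c"
| "suq2_gen a c Gc_star = star c"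

text \<open>The comultiplication is the one with $\Delta U = U \otimes U$.\<close>

locale quantum_SU2 = hopf_algebra \<Delta> \<epsilon> S
  for \<Delta> :: "'a::complex_star_algebra \<Rightarrow> ('a, 'a) tensor" and \<epsilon> S +
  fixes q :: real and a c :: 'a
  assumes presented: "presented_by (suq2_gen a c) (suq2_relations q)"
    and comult_a: "\<Delta> a = a \<otimes> a + (- cr q *\<^sub>C star c) \<otimes> c"
    and comult_c_star: "\<Delta> (- cr q *\<^sub>C star c) =
          a \<otimes> (- cr q *\<^sub>C star c) + (- cr q *\<^sub>C star c) \<otimes> star a"
    and comult_c: "\<Delta> c = c \<otimes> a + star a \<otimes> c"
    and comult_a_star: "\<Delta> (star a) = c \<otimes> (- cr q *\<^sub>C star c) + star a \<otimes> star a"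

datatype uqsu2_letter = GK | GK_inv | GE | GF

definition uqsu2_relations :: "real \<Rightarrow> (uqsu2_letter list \<Rightarrow>\<^sub>0 complex) set" where
  "uqsu2_relations q =
     {monom [GK, GK_inv] - monom [],
      monom [GK_inv, GK] - monom [],
      monom [GK, GE] - cr q *\<^sub>C monom [GE, GK],
      monom [GK_inv, GE] - cr (1 / q) *\<^sub>C monom [GE, GK_inv],
      monom [GK, GF] - cr (1 / q) *\<^sub>C monom [GF, GK],
      monom [GK_inv, GF] - cr q *\<^sub>C monom [GF, GK_inv],
      monom [GE, GF] - monom [GF, GE]
        - cr (1 / (q - 1 / q)) *\<^sub>C (monom [GK, GK] - monom [GK_inv, GK_inv])}"

primrec uqsu2_gen :: "'u \<Rightarrow> 'u \<Rightarrow> 'u \<Rightarrow> 'u \<Rightarrow> uqsu2_letter \<Rightarrow> 'u::complex_algebra_1" where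
  "uqsu2_gen K Ki E F GK = K"
| "uqsu2_gen K Ki E F GK_inv = Ki"
| "uqsu2_gen K Ki E F GE = E"
| "uqsu2_gen K Ki E F GF = F"

locale quantum_su2 = hopf_algebra \<Delta> \<epsilon> S
  for \<Delta> :: "'u::complex_algebra_1 \<Rightarrow> ('u, 'u) tensor" and \<epsilon> S +
  fixes q :: real and K Ki E F :: 'u
  assumes presented: "presented_by (uqsu2_gen K Ki E F) (uqsu2_relations q)"
    and comult_K: "\<Delta> K = K \<otimes> K"
    and comult_Ki: "\<Delta> Ki = Ki \<otimes> Ki"
    and comult_E: "\<Delta> E = E \<otimes> K + Ki \<otimes> E"
    and comult_F: "\<Delta> F = F \<otimes> K + Ki \<otimes> F"

locale suq2_duality =
  U: quantum_su2 \<Delta>U \<epsilon>U SU q K Ki E F + A: quantum_SU2 \<Delta>A \<epsilon>A SA q a c +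
  P: hopf_pairing \<Delta>U \<epsilon>U SU \<Delta>A \<epsilon>A SA pair
  for q :: real
    and \<Delta>U :: "'u::complex_algebra_1 \<Rightarrow> ('u, 'u) tensor" and \<epsilon>U SU and K Ki E F :: 'u
    and \<Delta>A :: "'a::complex_star_algebra \<Rightarrow> ('a, 'a) tensor" and \<epsilon>A SA and a c :: 'a
    and pair :: "'u \<Rightarrow> 'a \<Rightarrow> complex" +
  assumes q_range: "0 < q" "q < 1"
    and pair_K: "pair K a = cr (q powr (- 1 / 2))" "pair K (star a) = cr (q powr (1 / 2))"
      "pair K c = 0" "pair K (star c) = 0"
    and pair_Ki: "pair Ki a = cr (q powr (1 / 2))" "pair Ki (star a) = cr (q powr (- 1 / 2))"
      "pair Ki c = 0" "pair Ki (star c) = 0"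
    and pair_E: "pair E a = 0" "pair E (star a) = 0" "pair E c = 1" "pair E (star c) = 0"
    and pair_F: "pair F a = 0" "pair F (star a) = 0" "pair F c = 0" "pair F (star c) = - cr (1 / q)"

definition casimir :: "real \<Rightarrow> 'u \<Rightarrow> 'u \<Rightarrow> 'u \<Rightarrow> 'u \<Rightarrow> 'u::complex_algebra_1" where
  "casimir q K Ki E F =
     cr (1 / (q - 1 / q)\<^sup>2) *\<^sub>C (cr q *\<^sub>C (K * K) - 2 *\<^sub>C 1 + cr (1 / q) *\<^sub>C (Ki * Ki))
     + F * E - (1 / 4) *\<^sub>C 1"


section \<open>The four-dimensional calculus\<close>

datatype idx = Minus | Plus | Zero | Zed

lemma UNIV_idx: "UNIV = {Minus, Plus, Zero, Zed}"
  using idx.exhaust by auto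

instance idx :: finite
  by standard (simp add: UNIV_idx)

primrec Lvec :: "real \<Rightarrow> 'u \<Rightarrow> 'u \<Rightarrow> 'u \<Rightarrow> 'u \<Rightarrow> idx \<Rightarrow> 'u::complex_algebra_1" where
  "Lvec q K Ki E F Minus = cr (q powr (1 / 2)) *\<^sub>C (F * Ki)"
| "Lvec q K Ki E F Plus = cr (q powr (- 1 / 2)) *\<^sub>C (E * Ki)"
| "Lvec q K Ki E F Zed = cr (1 / (q - 1 / q)) *\<^sub>C (Ki * Ki - 1)"
| "Lvec q K Ki E F Zero =
     cr (1 / (q - 1 / q)\<^sup>2) *\<^sub>C (cr q *\<^sub>C (K * K - 1) + cr (1 / q) *\<^sub>C (Ki * Ki - 1)) + F * E"

text \<open>The elements \<open>f a b\<close> of the dual algebra with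
  $\omega_a x = \sum_b (f_{ab} \triangleright x)\,\omega_b$.\<close>

definition structure_elements ::
  "('u::complex_algebra_1 \<Rightarrow> ('u, 'u) tensor) \<Rightarrow> (idx \<Rightarrow> 'u) \<Rightarrow> (idx \<Rightarrow> idx \<Rightarrow> 'u) \<Rightarrow> bool" where
  "structure_elements \<Delta>U L f \<longleftrightarrow> (\<forall>a. \<Delta>U (L a) = 1 \<otimes> L a + (\<Sum>b\<in>UNIV. L b \<otimes> f b a))"

text \<open>An element of the \<open>k\<close>-fold tensor power of \<open>V\<close> (over the complex numbers) or of
  \<open>\<Omega>\<^sup>1\<close> (over the coordinate algebra \<open>'a\<close>) is given by its family of
  coefficients, in \<open>complex\<close> respectively in \<open>'a\<close> (on the left), with respect to the
  basis of words of length \<open>k\<close> in \<open>\<omega>\<^sub>-, \<omega>\<^sub>+, \<omega>\<^sub>0, \<omega>\<^sub>z\<close>.\<close>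

type_synonym 'v coeffs = "idx list \<Rightarrow> 'v"

definition words :: "nat \<Rightarrow> idx list set" where
  "words k = {w. length w = k}"

definition tensors :: "nat \<Rightarrow> 'v::zero coeffs set" where
  "tensors k = {\<xi>. \<forall>w. w \<notin> words k \<longrightarrow> \<xi> w = 0}"

definition unit_vec :: "idx \<Rightarrow> idx \<Rightarrow> idx \<times> idx \<Rightarrow> real" where
  "unit_vec a b cd = (if cd = (a, b) then 1 else 0)"

text \<open>\<open>braiding q a b (c, d)\<close> is the coefficient of \<open>\<omega>\<^sub>c \<otimes> \<omega>\<^sub>d\<close> in \<open>\<sigma>(\<omega>\<^sub>a \<otimes> \<omega>\<^sub>b)\<close>.\<close>

fun braiding :: "real \<Rightarrow> idx \<Rightarrow> idx \<Rightarrow> idx \<times> idx \<Rightarrow> real" where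
  "braiding q Minus Minus = unit_vec Minus Minus"
| "braiding q Plus Plus = unit_vec Plus Plus"
| "braiding q Zero Zero = unit_vec Zero Zero"
| "braiding q Minus Zero =
     (\<lambda>w. (1 - q\<^sup>2) * unit_vec Minus Zero w + unit_vec Zero Minus w)"
| "braiding q Zero Minus = (\<lambda>w. q\<^sup>2 * unit_vec Minus Zero w)"
| "braiding q Minus Zed =
     (\<lambda>w. (1 + q\<^sup>2) * unit_vec Minus Zero w + unit_vec Zed Minus w)"
| "braiding q Zed Minus =
     (\<lambda>w. - (1 + 1 / q\<^sup>2) * unit_vec Minus Zero w + 1 / q\<^sup>2 * unit_vec Minus Zed w
          + (1 - 1 / q\<^sup>2) * unit_vec Zed Minus w)"
| "braiding q Plus Zero =
     (\<lambda>w. (1 - 1 / q\<^sup>2) * unit_vec Plus Zero w + unit_vec Zero Plus w)"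
| "braiding q Zero Plus = (\<lambda>w. 1 / q\<^sup>2 * unit_vec Plus Zero w)"
| "braiding q Plus Zed =
     (\<lambda>w. - (1 + 1 / q\<^sup>2) * unit_vec Plus Zero w + unit_vec Zed Plus w)"
| "braiding q Zed Plus =
     (\<lambda>w. (1 + q\<^sup>2) * unit_vec Plus Zero w + q\<^sup>2 * unit_vec Plus Zed w
          + (1 - q\<^sup>2) * unit_vec Zed Plus w)"
| "braiding q Zed Zero =
     (\<lambda>w. unit_vec Zero Zed w - (q - 1 / q)\<^sup>2 *
          (unit_vec Zed Zero w + unit_vec Minus Plus w - unit_vec Plus Minus w))"
| "braiding q Zero Zed = unit_vec Zed Zero"
| "braiding q Zed Zed =
     (\<lambda>w. unit_vec Zed Zed w + (q\<^sup>2 - 1 / q\<^sup>2) *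
          (unit_vec Zed Zero w + unit_vec Minus Plus w - unit_vec Plus Minus w))"
| "braiding q Minus Plus = (\<lambda>w. - unit_vec Zed Zero w + unit_vec Plus Minus w)"
| "braiding q Plus Minus = (\<lambda>w. unit_vec Zed Zero w + unit_vec Minus Plus w)"

text \<open>Tensor factors are counted from \<open>0\<close>, so \<open>braid_at q j\<close> acts on the factors with
  indices \<open>j\<close> and \<open>Suc j\<close>.\<close>

definition braid_at :: "real \<Rightarrow> nat \<Rightarrow> 'v::complex_vector coeffs \<Rightarrow> 'v coeffs" where
  "braid_at q j \<xi> = (\<lambda>w. if Suc j < length w
     then \<Sum>(a, b)\<in>UNIV. cr (braiding q a b (w ! j, w ! Suc j)) *\<^sub>C \<xi> (w[j := a, Suc j := b])
     else \<xi> w)"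

definition perm_word :: "nat \<Rightarrow> nat list \<Rightarrow> (nat \<Rightarrow> nat) \<Rightarrow> bool" where
  "perm_word k js p \<longleftrightarrow> (\<forall>j\<in>set js. Suc j < k) \<and>
     p = foldr (\<lambda>j r. Transposition.transpose j (Suc j) \<circ> r) js id"

definition perm_length :: "nat \<Rightarrow> (nat \<Rightarrow> nat) \<Rightarrow> nat" where
  "perm_length k p = (LEAST n. \<exists>js. perm_word k js p \<and> length js = n)"

definition reduced_word :: "nat \<Rightarrow> nat list \<Rightarrow> (nat \<Rightarrow> nat) \<Rightarrow> bool" where
  "reduced_word k js p \<longleftrightarrow> perm_word k js p \<and> length js = perm_length k p"

definition perm_op ::
  "real \<Rightarrow> nat \<Rightarrow> (nat \<Rightarrow> nat) \<Rightarrow> 'v::complex_vector coeffs \<Rightarrow> 'v coeffs" where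
  "perm_op q k p = foldr (braid_at q) (SOME js. reduced_word k js p)"

definition signed_perm_sum ::
  "real \<Rightarrow> nat \<Rightarrow> (nat \<Rightarrow> nat) set \<Rightarrow> 'v::complex_vector coeffs \<Rightarrow> 'v coeffs" where
  "signed_perm_sum q k P \<xi> = (\<lambda>w. \<Sum>p\<in>P. of_int (sign p) *\<^sub>C perm_op q k p \<xi> w)"

definition antisym :: "real \<Rightarrow> nat \<Rightarrow> 'v::complex_vector coeffs \<Rightarrow> 'v coeffs" where
  "antisym q k = signed_perm_sum q k {p. p permutes {..<k}}"

text \<open>Minimal-length representatives of the right cosets of \<open>P(k) \<times> P(s)\<close> in \<open>P(k + s)\<close>.\<close>

definition shuffles_of :: "nat \<Rightarrow> nat \<Rightarrow> (nat \<Rightarrow> nat) set" where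
  "shuffles_of k s = {p. p permutes {..<k + s} \<and>
     (\<forall>h. h permutes {..<k + s} \<and> h ` {..<k} = {..<k} \<longrightarrow>
        perm_length (k + s) p \<le> perm_length (k + s) (h \<circ> p))}"

definition shuffle_sum :: "real \<Rightarrow> nat \<Rightarrow> nat \<Rightarrow> 'v::complex_vector coeffs \<Rightarrow> 'v coeffs" where
  "shuffle_sum q k s = signed_perm_sum q (k + s) (shuffles_of k s)"

text \<open>\<open>forms q k\<close> is \<open>\<Omega>\<^sup>k\<close> for \<open>'v\<close> the coordinate algebra and the space of
  left-invariant forms for \<open>'v = complex\<close>.\<close>

definition forms :: "real \<Rightarrow> nat \<Rightarrow> 'v::complex_vector coeffs set" where
  "forms q k = antisym q k ` tensors k"

abbreviation inv_forms :: "real \<Rightarrow> nat \<Rightarrow> complex coeffs set" where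
  "inv_forms \<equiv> forms"

definition preimage :: "real \<Rightarrow> nat \<Rightarrow> 'v::complex_vector coeffs \<Rightarrow> 'v coeffs" where
  "preimage q k \<theta> = (SOME \<xi>. \<xi> \<in> tensors k \<and> antisym q k \<xi> = \<theta>)"

definition left_mult :: "'a::complex_algebra_1 \<Rightarrow> complex coeffs \<Rightarrow> 'a coeffs" where
  "left_mult x \<eta> = (\<lambda>w. \<eta> w *\<^sub>C x)"

definition form0 :: "'a::zero \<Rightarrow> 'a coeffs" where
  "form0 x = (\<lambda>w. if w = [] then x else 0)"

definition form1 :: "(idx \<Rightarrow> 'a::zero) \<Rightarrow> 'a coeffs" where
  "form1 X = (\<lambda>w. case w of [a] \<Rightarrow> X a | _ \<Rightarrow> 0)"

text \<open>The tensor product over the coordinate algebra of \<open>\<xi>\<close> of degree \<open>k\<close> with \<open>\<xi>'\<close>: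
  the coefficients of \<open>\<xi>'\<close> are moved to the left through the words of \<open>\<xi>\<close> by
  $\omega_{a_1} \otimes \dots \otimes \omega_{a_k}\, y = \sum_b
    (f_{a_1 b_1} \cdots f_{a_k b_k} \triangleright y)\, \omega_{b_1} \otimes \dots \otimes \omega_{b_k}$.\<close>

definition tensor_forms :: "('u \<Rightarrow> 'a \<Rightarrow> 'a) \<Rightarrow> (idx \<Rightarrow> idx \<Rightarrow> 'u::complex_algebra_1) \<Rightarrow>
    nat \<Rightarrow> 'a::complex_algebra_1 coeffs \<Rightarrow> 'a coeffs \<Rightarrow> 'a coeffs" where
  "tensor_forms act f k \<xi> \<xi>' = (\<lambda>w. if k \<le> length w
     then \<Sum>u\<in>words k. \<xi> u * act (prod_list (map2 f u (take k w))) (\<xi>' (drop k w))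
     else 0)"

definition wedge :: "real \<Rightarrow> ('u \<Rightarrow> 'a \<Rightarrow> 'a) \<Rightarrow> (idx \<Rightarrow> idx \<Rightarrow> 'u::complex_algebra_1) \<Rightarrow>
    nat \<Rightarrow> nat \<Rightarrow> 'a::complex_algebra_1 coeffs \<Rightarrow> 'a coeffs \<Rightarrow> 'a coeffs" where
  "wedge q act f k l \<theta> \<theta>' =
     antisym q (k + l) (tensor_forms act f k (preimage q k \<theta>) (preimage q l \<theta>'))"

locale exterior_derivative =
  fixes q :: real and act :: "'u::complex_algebra_1 \<Rightarrow> 'a::complex_algebra_1 \<Rightarrow> 'a"
    and L :: "idx \<Rightarrow> 'u" and f :: "idx \<Rightarrow> idx \<Rightarrow> 'u" and d :: "'a coeffs \<Rightarrow> 'a coeffs"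
  assumes d_function: "d (form0 x) = form1 (\<lambda>a. act (L a) x)"
    and d_degree: "\<theta> \<in> forms q k \<Longrightarrow> d \<theta> \<in> forms q (Suc k)"
    and d_linear: "\<theta> \<in> forms q k \<Longrightarrow> \<theta>' \<in> forms q k \<Longrightarrow>
          d (\<lambda>w. r *\<^sub>C \<theta> w + s *\<^sub>C \<theta>' w) = (\<lambda>w. r *\<^sub>C d \<theta> w + s *\<^sub>C d \<theta>' w)"
    and d_wedge: "\<theta> \<in> forms q k \<Longrightarrow> \<theta>' \<in> forms q l \<Longrightarrow>
          d (wedge q act f k l \<theta> \<theta>') =
            (\<lambda>w. wedge q act f (Suc k) l (d \<theta>) \<theta>' w
               + (- 1) ^ k * wedge q act f k (Suc l) \<theta> (d \<theta>') w)"
    and d_square: "\<theta> \<in> forms q k \<Longrightarrow> d (d \<theta>) = (\<lambda>w. 0)"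


section \<open>Hodge duality\<close>

primrec conj_idx :: "idx \<Rightarrow> idx" where
  "conj_idx Minus = Plus"
| "conj_idx Plus = Minus"
| "conj_idx Zero = Zero"
| "conj_idx Zed = Zed"

text \<open>The involution $(v_1 \otimes \dots \otimes v_k)^\dagger =
  (-1)^{k(k-1)/2}\, v_k^* \otimes \dots \otimes v_1^*$ in terms of coefficients, where
  \<open>\<omega>\<^sub>a\<^sup>* = - \<omega>\<^sub>b\<close> for \<open>b = conj_idx a\<close>; the second sign collects these \<open>k\<close> minus signs.\<close>

definition dagger :: "complex coeffs \<Rightarrow> complex coeffs" where
  "dagger \<xi> = (\<lambda>w. (- 1) ^ (length w * (length w - 1) div 2) * (- 1) ^ length w *
     cnj (\<xi> (rev (map conj_idx w))))"

definition form_conj :: "real \<Rightarrow> nat \<Rightarrow> complex coeffs \<Rightarrow> complex coeffs" where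
  "form_conj q k \<eta> = antisym q k (dagger (preimage q k \<eta>))"

definition contraction_coeff :: "real \<Rightarrow> real \<Rightarrow> idx \<Rightarrow> idx \<Rightarrow> complex" where
  "contraction_coeff q \<alpha> a b =
     (if (a, b) = (Minus, Minus) then cr \<alpha>
      else if (a, b) = (Plus, Plus) then cr (q\<^sup>2 * \<alpha>)
      else if (a, b) = (Zero, Zed) \<or> (a, b) = (Zed, Zero) then cr ((1 - q\<^sup>2) * \<alpha>)
      else if (a, b) = (Zed, Zed) then cr ((1 + q\<^sup>2) * \<alpha>)
      else 0)"

definition contract :: "(idx \<Rightarrow> idx \<Rightarrow> complex) \<Rightarrow> nat \<Rightarrow>
    complex coeffs \<Rightarrow> complex coeffs \<Rightarrow> complex coeffs" where
  "contract \<Gamma> k \<eta> \<zeta> = (\<lambda>w. \<Sum>u\<in>words k. \<Sum>v\<in>words k.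
     cnj (\<eta> u) * (\<Prod>i<k. \<Gamma> (u ! i) (v ! i)) * \<zeta> (v @ w))"

definition volume_tensor :: "real \<Rightarrow> complex coeffs" where
  "volume_tensor m = (\<lambda>w. if w = [Minus, Plus, Zero, Zed] then \<i> * cr m else 0)"

definition is_hodge_inv :: "real \<Rightarrow> (idx \<Rightarrow> idx \<Rightarrow> complex) \<Rightarrow> real \<Rightarrow> nat \<Rightarrow>
    (complex coeffs \<Rightarrow> complex coeffs) \<Rightarrow> bool" where
  "is_hodge_inv q \<Gamma> m k T \<longleftrightarrow>
     (\<forall>\<eta>\<in>inv_forms q k. \<forall>\<eta>'\<in>inv_forms q k. \<forall>r s.
        T (\<lambda>w. r * \<eta> w + s * \<eta>' w) = (\<lambda>w. r * T \<eta> w + s * T \<eta>' w)) \<and>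
     (\<forall>\<eta>\<in>inv_forms q k. \<forall>l l'. \<eta> \<noteq> (\<lambda>w. 0) \<and> antisym q k \<eta> = (\<lambda>w. l * \<eta> w) \<and>
        antisym q k (form_conj q k \<eta>) = (\<lambda>w. l' * form_conj q k \<eta> w) \<longrightarrow>
        T \<eta> = (\<lambda>w. l' / l * form_conj q (4 - k)
          (antisym q (4 - k) (contract \<Gamma> k \<eta> (shuffle_sum q k (4 - k) (volume_tensor m)))) w))"

definition hodge_inv :: "real \<Rightarrow> (idx \<Rightarrow> idx \<Rightarrow> complex) \<Rightarrow> real \<Rightarrow> nat \<Rightarrow>
    complex coeffs \<Rightarrow> complex coeffs" where
  "hodge_inv q \<Gamma> m k = (SOME T. is_hodge_inv q \<Gamma> m k T)"

definition is_hodge_left :: "real \<Rightarrow> (idx \<Rightarrow> idx \<Rightarrow> complex) \<Rightarrow> real \<Rightarrow> nat \<Rightarrow>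
    ('a::complex_algebra_1 coeffs \<Rightarrow> 'a coeffs) \<Rightarrow> bool" where
  "is_hodge_left q \<Gamma> m k T \<longleftrightarrow>
     (\<forall>\<theta>\<in>forms q k. \<forall>\<theta>'\<in>forms q k.
        T (\<lambda>w. \<theta> w + \<theta>' w) = (\<lambda>w. T \<theta> w + T \<theta>' w)) \<and>
     (\<forall>x. \<forall>\<eta>\<in>inv_forms q k. T (left_mult x \<eta>) = left_mult x (hodge_inv q \<Gamma> m k \<eta>))"

definition hodge_left :: "real \<Rightarrow> (idx \<Rightarrow> idx \<Rightarrow> complex) \<Rightarrow> real \<Rightarrow> nat \<Rightarrow>
    'a::complex_algebra_1 coeffs \<Rightarrow> 'a coeffs" where
  "hodge_left q \<Gamma> m k = (SOME T. is_hodge_left q \<Gamma> m k T)"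

definition laplacian :: "real \<Rightarrow> (idx \<Rightarrow> idx \<Rightarrow> complex) \<Rightarrow> real \<Rightarrow>
    ('a::complex_algebra_1 coeffs \<Rightarrow> 'a coeffs) \<Rightarrow> 'a \<Rightarrow> 'a coeffs" where
  "laplacian q \<Gamma> m d x =
     (\<lambda>w. - hodge_left q \<Gamma> m 4 (d (hodge_left q \<Gamma> m 1 (d (form0 x)))) w)"


section \<open>Eigenvectors\<close>

definition phi_index :: "(int \<times> real \<times> nat) set" where
  "phi_index = {(n, J, l). (\<exists>k::nat. J = \<bar>real_of_int n\<bar> / 2 + real k) \<and> real l \<le> 2 * J}"

definition phi :: "('a::complex_star_algebra \<Rightarrow> ('a, 'a) tensor) \<Rightarrow>
    ('u::complex_algebra_1 \<Rightarrow> 'a \<Rightarrow> complex) \<Rightarrow> 'a \<Rightarrow> 'a \<Rightarrow> 'u \<Rightarrow> int \<times> real \<times> nat \<Rightarrow> 'a" where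
  "phi \<Delta>A pair a c E = (\<lambda>(n, J, l).
     right_action \<Delta>A pair
       (c ^ nat \<lfloor>J - real_of_int n / 2\<rfloor> * star a ^ nat \<lfloor>J + real_of_int n / 2\<rfloor>) (E ^ l))"

end

theory Submission
  imports Defs
begin

text \<open>In degree four the quadratic relations of the exterior algebra rewrite every word to a multiple of
  \<open>- + 0 z\<close>, so the antisymmetriser has rank one there, and the Hodge duality is explicit in degrees
  one and four. Writing each \<open>\<omega>\<^sub>e\<close> as a combination of exact forms \<open>\<Sum> x\<^sub>g du\<^sub>g\<close>, the Leibniz rule and
  \<open>d\<^sup>2 = 0\<close> give the Maurer-Cartan equations, and these imply that invariant 3-forms are closed. Hence
  \<open>d \<star> d x\<close> is the volume form times a combination of the \<open>L\<^sub>b L\<^sub>a \<triangleright> x\<close>, whose coefficients pair \<open>\<omega>\<^sub>b\<close>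
  with \<open>\<star> \<omega>\<^sub>a\<close>; this is the operator in the theorem, and the relations of the quantum enveloping
  algebra reduce it to a multiple of \<open>L\<^sub>0\<close>.

  The \<open>\<phi>\<^sub>n\<^sub>J\<^sub>l\<close> are joint eigenvectors of \<open>L\<^sub>0\<close> and of the left and right actions of \<open>K\<close>. Distinct indices
  have distinct eigenvalues, which gives independence; they span because in each step of the filtration
  by word length there are as many of them as ordered monomials.\<close>

section \<open>The braiding\<close>

text \<open>Several objects are given by choice: \<open>perm_op\<close> picks a reduced word,
  \<open>preimage\<close> a tensor above a form, \<open>hodge_inv\<close> and
  \<open>hodge_left\<close> a map with prescribed properties. Nothing can be computed before the
  choice is shown to be immaterial. For \<open>perm_op\<close> this is Matsumoto's theorem together
  with the braid equation for \<sigma>. For \<open>preimage\<close> it is a factorisation of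
  antisymmetrisers: A^(k+1) factors through 1 \<otimes> A^(k), which settles the wedge with a
  1-form, and in degree three the longest braid intertwines A^(3) with the dagger, which settles the
  conjugation. The Hodge maps are specified on eigenvectors of A^(k); in degree one every nonzero
  form is an eigenvector and in degree four the invariant forms are a line, and the Laplacian uses
  only these two degrees.

  The map \<open>d\<close> is likewise known only through its axioms. The constants
  \<open>mc\<close> are the first-order terms that turn L_a L_b into a \<sigma>-invariant family,
  which the antisymmetriser kills; this is why they also govern \<open>d\<close> on invariant
  forms.\<close>

text \<open>The matrix of \<sigma> acting on coefficient families. The table \<open>braiding\<close>
  lists the images of basis vectors, so its transpose appears here.\<close>

definition sig :: "real \<Rightarrow> (idx \<Rightarrow> idx \<Rightarrow> 'v::complex_vector) \<Rightarrow> idx \<Rightarrow> idx \<Rightarrow> 'v" where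
  "sig q G x y = (\<Sum>(a, b)\<in>UNIV. cr (braiding q a b (x, y)) *\<^sub>C G a b)"

lemma sum_idx: "(\<Sum>a\<in>UNIV. h a) = h Minus + h Plus + h Zero + h Zed"
  for h :: "idx \<Rightarrow> 'v::comm_monoid_add"
  by (simp add: UNIV_idx add.assoc)

lemma sum_idx_pair: "(\<Sum>(a, b)\<in>UNIV. h a b) = (\<Sum>a\<in>UNIV. \<Sum>b\<in>UNIV. h a b)"
  for h :: "idx \<Rightarrow> idx \<Rightarrow> 'v::comm_monoid_add"
  by (simp add: sum.cartesian_product flip: UNIV_Times_UNIV)

lemma sig_rows:
  fixes G :: "idx \<Rightarrow> idx \<Rightarrow> 'v::complex_vector"
  shows
    "sig q G Minus Minus = G Minus Minus"
    "sig q G Plus Plus = G Plus Plus"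
    "sig q G Zero Zero = G Zero Zero"
    "sig q G Zed Zed = G Zed Zed"
    "sig q G Zero Minus = G Minus Zero"
    "sig q G Zero Plus = G Plus Zero"
    "sig q G Zero Zed = G Zed Zero"
    "sig q G Zed Minus = G Minus Zed + cr (1 - 1 / q\<^sup>2) *\<^sub>C G Zed Minus"
    "sig q G Zed Plus = G Plus Zed + cr (1 - q\<^sup>2) *\<^sub>C G Zed Plus"
    "sig q G Minus Zed = cr (1 / q\<^sup>2) *\<^sub>C G Zed Minus"
    "sig q G Plus Zed = cr (q\<^sup>2) *\<^sub>C G Zed Plus"
    "sig q G Minus Zero = cr (1 - q\<^sup>2) *\<^sub>C G Minus Zero + cr (q\<^sup>2) *\<^sub>C G Zero Minus
       + cr (1 + q\<^sup>2) *\<^sub>C G Minus Zed + cr (- (1 + 1 / q\<^sup>2)) *\<^sub>C G Zed Minus"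
    "sig q G Plus Zero = cr (1 - 1 / q\<^sup>2) *\<^sub>C G Plus Zero + cr (1 / q\<^sup>2) *\<^sub>C G Zero Plus
       + cr (- (1 + 1 / q\<^sup>2)) *\<^sub>C G Plus Zed + cr (1 + q\<^sup>2) *\<^sub>C G Zed Plus"
    "sig q G Minus Plus = cr (- (q - 1 / q)\<^sup>2) *\<^sub>C G Zed Zero + cr (q\<^sup>2 - 1 / q\<^sup>2) *\<^sub>C G Zed Zed
       + G Plus Minus"
    "sig q G Plus Minus = cr ((q - 1 / q)\<^sup>2) *\<^sub>C G Zed Zero + cr (- (q\<^sup>2 - 1 / q\<^sup>2)) *\<^sub>C G Zed Zed
       + G Minus Plus"
    "sig q G Zed Zero = cr (- (q - 1 / q)\<^sup>2) *\<^sub>C G Zed Zero + cr (q\<^sup>2 - 1 / q\<^sup>2) *\<^sub>C G Zed Zed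
       + G Zero Zed - G Minus Plus + G Plus Minus"
  unfolding sig_def sum_idx_pair sum_idx
  by (simp_all add: unit_vec_def scaleC_one)

lemma sig_functional:
  assumes "clinear g"
  shows "g (sig q G x y) = sig q (\<lambda>a b. g (G a b)) x y"
proof -
  interpret g: Vector_Spaces.linear scaleC scaleC g by fact
  show ?thesis by (simp add: sig_def g.sum split_beta g.scale)
qed

text \<open>Linear functionals turn identities between vectors into identities between complex numbers, where
  ring normalisation applies.\<close>

lemma functionals_separate:
  assumes "\<And>g :: 'a::complex_vector \<Rightarrow> complex. clinear g \<Longrightarrow> g x = g y"
  shows "x = y"
proof (rule ccontr)
  assume "x \<noteq> y"
  then obtain g :: "'a \<Rightarrow> complex" where g: "clinear g" "g (x - y) = 1"
    using complex_functional_exists[of "x - y"] by auto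
  interpret g: Vector_Spaces.linear scaleC scaleC g by (rule g(1))
  show False using g assms[OF g(1)] by (simp add: g.diff)
qed

text \<open>Opaque names for q^2 and q^(-2). The identities for \<sigma> are Laurent polynomial
  identities in q^2; with these names ring normalisation and the rule \<open>qs q * qt q = 1\<close>
  decide them without division.\<close>

definition qs :: "real \<Rightarrow> complex" where "qs q = cr (q\<^sup>2)"
definition qt :: "real \<Rightarrow> complex" where "qt q = cr (1 / q\<^sup>2)"

lemma qs_qt:
  assumes "q \<noteq> 0"
  shows "qs q * qt q = 1" "qs q * (qt q * z) = z"
  using assms by (simp_all add: qs_def qt_def flip: of_real_mult mult.assoc)

lemma cr_qs_qt:
  assumes "q \<noteq> 0"
  shows "cr (q\<^sup>2) = qs q" "cr (1 / q\<^sup>2) = qt q" "cr (1 - q\<^sup>2) = 1 - qs q" "cr (1 + q\<^sup>2) = 1 + qs q"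
    "cr (1 - 1 / q\<^sup>2) = 1 - qt q" "cr (- (1 + 1 / q\<^sup>2)) = - (1 + qt q)"
    "cr (q\<^sup>2 - 1 / q\<^sup>2) = qs q - qt q" "cr (- (q\<^sup>2 - 1 / q\<^sup>2)) = - (qs q - qt q)"
    "cr ((q - 1 / q)\<^sup>2) = qs q - 2 + qt q" "cr (- (q - 1 / q)\<^sup>2) = - (qs q - 2 + qt q)"
proof -
  have "(q - 1 / q)\<^sup>2 = q\<^sup>2 - 2 + 1 / q\<^sup>2"
    using assms by (simp add: power2_eq_square field_simps)
  then show "cr (q\<^sup>2) = qs q" "cr (1 / q\<^sup>2) = qt q" "cr (1 - q\<^sup>2) = 1 - qs q" "cr (1 + q\<^sup>2) = 1 + qs q"
    "cr (1 - 1 / q\<^sup>2) = 1 - qt q" "cr (- (1 + 1 / q\<^sup>2)) = - (1 + qt q)"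
    "cr (q\<^sup>2 - 1 / q\<^sup>2) = qs q - qt q" "cr (- (q\<^sup>2 - 1 / q\<^sup>2)) = - (qs q - qt q)"
    "cr ((q - 1 / q)\<^sup>2) = qs q - 2 + qt q" "cr (- (q - 1 / q)\<^sup>2) = - (qs q - 2 + qt q)"
    by (simp_all add: qs_def qt_def)
qed

lemmas sig_rows_complex = sig_rows[where 'v = complex, unfolded scaleC_complex_def]

text \<open>The braid (Yang-Baxter) equation of \<sigma>, verified for each of the 64 output
  coefficients.\<close>

lemma braid_relation_scalar:
  fixes G :: "idx \<Rightarrow> idx \<Rightarrow> idx \<Rightarrow> complex"
  assumes q: "q \<noteq> 0"
  shows "sig q (\<lambda>a b. sig q (\<lambda>b c. sig q (\<lambda>a b. G a b c) a b) b z) x y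
    = sig q (\<lambda>b c. sig q (\<lambda>a b. sig q (\<lambda>b c. G a b c) b c) x b) y z"
  by (cases x; cases y; cases z; simp only: idx.simps sig_rows_complex cr_qs_qt[OF q];
      simp add: algebra_simps qs_qt[OF q])

lemma braid_relation_local:
  fixes G :: "idx \<Rightarrow> idx \<Rightarrow> idx \<Rightarrow> 'v::complex_vector"
  assumes q: "q \<noteq> 0"
  shows "sig q (\<lambda>a b. sig q (\<lambda>b c. sig q (\<lambda>a b. G a b c) a b) b z) x y
    = sig q (\<lambda>b c. sig q (\<lambda>a b. sig q (\<lambda>b c. G a b c) b c) x b) y z"
proof (rule functionals_separate)
  fix g :: "'v \<Rightarrow> complex" assume g: "clinear g"
  show "g (sig q (\<lambda>a b. sig q (\<lambda>b c. sig q (\<lambda>a b. G a b c) a b) b z) x y)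
    = g (sig q (\<lambda>b c. sig q (\<lambda>a b. sig q (\<lambda>b c. G a b c) b c) x b) y z)"
    by (simp only: sig_functional[OF g] braid_relation_scalar[OF q])
qed

lemma sig_commute:
  "sig q (\<lambda>a b. sig q (\<lambda>c d. H a b c d) z u) x y = sig q (\<lambda>c d. sig q (\<lambda>a b. H a b c d) x y) z u"
  unfolding sig_def split_beta cv.scale_sum_right scaleC_scaleC
  by (subst sum.swap) (simp add: mult.commute)

lemma braid_at_sig:
  "Suc j < length w \<Longrightarrow>
     braid_at q j \<xi> w = sig q (\<lambda>a b. \<xi> (w[j := a, Suc j := b])) (w ! j) (w ! Suc j)"
  by (simp add: braid_at_def sig_def)

lemma braid_at_relation:
  assumes "q \<noteq> 0" and "Suc (Suc j) < length w"
  shows "braid_at q j (braid_at q (Suc j) (braid_at q j \<xi>)) w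
    = braid_at q (Suc j) (braid_at q j (braid_at q (Suc j) \<xi>)) w"
proof -
  let ?G = "\<lambda>a b c. \<xi> (w[j := a, Suc j := b, Suc (Suc j) := c])"
  have "braid_at q j (braid_at q (Suc j) (braid_at q j \<xi>)) w
    = sig q (\<lambda>a b. sig q (\<lambda>b c. sig q (\<lambda>a b. ?G a b c) a b) b (w ! Suc (Suc j))) (w ! j) (w ! Suc j)"
    using assms(2) by (simp add: braid_at_sig list_update_swap)
  moreover have "braid_at q (Suc j) (braid_at q j (braid_at q (Suc j) \<xi>)) w
    = sig q (\<lambda>b c. sig q (\<lambda>a b. sig q (\<lambda>b c. ?G a b c) b c) (w ! j) b) (w ! Suc j) (w ! Suc (Suc j))"
    using assms(2) by (simp add: braid_at_sig list_update_swap)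
  ultimately show ?thesis by (simp only: braid_relation_local[OF assms(1)])
qed

lemma braid_at_commute:
  assumes "Suc i < j" and "Suc j < length w"
  shows "braid_at q i (braid_at q j \<xi>) w = braid_at q j (braid_at q i \<xi>) w"
proof -
  have [simp]: "w[j := c, Suc j := d, i := a, Suc i := b] = w[i := a, Suc i := b, j := c, Suc j := d]" for a b c d
    using assms by (simp add: list_update_swap[of "Suc j" i] list_update_swap[of j i]
        list_update_swap[of "Suc j" "Suc i"] list_update_swap[of j "Suc i"])
  show ?thesis
    using assms sig_commute[of q "\<lambda>a b c d. \<xi> (w[i := a, Suc i := b, j := c, Suc j := d])"
        "w ! j" "w ! Suc j" "w ! i" "w ! Suc i"]
    by (simp add: braid_at_sig)
qed

section \<open>Reduced words and the antisymmetriser\<close>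

text \<open>Equality in the braid monoid. No rule cancels a repeated letter, so length is an
  invariant and equivalent words act by the same operator although \<sigma> is not an
  involution.\<close>

inductive braid_equiv :: "nat list \<Rightarrow> nat list \<Rightarrow> bool" (infix "\<approx>" 50) where
  refl: "u \<approx> u"
| sym: "u \<approx> v \<Longrightarrow> v \<approx> u"
| trans: "u \<approx> v \<Longrightarrow> v \<approx> w \<Longrightarrow> u \<approx> w"
| commute: "Suc i < j \<Longrightarrow> u @ [i, j] @ v \<approx> u @ [j, i] @ v"
| braid: "u @ [j, Suc j, j] @ v \<approx> u @ [Suc j, j, Suc j] @ v"

lemmas [trans] = braid_equiv.trans

lemma braid_equiv_context: "u \<approx> v \<Longrightarrow> a @ u @ b \<approx> a @ v @ b"
proof (induction rule: braid_equiv.induct)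
  case (commute i j u v)
  then show ?case using braid_equiv.commute[of i j "a @ u" "v @ b"] by simp
next
  case (braid u j v)
  show ?case using braid_equiv.braid[of "a @ u" j "v @ b"] by simp
next
  case (trans u v w)
  then show ?case by (blast intro: braid_equiv.trans)
qed (simp_all add: braid_equiv.refl braid_equiv.sym)

lemma braid_equiv_Cons: "u \<approx> v \<Longrightarrow> j # u \<approx> j # v"
  using braid_equiv_context[of u v "[j]" "[]"] by simp

lemma braid_equiv_append1: "u \<approx> v \<Longrightarrow> a @ u \<approx> a @ v"
  using braid_equiv_context[of u v a "[]"] by simp

lemma braid_equiv_append2: "u \<approx> v \<Longrightarrow> u @ b \<approx> v @ b"
  using braid_equiv_context[of u v "[]" b] by simp

lemma braid_equiv_map_Suc: "u \<approx> v \<Longrightarrow> map Suc u \<approx> map Suc v"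
proof (induction rule: braid_equiv.induct)
  case (commute i j u v)
  then show ?case using braid_equiv.commute[of "Suc i" "Suc j" "map Suc u" "map Suc v"] by simp
next
  case (braid u j v)
  show ?case using braid_equiv.braid[of "map Suc u" "Suc j" "map Suc v"] by simp
next
  case (trans u v w)
  then show ?case by (blast intro: braid_equiv.trans)
qed (simp_all add: braid_equiv.refl braid_equiv.sym)

lemma braid_equiv_length: "u \<approx> v \<Longrightarrow> length u = length v"
  by (induction rule: braid_equiv.induct) auto

lemma braid_equiv_bound: "u \<approx> v \<Longrightarrow> (\<forall>j\<in>set u. Suc j < k) \<longleftrightarrow> (\<forall>j\<in>set v. Suc j < k)"
  by (induction rule: braid_equiv.induct) auto

lemma braid_equiv_commute_list:
  "(\<And>i. i \<in> set u \<Longrightarrow> Suc i < j \<or> Suc j < i) \<Longrightarrow> j # u \<approx> u @ [j]"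
proof (induction u)
  case Nil
  then show ?case by (simp add: braid_equiv.refl)
next
  case (Cons i u)
  have "j # i # u \<approx> i # j # u"
    using Cons.prems[of i] braid_equiv.commute[of i j "[]" u] braid_equiv.commute[of j i "[]" u]
    by (auto intro: braid_equiv.sym)
  also have "i # j # u \<approx> i # u @ [j]"
    using Cons by (intro braid_equiv_Cons) auto
  finally show ?case by simp
qed

abbreviation descend :: "nat \<Rightarrow> nat list" where "descend i \<equiv> rev [0..<i]"

text \<open>Only the letters j+1 and j of the descending word interact with j: the larger ones
  commute with it, one braid move turns it into j+1, and that commutes with the rest.\<close>

lemma descend_shift:
  assumes "Suc j < i"
  shows "j # descend i \<approx> descend i @ [Suc j]"
proof -
  let ?u = "rev [Suc (Suc j)..<i]"
  have "[0..<i] = [0..<j] @ [j, Suc j] @ [Suc (Suc j)..<i]"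
    using assms upt_add_eq_append[of 0 j "i - j"] by (simp add: upt_conv_Cons)
  then have split: "descend i = ?u @ [Suc j, j] @ descend j" by simp
  have "j # descend i \<approx> ?u @ [j] @ [Suc j, j] @ descend j"
    using braid_equiv_append2[OF braid_equiv_commute_list[of ?u j], of "[Suc j, j] @ descend j"]
    by (simp add: split)
  also have "\<dots> \<approx> ?u @ [Suc j, j] @ Suc j # descend j"
    using braid_equiv.braid[of ?u j "descend j"] by simp
  also have "\<dots> \<approx> ?u @ [Suc j, j] @ descend j @ [Suc j]"
    by (intro braid_equiv_append1 braid_equiv_commute_list) auto
  finally show ?thesis by (simp add: split)
qed

text \<open>One reduced word for each permutation (\<open>normal_word_of_perm\<close>): the first factor \<open>descend i\<close> moves
  \<open>0\<close> to \<open>i\<close>.\<close>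

primrec normal_words :: "nat \<Rightarrow> nat list set" where
  "normal_words 0 = {[]}"
| "normal_words (Suc k) = (\<lambda>(i, w). descend i @ map Suc w) ` ({..k} \<times> normal_words k)"

lemma finite_normal_words: "finite (normal_words k)"
  by (induction k) auto

lemma normal_words_bound: "w \<in> normal_words k \<Longrightarrow> j \<in> set w \<Longrightarrow> Suc j < k"
proof (induction k arbitrary: w j)
  case (Suc k)
  then obtain i v where v: "i \<le> k" "v \<in> normal_words k" "w = descend i @ map Suc v" by auto
  then have "j < i \<or> (\<exists>j'\<in>set v. j = Suc j')" using Suc.prems(2) by auto
  then show ?case using v Suc.IH by fastforce
qed simp

lemma Nil_normal_words: "[] \<in> normal_words k"
  by (induction k) (auto intro!: image_eqI[of _ _ "(0, [])"])

text \<open>The exchange property. The letter j lengthens the head (j = i), cancels the first letter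
  of the head (i = j+1), or passes through the head, shifted up by one if j+1 < i and unchanged if i
  < j; in the last two cases the tail decides by induction.\<close>

lemma normal_words_step:
  "w \<in> normal_words k \<Longrightarrow> Suc j < k \<Longrightarrow> \<exists>w'\<in>normal_words k. j # w \<approx> w' \<or> w \<approx> j # w'"
proof (induction k arbitrary: w j)
  case (Suc k)
  then obtain i v where v: "i \<le> k" "v \<in> normal_words k" and w: "w = descend i @ map Suc v" by auto
  have nf: "descend i' @ map Suc v' \<in> normal_words (Suc k)" if "i' \<le> k" "v' \<in> normal_words k" for i' v'
    using that by force
  have recurse: ?case if shift: "j # descend i \<approx> descend i @ [Suc j']" and j': "Suc j' < k" for j'
  proof -
    obtain v' where v': "v' \<in> normal_words k" "j' # v \<approx> v' \<or> v \<approx> j' # v'"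
      using Suc.IH[OF v(2) j'] by blast
    have shift': "j # descend i @ map Suc u \<approx> descend i @ map Suc (j' # u)" for u
      using braid_equiv_append2[OF shift, of "map Suc u"] by simp
    show ?case
    proof (rule bexI[OF _ nf[OF v(1) v'(1)]])
      from v'(2) show "j # w \<approx> descend i @ map Suc v' \<or> w \<approx> j # descend i @ map Suc v'"
      proof (elim disj_forward)
        assume "j' # v \<approx> v'"
        then have "descend i @ map Suc (j' # v) \<approx> descend i @ map Suc v'"
          by (intro braid_equiv_append1 braid_equiv_map_Suc)
        with shift'[of v] show "j # w \<approx> descend i @ map Suc v'"
          unfolding w by (rule braid_equiv.trans)
      next
        assume "v \<approx> j' # v'"
        then have "w \<approx> descend i @ map Suc (j' # v')"
          unfolding w by (intro braid_equiv_append1 braid_equiv_map_Suc)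
        then show "w \<approx> j # descend i @ map Suc v'"
          using shift'[of v'] by (blast intro: braid_equiv.trans braid_equiv.sym)
      qed
    qed
  qed
  consider "j = i" | "i = Suc j" | "Suc j < i" | "i < j" by linarith
  then show ?case
  proof cases
    case 1
    then have "j # w = descend (Suc i) @ map Suc v" by (simp add: w)
    moreover have "descend (Suc i) @ map Suc v \<in> normal_words (Suc k)"
      using nf[of "Suc i" v] v Suc.prems(2) 1 by simp
    ultimately show ?thesis by (metis braid_equiv.refl)
  next
    case 2
    then have "w = j # descend j @ map Suc v" by (simp add: w)
    moreover have "descend j @ map Suc v \<in> normal_words (Suc k)"
      using nf[of j v] v 2 by simp
    ultimately show ?thesis by (metis braid_equiv.refl)
  next
    case 3
    then have "j # descend i \<approx> descend i @ [Suc j]" by (rule descend_shift)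
    then show ?thesis by (rule recurse) (use v(1) 3 in simp)
  next
    case 4
    then obtain j' where j': "j = Suc j'" using less_imp_Suc_add by blast
    then have "j # descend i \<approx> descend i @ [Suc j']"
      using 4 by (auto intro: braid_equiv_commute_list)
    then show ?thesis by (rule recurse) (use j' Suc.prems(2) in simp)
  qed
qed simp

section \<open>Permutations of words and Matsumoto's theorem\<close>

primrec perm_of :: "nat list \<Rightarrow> nat \<Rightarrow> nat" where
  "perm_of [] = id"
| "perm_of (j # js) = Transposition.transpose j (Suc j) \<circ> perm_of js"

lemma perm_word_perm_of: "perm_word k js p \<longleftrightarrow> (\<forall>j\<in>set js. Suc j < k) \<and> p = perm_of js"
proof -
  have "foldr (\<lambda>j r. Transposition.transpose j (Suc j) \<circ> r) js id = perm_of js"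
    by (induction js) simp_all
  then show ?thesis by (simp add: perm_word_def)
qed

lemma perm_of_append: "perm_of (u @ v) = perm_of u \<circ> perm_of v"
  by (induction u) (simp_all add: comp_assoc)

lemma perm_of_rev: "perm_of (rev u) (perm_of u n) = n"
  by (induction u arbitrary: n) (simp_all add: perm_of_append)

lemma braid_equiv_perm_of: "u \<approx> v \<Longrightarrow> perm_of u = perm_of v"
proof (induction rule: braid_equiv.induct)
  case (commute i j u v)
  then have "perm_of [i, j] n = perm_of [j, i] n" for n
    by (simp add: Transposition.transpose_def)
  then have "perm_of [i, j] = perm_of [j, i]" ..
  then show ?case by (simp only: perm_of_append)
next
  case (braid u j v)
  have "perm_of [j, Suc j, j] n = perm_of [Suc j, j, Suc j] n" for n
    using transpose_triple[of j "Suc (Suc j)" "Suc j" n] transpose_triple[of "Suc (Suc j)" j "Suc j" n]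
    by (simp only: perm_of.simps o_apply id_apply Transposition.transpose_commute[of "Suc j" j]
        Transposition.transpose_commute[of "Suc (Suc j)"])
  then have "perm_of [j, Suc j, j] = perm_of [Suc j, j, Suc j]" ..
  then show ?case by (simp only: perm_of_append)
qed simp_all

text \<open>Letters are absorbed one at a time by \<open>normal_words_step\<close>. A cancellation
  costs two letters, so equal length means that only braid moves were used; this last clause carries
  the uniqueness of reduced words.\<close>

lemma normal_word_exists:
  "(\<forall>j\<in>set js. Suc j < k) \<Longrightarrow>
    \<exists>w\<in>normal_words k. perm_of w = perm_of js \<and> length w \<le> length js \<and>
      (length w = length js \<longrightarrow> w \<approx> js)"
proof (induction js)
  case Nil
  then show ?case by (intro bexI[OF _ Nil_normal_words]) (simp add: braid_equiv.refl)
next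
  case (Cons j js)
  then have "\<forall>j\<in>set js. Suc j < k" by simp
  from Cons.IH[OF this] obtain w where w: "w \<in> normal_words k" "perm_of w = perm_of js"
      "length w \<le> length js" "length w = length js \<longrightarrow> w \<approx> js" by blast
  from normal_words_step[OF w(1), of j] Cons.prems
  obtain w' where w': "w' \<in> normal_words k" "j # w \<approx> w' \<or> w \<approx> j # w'" by auto
  from w'(2) show ?case
  proof
    assume up: "j # w \<approx> w'"
    then have "length w' = Suc (length w)" using braid_equiv_length by fastforce
    moreover have "perm_of w' = perm_of (j # js)"
      using braid_equiv_perm_of[OF up] w(2) by simp
    moreover have "w' \<approx> j # js" if "length w = length js"
      using up w(4) that by (meson braid_equiv.sym braid_equiv.trans braid_equiv_Cons)
    ultimately show ?case using w w'(1) by (intro bexI[of _ w']) auto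
  next
    assume down: "w \<approx> j # w'"
    then have "length w = Suc (length w')" using braid_equiv_length by fastforce
    moreover have "perm_of w' = perm_of (j # js)"
      using fun_cong[OF braid_equiv_perm_of[OF down]] fun_cong[OF w(2)] by (simp add: fun_eq_iff)
    ultimately show ?case using w w'(1) by (intro bexI[of _ w']) auto
  qed
qed

lemma perm_of_descend: "perm_of (descend i) 0 = i"
  by (induction i) simp_all

lemma perm_of_map_Suc: "perm_of (map Suc w) 0 = 0" "perm_of (map Suc w) (Suc n) = Suc (perm_of w n)"
  by (induction w) (simp_all add: Transposition.transpose_def)

lemma perm_of_permutes: "(\<forall>j\<in>set js. Suc j < k) \<Longrightarrow> perm_of js permutes {..<k}"
proof (induction js)
  case (Cons j js)
  then have "perm_of js permutes {..<k}" "Transposition.transpose j (Suc j) permutes {..<k}"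
    by (auto intro: permutes_swap_id)
  then show ?case unfolding perm_of.simps by (intro permutes_compose)
qed (simp add: permutes_id)

lemma inj_perm_of: "inj (perm_of js)"
  by (metis injI perm_of_rev)

lemma permutation_perm_of: "permutation (perm_of js)"
  by (induction js) (auto simp only: perm_of.simps permutation_id permutation_swap_id intro: permutation_compose)

lemma sign_perm_of: "sign (perm_of js) = (- 1) ^ length js"
proof (induction js)
  case (Cons j js)
  have "sign (perm_of (j # js)) = sign (Transposition.transpose j (Suc j)) * sign (perm_of js)"
    unfolding perm_of.simps by (rule sign_compose[OF permutation_swap_id permutation_perm_of])
  then show ?case using Cons by (simp only: sign_swap_id list.size) simp
qed simp

text \<open>The image of 0 is i, and after cancelling the common head the values at successors give
  the permutation of the tail.\<close>

lemma inj_on_perm_of_pairs: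
  assumes "inj_on perm_of W"
  shows "inj_on (\<lambda>(i, w). perm_of (descend i @ map Suc w)) ({..k} \<times> W)"
proof (rule inj_onI, clarify)
  fix i i' v v'
  assume v: "v \<in> W" "v' \<in> W" and eq: "perm_of (descend i @ map Suc v) = perm_of (descend i' @ map Suc v')"
  from fun_cong[OF eq, of 0] have i: "i = i'"
    by (simp add: perm_of_append perm_of_map_Suc perm_of_descend)
  have "perm_of v n = perm_of v' n" for n
    using fun_cong[OF eq, of "Suc n"] i
    by (simp add: perm_of_append perm_of_map_Suc inj_eq[OF inj_perm_of])
  then have "perm_of v = perm_of v'" ..
  with assms v i show "i = i' \<and> v = v'" by (auto dest: inj_onD)
qed

lemma inj_on_perm_of: "inj_on perm_of (normal_words k)"
proof (induction k)
  case (Suc k)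
  show ?case
    using inj_on_imageI[of perm_of "\<lambda>(i, w). descend i @ map Suc w" "{..k} \<times> normal_words k"]
      inj_on_perm_of_pairs[OF Suc, of k]
    by (simp add: comp_def split_def)
qed simp

lemma inj_on_descend_append: "inj_on (\<lambda>(i, w). descend i @ map Suc w) ({..k} \<times> normal_words k)"
  using inj_on_perm_of_pairs[OF inj_on_perm_of, of k k] inj_on_imageI2[of perm_of]
  by (simp add: comp_def split_def)

lemma card_normal_words: "card (normal_words k) = fact k"
  by (induction k) (simp_all add: card_image inj_on_descend_append card_cartesian_product)

lemma perm_of_normal_words: "perm_of ` normal_words k = {p. p permutes {..<k}}"
proof (rule card_subset_eq)
  show "finite {p. p permutes {..<k}}" by (simp add: finite_permutations)
  show "perm_of ` normal_words k \<subseteq> {p. p permutes {..<k}}"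
    using normal_words_bound by (auto intro!: perm_of_permutes)
  show "card (perm_of ` normal_words k) = card {p. p permutes {..<k}}"
    by (simp add: card_image inj_on_perm_of card_normal_words card_permutations)
qed

text \<open>Any competing word normalises to one that is no longer, and by injectivity that normal
  word is \<open>w\<close> itself.\<close>

lemma perm_length_normal_word:
  assumes "w \<in> normal_words k"
  shows "perm_length k (perm_of w) = length w"
  unfolding perm_length_def
proof (rule Least_equality)
  show "\<exists>js. perm_word k js (perm_of w) \<and> length js = length w"
    using assms normal_words_bound by (auto simp: perm_word_perm_of)
  fix n assume "\<exists>js. perm_word k js (perm_of w) \<and> length js = n"
  then obtain js where js: "\<forall>j\<in>set js. Suc j < k" "perm_of w = perm_of js" "length js = n"
    by (auto simp: perm_word_perm_of)
  from normal_word_exists[OF js(1)] obtain w' where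
    w': "w' \<in> normal_words k" "perm_of w' = perm_of js" "length w' \<le> length js" by blast
  then have "w' = w"
    using inj_onD[OF inj_on_perm_of _ w'(1) assms] js(2) by simp
  then show "length w \<le> n" using w'(3) js(3) by simp
qed

text \<open>Matsumoto's theorem: the reduced words of a permutation form a single braid class. This
  makes the choice inside \<open>perm_op\<close> harmless.\<close>

lemma reduced_word_normal:
  assumes "w \<in> normal_words k"
  shows "reduced_word k js (perm_of w) \<longleftrightarrow> js \<approx> w"
proof
  assume "reduced_word k js (perm_of w)"
  then have js: "\<forall>j\<in>set js. Suc j < k" "perm_of w = perm_of js" "length js = length w"
    using perm_length_normal_word[OF assms] by (auto simp: reduced_word_def perm_word_perm_of)
  from normal_word_exists[OF js(1)] obtain w' where
    w': "w' \<in> normal_words k" "perm_of w' = perm_of js" "length w' = length js \<longrightarrow> w' \<approx> js" by blast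
  then have "w' = w"
    using inj_onD[OF inj_on_perm_of _ w'(1) assms] js(2) by simp
  then show "js \<approx> w" using w'(3) js(3) by (simp add: braid_equiv.sym)
next
  assume "js \<approx> w"
  then show "reduced_word k js (perm_of w)"
    using braid_equiv_bound[of js w k] braid_equiv_perm_of[of js w] braid_equiv_length[of js w]
      normal_words_bound[OF assms] perm_length_normal_word[OF assms]
    by (simp add: reduced_word_def perm_word_perm_of)
qed

lemma normal_word_of_perm:
  assumes "p permutes {..<k}"
  obtains w where "w \<in> normal_words k" "p = perm_of w"
  using assms perm_of_normal_words[of k] by blast

section \<open>Braid words acting on tensors\<close>

lemma words_iff: "w \<in> words k \<longleftrightarrow> length w = k"
  by (simp add: words_def)

lemma braid_at_cong:
  assumes "\<And>w. w \<in> words k \<Longrightarrow> \<xi> w = \<xi>' w" and "w \<in> words k"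
  shows "braid_at q j \<xi> w = braid_at q j \<xi>' w"
  using assms by (auto simp: braid_at_def words_iff intro!: sum.cong)

lemma braid_word_cong:
  assumes "\<And>w. w \<in> words k \<Longrightarrow> \<xi> w = \<xi>' w" and "w \<in> words k"
  shows "foldr (braid_at q) js \<xi> w = foldr (braid_at q) js \<xi>' w"
  using assms(2) by (induction js arbitrary: w) (auto intro!: assms(1) braid_at_cong[of k])

lemma braid_at_sum:
  "braid_at q j (\<lambda>w. \<Sum>i\<in>I. c i *\<^sub>C \<xi> i w) = (\<lambda>w. \<Sum>i\<in>I. c i *\<^sub>C braid_at q j (\<xi> i) w)"
proof
  fix w
  show "braid_at q j (\<lambda>w. \<Sum>i\<in>I. c i *\<^sub>C \<xi> i w) w = (\<Sum>i\<in>I. c i *\<^sub>C braid_at q j (\<xi> i) w)"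
    by (simp add: braid_at_def split_beta cv.scale_sum_right scaleC_scaleC mult.commute)
      (subst sum.swap, simp)
qed

lemma braid_word_sum:
  "foldr (braid_at q) js (\<lambda>w. \<Sum>i\<in>I. c i *\<^sub>C \<xi> i w)
    = (\<lambda>w. \<Sum>i\<in>I. c i *\<^sub>C foldr (braid_at q) js (\<xi> i) w)"
  by (induction js) (simp_all add: braid_at_sum)

lemma braid_at_tensors: "\<xi> \<in> tensors k \<Longrightarrow> braid_at q j \<xi> \<in> tensors k"
  by (auto simp: tensors_def words_iff braid_at_def intro!: sum.neutral)

lemma braid_word_tensors: "\<xi> \<in> tensors k \<Longrightarrow> foldr (braid_at q) js \<xi> \<in> tensors k"
  by (induction js) (auto intro: braid_at_tensors)

lemma braid_equiv_word:
  assumes q: "q \<noteq> 0"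
  shows "u \<approx> v \<Longrightarrow> \<forall>j\<in>set u. Suc j < k \<Longrightarrow> w \<in> words k \<Longrightarrow>
    foldr (braid_at q) u \<xi> w = foldr (braid_at q) v \<xi> w"
proof (induction arbitrary: w rule: braid_equiv.induct)
  case (sym u v)
  then show ?case using braid_equiv_bound[OF sym(1), of k] by simp
next
  case (trans u v x)
  then show ?case using braid_equiv_bound[OF trans(1), of k] by simp
next
  case (commute i j u v)
  show ?case unfolding foldr_append o_apply
    by (rule braid_word_cong[OF _ commute(3)])
      (use commute in \<open>auto simp: words_iff intro!: braid_at_commute\<close>)
next
  case (braid u j v)
  show ?case unfolding foldr_append o_apply
    by (rule braid_word_cong[OF _ braid(2)])
      (use braid in \<open>auto simp: words_iff braid_at_relation[OF q]\<close>)
qed simp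

lemma perm_op_reduced_word:
  assumes q: "q \<noteq> 0" and js: "reduced_word k js p" and w: "w \<in> words k"
  shows "perm_op q k p \<xi> w = foldr (braid_at q) js \<xi> w"
proof -
  let ?js = "SOME js. reduced_word k js p"
  have js': "reduced_word k ?js p" using js by (rule someI)
  have p: "p = perm_of js" "\<forall>j\<in>set js. Suc j < k"
    using js by (auto simp: reduced_word_def perm_word_perm_of)
  then have "p permutes {..<k}" using perm_of_permutes by blast
  then obtain v where v: "v \<in> normal_words k" "p = perm_of v" by (rule normal_word_of_perm)
  have "js \<approx> v" "?js \<approx> v"
    using js js' reduced_word_normal[OF v(1)] unfolding v(2) by blast+
  then have "js \<approx> ?js" by (blast intro: braid_equiv.trans braid_equiv.sym)
  then show ?thesis
    unfolding perm_op_def by (rule braid_equiv_word[OF q _ p(2) w, symmetric])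
qed

lemma perm_op_normal_word:
  assumes "q \<noteq> 0" and "v \<in> normal_words k" and "w \<in> words k"
  shows "perm_op q k (perm_of v) \<xi> w = foldr (braid_at q) v \<xi> w"
  by (rule perm_op_reduced_word[OF assms(1) _ assms(3)])
    (simp add: reduced_word_normal[OF assms(2)] braid_equiv.refl)

lemma antisym_normal_words:
  assumes q: "q \<noteq> 0" and w: "w \<in> words k"
  shows "antisym q k \<xi> w = (\<Sum>v\<in>normal_words k. (- 1) ^ length v *\<^sub>C foldr (braid_at q) v \<xi> w)"
  unfolding antisym_def signed_perm_sum_def perm_of_normal_words[symmetric]
  by (simp add: sum.reindex[OF inj_on_perm_of] sign_perm_of perm_op_normal_word[OF q _ w])

lemma antisym_cong:
  assumes "q \<noteq> 0" and "\<And>w. w \<in> words k \<Longrightarrow> \<xi> w = \<xi>' w" and "w \<in> words k"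
  shows "antisym q k \<xi> w = antisym q k \<xi>' w"
  by (simp add: antisym_normal_words[OF assms(1,3)] braid_word_cong[OF assms(2,3)])

lemma antisym_tensors:
  assumes "\<xi> \<in> tensors k"
  shows "antisym q k \<xi> \<in> tensors k"
proof -
  have "perm_op q k p \<xi> w = 0" if "w \<notin> words k" for p w
    using braid_word_tensors[OF assms] that unfolding perm_op_def tensors_def by blast
  then show ?thesis by (simp add: tensors_def antisym_def signed_perm_sum_def)
qed

lemma antisym_sum:
  assumes "q \<noteq> 0" "w \<in> words k"
  shows "antisym q k (\<lambda>w. \<Sum>i\<in>I. c i *\<^sub>C \<xi> i w) w = (\<Sum>i\<in>I. c i *\<^sub>C antisym q k (\<xi> i) w)"
  unfolding antisym_normal_words[OF assms] braid_word_sum cv.scale_sum_right scaleC_scaleC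
  by (subst sum.swap) (simp add: mult.commute)

lemma braid_word_map_Suc:
  "foldr (braid_at q) (map Suc js) \<xi> (a # w) = foldr (braid_at q) js (\<lambda>u. \<xi> (a # u)) w"
  by (induction js arbitrary: w) (simp_all add: braid_at_def)

text \<open>The shape of normal words gives A^(k+1) = (sum over i of (-1)^i \<sigma>_(i-1) ...
  \<sigma>_0) (1 \<otimes> A^(k)). It computes small antisymmetrisers and shows that wedging with a
  1-form on the left depends only on the form on the right.\<close>

lemma antisym_Suc:
  assumes q: "q \<noteq> 0" and v: "v \<in> words (Suc k)"
  shows "antisym q (Suc k) \<xi> v
    = (\<Sum>i\<le>k. (- 1) ^ i *\<^sub>C foldr (braid_at q) (descend i) (\<lambda>w. antisym q k (\<lambda>u. \<xi> (hd w # u)) (tl w)) v)"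
proof -
  have inner: "antisym q k (\<lambda>u. \<xi> (hd w # u)) (tl w)
      = (\<Sum>x\<in>normal_words k. (- 1) ^ length x *\<^sub>C foldr (braid_at q) (map Suc x) \<xi> w)"
    if "w \<in> words (Suc k)" for w
  proof -
    from that obtain a u where "w = a # u" "u \<in> words k" by (cases w) (auto simp: words_iff)
    then show ?thesis by (simp add: antisym_normal_words[OF q] braid_word_map_Suc)
  qed
  have "foldr (braid_at q) (descend i) (\<lambda>w. antisym q k (\<lambda>u. \<xi> (hd w # u)) (tl w)) v
    = foldr (braid_at q) (descend i)
        (\<lambda>w. \<Sum>x\<in>normal_words k. (- 1) ^ length x *\<^sub>C foldr (braid_at q) (map Suc x) \<xi> w) v" for i
    using inner v by (rule braid_word_cong)
  then show ?thesis
    unfolding antisym_normal_words[OF q v] normal_words.simps sum.reindex[OF inj_on_descend_append] o_apply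
    by (simp add: split_beta braid_word_sum cv.scale_sum_right scaleC_scaleC power_add sum.cartesian_product)
qed

section \<open>Reversed words and divisibility of the antisymmetriser by 1 - \<sigma>_j\<close>

lemma braid_equiv_rev: "u \<approx> v \<Longrightarrow> rev u \<approx> rev v"
proof (induction rule: braid_equiv.induct)
  case (commute i j u v)
  then show ?case using braid_equiv.sym[OF braid_equiv.commute[of i j "rev v" "rev u"]] by simp
next
  case (braid u j v)
  show ?case using braid_equiv.braid[of "rev v" j "rev u"] by simp
next
  case (trans u v w)
  then show ?case by (blast intro: braid_equiv.trans)
qed (simp_all add: braid_equiv.refl braid_equiv.sym)

lemma normal_word_unique:
  "v \<in> normal_words k \<Longrightarrow> w \<in> normal_words k \<Longrightarrow> perm_of v = perm_of w \<Longrightarrow> v = w"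
  using inj_onD[OF inj_on_perm_of] by blast

text \<open>Normalising \<open>rev v\<close> to \<open>w\<close>, and then \<open>rev w\<close>
  back, returns to \<open>v\<close> without gaining length. Hence the first step lost no length
  either and consists of braid moves.\<close>

lemma normal_word_rev_exists:
  assumes v: "v \<in> normal_words k"
  shows "\<exists>w\<in>normal_words k. w \<approx> rev v"
proof -
  have "\<forall>j\<in>set (rev v). Suc j < k" using normal_words_bound[OF v] by simp
  from normal_word_exists[OF this] obtain w where w: "w \<in> normal_words k" "perm_of w = perm_of (rev v)"
    "length w \<le> length v" "length w = length v \<longrightarrow> w \<approx> rev v" by auto
  have "perm_of (rev w) n = perm_of v n" for n
  proof -
    have "perm_of (rev w) (perm_of w (perm_of v n)) = perm_of v n" by (rule perm_of_rev)
    then show ?thesis by (simp add: w(2) perm_of_rev)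
  qed
  then have "perm_of (rev w) = perm_of v" ..
  moreover have "\<forall>j\<in>set (rev w). Suc j < k" using normal_words_bound[OF w(1)] by simp
  ultimately obtain v' where v': "v' \<in> normal_words k" "perm_of v' = perm_of v" "length v' \<le> length w"
    using normal_word_exists[of "rev w" k] by auto
  have "v' = v" by (rule normal_word_unique[OF v'(1) v v'(2)])
  with v' w have "length w = length v" by simp
  with w show ?thesis by blast
qed

definition normal_rev :: "nat \<Rightarrow> nat list \<Rightarrow> nat list" where
  "normal_rev k v = (SOME w. w \<in> normal_words k \<and> w \<approx> rev v)"

lemma normal_rev:
  assumes "v \<in> normal_words k"
  shows "normal_rev k v \<in> normal_words k" "normal_rev k v \<approx> rev v"
  using someI_ex[OF normal_word_rev_exists[OF assms, unfolded Bex_def]]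
  unfolding normal_rev_def by blast+

lemma normal_rev_rev:
  assumes v: "v \<in> normal_words k"
  shows "normal_rev k (normal_rev k v) = v"
proof (rule normal_word_unique[OF _ v])
  note r = normal_rev[OF v]
  note rr = normal_rev[OF r(1)]
  show "normal_rev k (normal_rev k v) \<in> normal_words k" by (rule rr(1))
  have "rev (normal_rev k v) \<approx> v" using braid_equiv_rev[OF r(2)] by simp
  with rr(2) show "perm_of (normal_rev k (normal_rev k v)) = perm_of v"
    by (intro braid_equiv_perm_of) (rule braid_equiv.trans)
qed

text \<open>Reindexing by inverse permutations. It turns the pairing by multiplication on the left
  into a factor on the right, as \<open>antisym_kernel\<close> needs.\<close>

lemma antisym_normal_words_rev:
  assumes q: "q \<noteq> 0" and w: "w \<in> words k"
  shows "antisym q k \<xi> w = (\<Sum>v\<in>normal_words k. (- 1) ^ length v *\<^sub>C foldr (braid_at q) (rev v) \<xi> w)"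
  unfolding antisym_normal_words[OF q w]
proof (rule sum.reindex_bij_witness[of _ "normal_rev k" "normal_rev k"])
  fix v assume v: "v \<in> normal_words k"
  note r = normal_rev[OF v]
  show "normal_rev k (normal_rev k v) = v" "normal_rev k v \<in> normal_words k"
    "normal_rev k (normal_rev k v) = v" "normal_rev k v \<in> normal_words k"
    using r(1) normal_rev_rev[OF v] by simp_all
  have e: "rev (normal_rev k v) \<approx> v" using braid_equiv_rev[OF r(2)] by simp
  have b: "\<forall>j\<in>set (rev (normal_rev k v)). Suc j < k" using normal_words_bound[OF r(1)] by simp
  show "(- 1) ^ length (normal_rev k v) *\<^sub>C foldr (braid_at q) (rev (normal_rev k v)) \<xi> w
      = (- 1) ^ length v *\<^sub>C foldr (braid_at q) v \<xi> w"
    using braid_equiv_word[OF q e b w, of \<xi>] braid_equiv_length[OF r(2)] by simp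
qed

text \<open>Left multiplication by the \<open>j\<close>-th transposition pairs the permutations; this makes the
  antisymmetriser factor through \<open>1 - \<sigma>\<^sub>j\<close> on either side.\<close>

lemma normal_words_pairing:
  assumes j: "Suc j < k"
  obtains Up up where "Up \<subseteq> normal_words k" "\<And>w. w \<in> Up \<Longrightarrow> j # w \<approx> up w"
    "\<And>g :: nat list \<Rightarrow> 'v::ab_group_add. (\<Sum>w\<in>normal_words k. g w) = (\<Sum>w\<in>Up. g w + g (up w))"
proof -
  \<comment> \<open>\<open>Up\<close> represents the permutations lengthened by the j-th
    transposition and \<open>up\<close> performs the multiplication; by
    \<open>normal_words_step\<close> every other normal word lies in the image of
    \<open>up\<close>.\<close>
  define Up where "Up = {w \<in> normal_words k. \<exists>w'\<in>normal_words k. j # w \<approx> w'}"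
  define up where "up w = (SOME w'. w' \<in> normal_words k \<and> j # w \<approx> w')" for w
  have up: "up w \<in> normal_words k" "j # w \<approx> up w" if "w \<in> Up" for w
    using that someI_ex[of "\<lambda>w'. w' \<in> normal_words k \<and> j # w \<approx> w'"] unfolding Up_def up_def by blast+
  have inj: "inj_on up Up"
  proof (rule inj_onI)
    fix v w assume vw: "v \<in> Up" "w \<in> Up" "up v = up w"
    then have "perm_of (j # v) = perm_of (j # w)"
      using braid_equiv_perm_of[OF up(2)] by metis
    then have "Transposition.transpose j (Suc j) (perm_of (j # v) n) = Transposition.transpose j (Suc j) (perm_of (j # w) n)" for n
      by simp
    then have "perm_of v = perm_of w" by (simp add: fun_eq_iff)
    with vw show "v = w" unfolding Up_def by (auto intro: normal_word_unique)
  qed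
  have disj: "Up \<inter> up ` Up = {}"
  proof -
    have False if w: "w \<in> Up" and uw: "up w \<in> Up" for w
    proof -
      have "perm_of (up (up w)) = perm_of (j # j # w)"
        using braid_equiv_perm_of[OF up(2)[OF uw]] braid_equiv_perm_of[OF up(2)[OF w]] by simp
      also have "\<dots> = perm_of w" by (simp add: fun_eq_iff)
      finally have "up (up w) = w"
        using up(1)[OF uw] w unfolding Up_def by (auto intro: normal_word_unique)
      then show False
        using braid_equiv_length[OF up(2)[OF uw]] braid_equiv_length[OF up(2)[OF w]] by simp
    qed
    then show ?thesis by blast
  qed
  have cover: "normal_words k = Up \<union> up ` Up"
  proof
    show "Up \<union> up ` Up \<subseteq> normal_words k" using up(1) unfolding Up_def by blast
    show "normal_words k \<subseteq> Up \<union> up ` Up"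
    proof
      fix w assume w: "w \<in> normal_words k"
      from normal_words_step[OF w j] obtain w' where w': "w' \<in> normal_words k" "j # w \<approx> w' \<or> w \<approx> j # w'" by blast
      then consider "w \<in> Up" | "w \<approx> j # w'" using w unfolding Up_def by blast
      then show "w \<in> Up \<union> up ` Up"
      proof cases
        case 2
        then have "w' \<in> Up" using w w'(1) unfolding Up_def by (blast intro: braid_equiv.sym)
        moreover have "up w' = w"
          using up[OF \<open>w' \<in> Up\<close>] w 2 by (metis normal_word_unique braid_equiv_perm_of)
        ultimately show ?thesis by blast
      qed simp
    qed
  qed
  have fin: "finite Up" unfolding Up_def by (simp add: finite_normal_words)
  show thesis
  proof
    show "Up \<subseteq> normal_words k" unfolding Up_def by blast
    show "j # w \<approx> up w" if "w \<in> Up" for w using up(2)[OF that] .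
    show "(\<Sum>w\<in>normal_words k. g w) = (\<Sum>w\<in>Up. g w + g (up w))" for g :: "nat list \<Rightarrow> 'v"
      unfolding cover using fin disj by (simp add: sum.union_disjoint sum.reindex[OF inj] sum.distrib)
  qed
qed

text \<open>The factor 1 - \<sigma>_j on the right: \<open>rev (up w)\<close> is equivalent to
  \<open>rev w @ [j]\<close> and enters with the opposite sign. Both the exterior relations and the
  Maurer-Cartan equations come from here.\<close>

lemma antisym_kernel:
  fixes \<xi> :: "'v::complex_vector coeffs"
  assumes q: "q \<noteq> 0" and j: "Suc j < k"
    and \<xi>: "\<And>w. w \<in> words k \<Longrightarrow> braid_at q j \<xi> w = \<xi> w" and v: "v \<in> words k"
  shows "antisym q k \<xi> v = 0"
proof -
  obtain Up up where Up: "Up \<subseteq> normal_words k" "\<And>w. w \<in> Up \<Longrightarrow> j # w \<approx> up w"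
    and sum: "\<And>g :: nat list \<Rightarrow> 'v. (\<Sum>w\<in>normal_words k. g w) = (\<Sum>w\<in>Up. g w + g (up w))"
    by (rule normal_words_pairing[OF j, where 'v = 'v]) (rule that)
  have "(- 1) ^ length w *\<^sub>C foldr (braid_at q) (rev w) \<xi> v
      + (- 1) ^ length (up w) *\<^sub>C foldr (braid_at q) (rev (up w)) \<xi> v = 0" if w: "w \<in> Up" for w
  proof -
    have "rev w @ [j] \<approx> rev (up w)" using braid_equiv_rev[OF Up(2)[OF w]] by simp
    moreover have "\<forall>i\<in>set (rev w @ [j]). Suc i < k" using normal_words_bound Up(1) w j by auto
    ultimately have "foldr (braid_at q) (rev (up w)) \<xi> v = foldr (braid_at q) (rev w @ [j]) \<xi> v"
      using braid_equiv_word[OF q _ _ v] by metis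
    also have "\<dots> = foldr (braid_at q) (rev w) \<xi> v"
      unfolding foldr_append o_apply by (rule braid_word_cong[OF _ v]) (simp add: \<xi>)
    finally show ?thesis using braid_equiv_length[OF Up(2)[OF w], symmetric] by simp
  qed
  then show ?thesis unfolding antisym_normal_words_rev[OF q v] sum by simp
qed

text \<open>The factor 1 - \<sigma>_j on the left, which constrains the output coefficients
  (\<open>dual_relations\<close>).\<close>

lemma antisym_image:
  fixes \<xi> :: "'v::complex_vector coeffs"
  assumes q: "q \<noteq> 0" and j: "Suc j < k"
  obtains \<eta> where "\<And>v. v \<in> words k \<Longrightarrow> antisym q k \<xi> v = \<eta> v - braid_at q j \<eta> v"
proof -
  obtain Up up where Up: "Up \<subseteq> normal_words k" "\<And>w. w \<in> Up \<Longrightarrow> j # w \<approx> up w"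
    and sum: "\<And>g :: nat list \<Rightarrow> 'v. (\<Sum>w\<in>normal_words k. g w) = (\<Sum>w\<in>Up. g w + g (up w))"
    by (rule normal_words_pairing[OF j, where 'v = 'v]) (rule that)
  show thesis
  proof
    fix v :: "idx list" assume v: "v \<in> words k"
    have "foldr (braid_at q) (up w) \<xi> v = braid_at q j (foldr (braid_at q) w \<xi>) v"
      "length (up w) = Suc (length w)" if w: "w \<in> Up" for w
    proof -
      have "\<forall>i\<in>set (j # w). Suc i < k" using normal_words_bound Up(1) w j by auto
      from braid_equiv_word[OF q Up(2)[OF w] this v, of \<xi>]
      show "foldr (braid_at q) (up w) \<xi> v = braid_at q j (foldr (braid_at q) w \<xi>) v" by simp
      show "length (up w) = Suc (length w)" using braid_equiv_length[OF Up(2)[OF w]] by simp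
    qed
    then show "antisym q k \<xi> v = (\<lambda>v. \<Sum>w\<in>Up. (- 1) ^ length w *\<^sub>C foldr (braid_at q) w \<xi> v) v
        - braid_at q j (\<lambda>v. \<Sum>w\<in>Up. (- 1) ^ length w *\<^sub>C foldr (braid_at q) w \<xi> v) v"
      unfolding antisym_normal_words[OF q v] sum braid_at_sum
      by (simp flip: sum_subtractf cong: sum.cong)
  qed
qed

section \<open>Shuffles as minimal coset representatives\<close>

lemma perm_of_ascending: "perm_of [0..<i] i = 0"
proof (induction i)
  case (Suc i)
  then show ?case by (simp add: perm_of_append)
qed simp

text \<open>The last letter acts first, and an adjacent transposition lowers a point by at most one.
  Reaching 0 in exactly n steps forces each letter.\<close>

lemma perm_of_to_zero:
  "perm_of js n = 0 \<Longrightarrow> n \<le> length js \<and> (length js = n \<longrightarrow> js = [0..<n])"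
proof (induction js arbitrary: n rule: rev_induct)
  case (snoc j js)
  define n' where "n' = Transposition.transpose j (Suc j) n"
  have "perm_of js n' = 0" using snoc.prems by (simp add: perm_of_append n'_def)
  from snoc.IH[OF this] have IH: "n' \<le> length js" "length js = n' \<longrightarrow> js = [0..<n']" by auto
  have n': "n \<le> Suc n'" "n = Suc n' \<longrightarrow> j = n'"
    by (auto simp: n'_def Transposition.transpose_def)
  show ?case
  proof (intro conjI impI)
    show "n \<le> length (js @ [j])" using IH(1) n'(1) by simp
    assume "length (js @ [j]) = n"
    with IH n' have "n = Suc n'" "length js = n'" by auto
    with IH(2) n'(2) show "js @ [j] = [0..<n]" by simp
  qed
qed simp

lemma reduced_word_exists:
  assumes "p permutes {..<k}"
  obtains js where "reduced_word k js p"
  using assms by (metis normal_word_of_perm reduced_word_normal braid_equiv.refl)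

lemma perm_length_le: "perm_word k js p \<Longrightarrow> perm_length k p \<le> length js"
  unfolding perm_length_def by (rule Least_le) blast

lemma reduced_word_ascending:
  assumes "i \<le> s"
  shows "reduced_word (Suc s) [0..<i] (perm_of [0..<i])"
proof -
  have word: "perm_word (Suc s) [0..<i] (perm_of [0..<i])"
    using assms by (auto simp: perm_word_perm_of)
  then have "perm_of [0..<i] permutes {..<Suc s}"
    by (simp add: perm_word_perm_of perm_of_permutes)
  then obtain js where js: "reduced_word (Suc s) js (perm_of [0..<i])" by (rule reduced_word_exists)
  then have "perm_of js i = 0"
    by (metis reduced_word_def perm_word_perm_of perm_of_ascending)
  from perm_of_to_zero[OF this] js have "i \<le> perm_length (Suc s) (perm_of [0..<i])"
    by (simp add: reduced_word_def)
  with perm_length_le[OF word] word show ?thesis by (simp add: reduced_word_def)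
qed

text \<open>Composing on the left with permutations that fix 0 preserves exactly the point i sent to
  0, so i labels the coset. By \<open>perm_of_to_zero\<close> its elements have length at least i,
  with equality only for the ascending word.\<close>

lemma shuffles_of_1: "shuffles_of 1 s = (\<lambda>i. perm_of [0..<i]) ` {..s}"
proof -
  have fix0: "h ` {..<1::nat} = {..<1} \<longleftrightarrow> h 0 = 0" for h :: "nat \<Rightarrow> nat"
    by (simp add: lessThan_Suc)
  have len: "perm_length (Suc s) (perm_of [0..<i]) = i" if "i \<le> s" for i
    using reduced_word_ascending[OF that] by (simp add: reduced_word_def)
  have perm: "perm_of [0..<i] permutes {..<Suc s}" if "i \<le> s" for i
    using that by (intro perm_of_permutes) auto
  have lower: "n \<le> perm_length (Suc s) p" if p: "p permutes {..<Suc s}" "p n = 0" for p n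
  proof -
    from p(1) obtain js where "reduced_word (Suc s) js p" by (rule reduced_word_exists)
    then show ?thesis using perm_of_to_zero[of js n] p(2) by (simp add: reduced_word_def perm_word_perm_of)
  qed
  show ?thesis
  proof (intro set_eqI iffI)
    fix p assume "p \<in> shuffles_of 1 s"
    then have p: "p permutes {..<Suc s}"
      and min: "\<And>h. h permutes {..<Suc s} \<Longrightarrow> h 0 = 0 \<Longrightarrow>
        perm_length (Suc s) p \<le> perm_length (Suc s) (h \<circ> p)"
      unfolding shuffles_of_def fix0 by auto
    define i where "i = inv p 0"
    have pi: "p i = 0" unfolding i_def using p by (simp add: permutes_inverses)
    have "i \<in> {..<Suc s}" using pi p by (metis permutes_not_in zero_less_Suc lessThan_iff)
    then have i: "i \<le> s" by simp
    \<comment> \<open>The element of the subgroup that carries \<open>p\<close> to the ascending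
      representative of its coset.\<close>
    let ?h = "perm_of [0..<i] \<circ> inv p"
    have hp: "?h \<circ> p = perm_of [0..<i]"
      using p by (simp add: comp_assoc permutes_inv_o)
    have "?h permutes {..<Suc s}" using perm[OF i] permutes_inv[OF p] by (intro permutes_compose)
    moreover have "?h 0 = 0" using perm_of_ascending[of i] by (simp add: i_def)
    ultimately have "perm_length (Suc s) p \<le> i" using min[of ?h] hp len[OF i] by simp
    moreover obtain js where js: "reduced_word (Suc s) js p" using p by (rule reduced_word_exists)
    ultimately have "length js \<le> i" by (simp add: reduced_word_def)
    have "perm_of js i = 0" using pi js by (simp add: reduced_word_def perm_word_perm_of)
    note zero = perm_of_to_zero[OF this]
    have "length js = i" using zero[THEN conjunct1] \<open>length js \<le> i\<close> by (rule order.antisym[rotated])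
    with zero[THEN conjunct2] have "js = [0..<i]" by (rule mp)
    moreover have "p = perm_of js" using js by (simp add: reduced_word_def perm_word_perm_of)
    ultimately have "p = perm_of [0..<i]" by (simp only:)
    then show "p \<in> (\<lambda>i. perm_of [0..<i]) ` {..s}"
      by (rule image_eqI) (simp add: i)
  next
    fix p assume "p \<in> (\<lambda>i. perm_of [0..<i]) ` {..s}"
    then obtain i where i: "i \<le> s" and p: "p = perm_of [0..<i]" by blast
    have "i \<le> perm_length (Suc s) (h \<circ> p)" if "h permutes {..<Suc s}" "h 0 = 0" for h
      using that perm[OF i] perm_of_ascending[of i] by (intro lower permutes_compose) (simp_all add: p)
    then show "p \<in> shuffles_of 1 s"
      unfolding shuffles_of_def fix0 using perm[OF i] len[OF i] by (simp add: p)
  qed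
qed

lemma shuffle_sum_1:
  assumes q: "q \<noteq> 0" and w: "w \<in> words (Suc s)"
  shows "shuffle_sum q 1 s \<xi> w = (\<Sum>i\<le>s. (- 1) ^ i *\<^sub>C foldr (braid_at q) [0..<i] \<xi> w)"
proof -
  have inj: "inj_on (\<lambda>i. perm_of [0..<i]) {..s}"
    by (rule inj_on_inverseI[of _ "\<lambda>p. inv p 0"]) (metis inj_perm_of inv_f_f perm_of_ascending)
  show ?thesis
    unfolding shuffle_sum_def signed_perm_sum_def shuffles_of_1 sum.reindex[OF inj] o_apply
    by (rule sum.cong) (use perm_op_reduced_word[OF q reduced_word_ascending w]
      in \<open>simp_all add: sign_perm_of\<close>)
qed

text \<open>For s = 0 there is a single coset, and the identity is its only element of length
  0.\<close>

lemma shuffle_sum_0_right: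
  assumes q: "q \<noteq> 0" and w: "w \<in> words k"
  shows "shuffle_sum q k 0 \<xi> w = \<xi> w"
proof -
  have id: "reduced_word k [] id"
    using reduced_word_normal[OF Nil_normal_words, of k "[]"] by (simp add: braid_equiv.refl)
  have "p = id" if p: "p permutes {..<k}" and min: "\<And>h. h permutes {..<k} \<Longrightarrow> perm_length k p \<le> perm_length k (h \<circ> p)" for p
  proof -
    obtain js where js: "reduced_word k js p" using p by (rule reduced_word_exists)
    have "perm_length k p \<le> 0"
      using min[OF permutes_inv[OF p]] id p by (simp add: permutes_inv_o reduced_word_def)
    with js have "js = []" by (simp add: reduced_word_def)
    with js show ?thesis by (simp add: reduced_word_def perm_word_perm_of)
  qed
  then have "shuffles_of k 0 = {id}"
    using id by (auto simp: shuffles_of_def permutes_image permutes_id reduced_word_def)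
  then show ?thesis
    using perm_op_reduced_word[OF q id w] by (simp add: shuffle_sum_def signed_perm_sum_def sign_id scaleC_one)
qed

section \<open>Symmetric tensors and the matrix of the antisymmetriser\<close>

text \<open>Six linear equations that force \<sigma>-invariance. Their ten-dimensional solution
  space yields the ten quadratic relations of \<open>exterior_relations\<close>; the products L_a
  L_b satisfy the same equations up to first-order terms (\<open>L_relations\<close>).\<close>

lemma sig_fixed:
  fixes N :: "idx \<Rightarrow> idx \<Rightarrow> 'v::complex_vector"
  assumes q: "q \<noteq> 0"
    and N: "N Zero Minus = N Minus Zero" "N Zero Plus = N Plus Zero" "N Zed Zero = N Zero Zed"
      "N Zed Minus = cr (q\<^sup>2) *\<^sub>C N Minus Zed" "N Zed Plus = cr (1 / q\<^sup>2) *\<^sub>C N Plus Zed"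
      "N Plus Minus = N Minus Plus - cr (q\<^sup>2 - 1 / q\<^sup>2) *\<^sub>C N Zed Zed + cr ((q - 1 / q)\<^sup>2) *\<^sub>C N Zero Zed"
  shows "sig q N x y = N x y"
proof (rule functionals_separate)
  fix g :: "'v \<Rightarrow> complex" assume g: "clinear g"
  interpret g: Vector_Spaces.linear scaleC scaleC g by (rule g)
  show "g (sig q N x y) = g (N x y)"
    unfolding sig_functional[OF g]
    by (cases x; cases y; simp only: idx.simps sig_rows_complex cr_qs_qt[OF q] N g.add g.diff g.scale scaleC_complex_def;
        simp add: algebra_simps qs_qt[OF q])
qed

definition basis_vec :: "idx list \<Rightarrow> complex coeffs" where
  "basis_vec w = (\<lambda>v. if v = w then 1 else 0)"

lemma finite_words: "finite (words k)"
  using finite_lists_length_eq[of "UNIV :: idx set" k] by (simp add: words_def)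

lemma basis_vec_expand:
  assumes "w \<in> words k"
  shows "\<xi> w = (\<Sum>v\<in>words k. \<xi> v *\<^sub>C basis_vec v w)"
  using assms finite_words by (simp add: basis_vec_def scaleC_complex_def if_distrib cong: if_cong)

lemma antisym_linear_map:
  fixes g :: "'v::complex_vector \<Rightarrow> 'w::complex_vector"
  assumes q: "q \<noteq> 0" and g: "clinear g" and w: "w \<in> words k"
  shows "g (antisym q k \<xi> w) = antisym q k (\<lambda>v. g (\<xi> v)) w"
proof -
  interpret g: Vector_Spaces.linear scaleC scaleC g by (rule g)
  have at: "g (braid_at q j \<zeta> v) = braid_at q j (\<lambda>v. g (\<zeta> v)) v" for j \<zeta> v
    by (simp add: braid_at_def g.sum split_beta g.scale)
  have "g (foldr (braid_at q) js \<xi> v) = foldr (braid_at q) js (\<lambda>v. g (\<xi> v)) v" for js v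
    by (induction js arbitrary: v) (simp_all add: at)
  then show ?thesis by (simp add: antisym_normal_words[OF q w] g.sum g.scale)
qed

text \<open>The antisymmetriser has a scalar matrix in the word basis, so forms with coefficients in
  the algebra are governed by complex computations.\<close>

lemma antisym_basis:
  fixes \<xi> :: "'v::complex_vector coeffs"
  assumes q: "q \<noteq> 0" and w: "w \<in> words k"
  shows "antisym q k \<xi> w = (\<Sum>v\<in>words k. antisym q k (basis_vec v) w *\<^sub>C \<xi> v)"
proof (rule functionals_separate)
  fix g :: "'v \<Rightarrow> complex" assume g: "clinear g"
  interpret g: Vector_Spaces.linear scaleC scaleC g by (rule g)
  have "g (antisym q k \<xi> w) = antisym q k (\<lambda>w. \<Sum>v\<in>words k. g (\<xi> v) *\<^sub>C basis_vec v w) w"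
    unfolding antisym_linear_map[OF q g w] by (rule antisym_cong[OF q basis_vec_expand w])
  then show "g (antisym q k \<xi> w) = g (\<Sum>v\<in>words k. antisym q k (basis_vec v) w *\<^sub>C \<xi> v)"
    unfolding antisym_sum[OF q w] by (simp add: g.sum g.scale scaleC_complex_def mult.commute)
qed

lemma antisym_symmetric_pair:
  assumes q: "q \<noteq> 0" and N: "\<And>x y. sig q N x y = N x y"
    and k: "length u + length v + 2 = k" and w: "w \<in> words k"
  shows "(\<Sum>(a, b)\<in>UNIV. N a b * antisym q k (basis_vec (u @ [a, b] @ v)) w) = 0"
proof -
  let ?j = "length u"
  \<comment> \<open>The tensor with \<open>N\<close> in the slots \<open>length u\<close> and
    \<open>Suc (length u)\<close>, and the fixed words \<open>u\<close>, \<open>v\<close> around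
    it.\<close>
  let ?\<xi> = "\<lambda>w. if take ?j w = u \<and> drop (?j + 2) w = v then N (w ! ?j) (w ! Suc ?j) else (0 :: complex)"
  have eq: "?\<xi> w = (\<Sum>p\<in>UNIV. N (fst p) (snd p) *\<^sub>C basis_vec (u @ [fst p, snd p] @ v) w)" if "w \<in> words k" for w
  proof -
    have "Suc ?j < length w" using that k by (simp add: words_iff)
    then have w: "w = take ?j w @ [w ! ?j, w ! Suc ?j] @ drop (?j + 2) w"
      by (simp add: Cons_nth_drop_Suc)
    have "(w = u @ [fst p, snd p] @ v) = (take ?j w = u \<and> drop (?j + 2) w = v \<and> p = (w ! ?j, w ! Suc ?j))" for p
      by (subst w) (use \<open>Suc ?j < length w\<close> in \<open>auto simp: append_eq_append_conv\<close>)
    then show ?thesis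
      by (auto simp: basis_vec_def scaleC_complex_def if_distrib cong: if_cong)
  qed
  have "antisym q k ?\<xi> w = 0"
  proof (rule antisym_kernel[OF q _ _ w])
    show "Suc ?j < k" using k by simp
    fix w :: "idx list" assume "w \<in> words k"
    then have "Suc ?j < length w" using k by (simp add: words_iff)
    then show "braid_at q ?j ?\<xi> w = ?\<xi> w"
      by (simp add: braid_at_sig N) (auto simp: sig_def)
  qed
  moreover have "antisym q k ?\<xi> w
      = antisym q k (\<lambda>w. \<Sum>p\<in>UNIV. N (fst p) (snd p) *\<^sub>C basis_vec (u @ [fst p, snd p] @ v) w) w"
    by (rule antisym_cong[OF q eq w])
  ultimately show ?thesis
    unfolding antisym_sum[OF q w] by (simp add: split_beta scaleC_complex_def)
qed

section \<open>Forms of top degree\<close>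

text \<open>The quadratic relations of the exterior algebra, read as rewriting rules that order a word
  along \<open>Minus, Plus, Zero, Zed\<close>.\<close>

definition exterior_relations :: "real \<Rightarrow> nat \<Rightarrow> (idx list \<Rightarrow> complex) \<Rightarrow> bool" where
  "exterior_relations q k G \<longleftrightarrow> (\<forall>u v. length u + length v + 2 = k \<longrightarrow>
     G (u @ [Minus, Minus] @ v) = 0 \<and> G (u @ [Plus, Plus] @ v) = 0 \<and> G (u @ [Zero, Zero] @ v) = 0 \<and>
     G (u @ [Zero, Minus] @ v) = - G (u @ [Minus, Zero] @ v) \<and>
     G (u @ [Zero, Plus] @ v) = - G (u @ [Plus, Zero] @ v) \<and>
     G (u @ [Zed, Minus] @ v) = - (qt q * G (u @ [Minus, Zed] @ v)) \<and>
     G (u @ [Zed, Plus] @ v) = - (qs q * G (u @ [Plus, Zed] @ v)) \<and>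
     G (u @ [Plus, Minus] @ v) = - G (u @ [Minus, Plus] @ v) \<and>
     G (u @ [Zed, Zed] @ v) = - ((qs q - qt q) * G (u @ [Minus, Plus] @ v)) \<and>
     G (u @ [Zed, Zero] @ v) = - G (u @ [Zero, Zed] @ v) + (qs q - 2 + qt q) * G (u @ [Minus, Plus] @ v))"

lemma exterior_relations_antisym:
  assumes q: "q \<noteq> 0" and w: "w \<in> words k"
  shows "exterior_relations q k (\<lambda>v. antisym q k (basis_vec v) w)"
proof -
  have pair: "(\<Sum>a\<in>UNIV. \<Sum>b\<in>UNIV. N a b * antisym q k (basis_vec (u @ [a, b] @ v)) w) = 0"
    if "length u + length v + 2 = k"
      "N Zero Minus = N Minus Zero" "N Zero Plus = N Plus Zero" "N Zed Zero = N Zero Zed"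
      "N Zed Minus = qs q * N Minus Zed" "N Zed Plus = qt q * N Plus Zed"
      "N Plus Minus = N Minus Plus - (qs q - qt q) * N Zed Zed + (qs q - 2 + qt q) * N Zero Zed" for N u v
    using antisym_symmetric_pair[OF q sig_fixed[OF q, of N] that(1) w] that(2-)
    unfolding cr_qs_qt[OF q] scaleC_complex_def sum_idx_pair by blast
  show ?thesis
    unfolding exterior_relations_def
  proof (intro allI impI)
    fix u v :: "idx list" assume uv: "length u + length v + 2 = k"
    let ?G = "\<lambda>v. antisym q k (basis_vec v) w"
    note [simp] = sum_idx qs_qt[OF q]
    \<comment> \<open>Each list names the nonzero entries of one of ten independent solutions of the
      equations in \<open>sig_fixed\<close>; each solution gives one relation.\<close>
    let ?N = "\<lambda>xs a b. \<Sum>(x, y, c)\<leftarrow>xs. if a = x \<and> b = y then c else (0 :: complex)"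
    show "?G (u @ [Minus, Minus] @ v) = 0 \<and> ?G (u @ [Plus, Plus] @ v) = 0 \<and> ?G (u @ [Zero, Zero] @ v) = 0 \<and>
     ?G (u @ [Zero, Minus] @ v) = - ?G (u @ [Minus, Zero] @ v) \<and>
     ?G (u @ [Zero, Plus] @ v) = - ?G (u @ [Plus, Zero] @ v) \<and>
     ?G (u @ [Zed, Minus] @ v) = - (qt q * ?G (u @ [Minus, Zed] @ v)) \<and>
     ?G (u @ [Zed, Plus] @ v) = - (qs q * ?G (u @ [Plus, Zed] @ v)) \<and>
     ?G (u @ [Plus, Minus] @ v) = - ?G (u @ [Minus, Plus] @ v) \<and>
     ?G (u @ [Zed, Zed] @ v) = - ((qs q - qt q) * ?G (u @ [Minus, Plus] @ v)) \<and>
     ?G (u @ [Zed, Zero] @ v) = - ?G (u @ [Zero, Zed] @ v) + (qs q - 2 + qt q) * ?G (u @ [Minus, Plus] @ v)"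
      using pair[OF uv, of "?N [(Minus, Minus, 1)]"] pair[OF uv, of "?N [(Plus, Plus, 1)]"]
        pair[OF uv, of "?N [(Zero, Zero, 1)]"]
        pair[OF uv, of "?N [(Zero, Minus, 1), (Minus, Zero, 1)]"]
        pair[OF uv, of "?N [(Zero, Plus, 1), (Plus, Zero, 1)]"]
        pair[OF uv, of "?N [(Zed, Minus, 1), (Minus, Zed, qt q)]"]
        pair[OF uv, of "?N [(Zed, Plus, 1), (Plus, Zed, qs q)]"]
        pair[OF uv, of "?N [(Minus, Plus, 1), (Plus, Minus, 1)]"]
        pair[OF uv, of "?N [(Zed, Zed, 1), (Plus, Minus, - (qs q - qt q))]"]
        pair[OF uv, of "?N [(Zed, Zero, 1), (Zero, Zed, 1), (Plus, Minus, qs q - 2 + qt q)]"]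
      by (simp add: algebra_simps add_eq_0_iff mult.commute[of "qt q" "qs q"])
  qed
qed

text \<open>Constraints on the coefficients of a tensor in the range of 1 - \<sigma>_j for every j.
  By contrast, \<open>exterior_relations\<close> describes how the antisymmetrised tensor depends on
  the word inserted.\<close>

definition dual_relations :: "real \<Rightarrow> nat \<Rightarrow> (idx list \<Rightarrow> complex) \<Rightarrow> bool" where
  "dual_relations q k M \<longleftrightarrow> (\<forall>u v. length u + length v + 2 = k \<longrightarrow>
     M (u @ [Minus, Minus] @ v) = 0 \<and> M (u @ [Plus, Plus] @ v) = 0 \<and>
     M (u @ [Zero, Zero] @ v) = 0 \<and> M (u @ [Zed, Zed] @ v) = 0 \<and>
     M (u @ [Plus, Minus] @ v) = - M (u @ [Minus, Plus] @ v) \<and>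
     M (u @ [Zed, Minus] @ v) = - M (u @ [Minus, Zed] @ v) \<and>
     M (u @ [Zed, Plus] @ v) = - M (u @ [Plus, Zed] @ v) \<and>
     M (u @ [Zed, Zero] @ v) = M (u @ [Minus, Plus] @ v) - M (u @ [Zero, Zed] @ v) \<and>
     M (u @ [Zero, Minus] @ v) = - qt q * (M (u @ [Minus, Zero] @ v) + (1 + qs q) * M (u @ [Minus, Zed] @ v)) \<and>
     M (u @ [Zero, Plus] @ v) = - qs q * (M (u @ [Plus, Zero] @ v) - (1 + qt q) * M (u @ [Plus, Zed] @ v)))"

lemma dual_relations_antisym:
  assumes q: "q \<noteq> 0"
  shows "dual_relations q k (antisym q k \<xi>)"
  unfolding dual_relations_def
proof (intro allI impI)
  fix u v :: "idx list" assume k: "length u + length v + 2 = k"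
  let ?j = "length u"
  have "Suc ?j < k" using k by simp
  from antisym_image[OF q this, of \<xi>] obtain \<eta>
    where \<eta>: "\<And>v. v \<in> words k \<Longrightarrow> antisym q k \<xi> v = \<eta> v - braid_at q ?j \<eta> v"
    by blast
  have M: "antisym q k \<xi> (u @ [x, y] @ v) = \<eta> (u @ [x, y] @ v) - sig q (\<lambda>a b. \<eta> (u @ [a, b] @ v)) x y" for x y
    using k by (simp add: \<eta> words_iff braid_at_sig nth_append list_update_append)
  let ?M = "antisym q k \<xi>"
  show "?M (u @ [Minus, Minus] @ v) = 0 \<and> ?M (u @ [Plus, Plus] @ v) = 0 \<and>
     ?M (u @ [Zero, Zero] @ v) = 0 \<and> ?M (u @ [Zed, Zed] @ v) = 0 \<and>
     ?M (u @ [Plus, Minus] @ v) = - ?M (u @ [Minus, Plus] @ v) \<and>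
     ?M (u @ [Zed, Minus] @ v) = - ?M (u @ [Minus, Zed] @ v) \<and>
     ?M (u @ [Zed, Plus] @ v) = - ?M (u @ [Plus, Zed] @ v) \<and>
     ?M (u @ [Zed, Zero] @ v) = ?M (u @ [Minus, Plus] @ v) - ?M (u @ [Zero, Zed] @ v) \<and>
     ?M (u @ [Zero, Minus] @ v) = - qt q * (?M (u @ [Minus, Zero] @ v) + (1 + qs q) * ?M (u @ [Minus, Zed] @ v)) \<and>
     ?M (u @ [Zero, Plus] @ v) = - qs q * (?M (u @ [Plus, Zero] @ v) - (1 + qt q) * ?M (u @ [Plus, Zed] @ v))"
    unfolding M
    by (simp add: sig_rows_complex[where q = q, unfolded cr_qs_qt[OF q]] algebra_simps qs_qt[OF q])
qed

abbreviation top_word :: "idx list" where "top_word \<equiv> [Minus, Plus, Zero, Zed]"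

lemma antisym_top_top:
  assumes q: "q \<noteq> 0"
  shows "antisym q 4 (basis_vec top_word) top_word = 1"
proof -
  \<comment> \<open>Congruence rules that freeze the coefficient family, so that evaluation proceeds
    from the outside inwards instead of normalising under the bound letters.\<close>
  have c1: "x = x' \<Longrightarrow> y = y' \<Longrightarrow> sig q G x y = sig q G x' y'" for G :: "idx \<Rightarrow> idx \<Rightarrow> complex" and x x' y y'
    by simp
  have c2: "w = w' \<Longrightarrow> braid_at q j \<xi> w = braid_at q j \<xi> w'" for j w w' and \<xi> :: "complex coeffs"
    by simp
  have c3: "k = k' \<Longrightarrow> w = w' \<Longrightarrow> antisym q k \<xi> w = antisym q k' \<xi> w'" for k k' w w' and \<xi> :: "complex coeffs"
    by simp
  have 0: "antisym q 0 \<xi> [] = \<xi> []" for \<xi> :: "complex coeffs"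
    by (simp add: antisym_normal_words[OF q] words_iff scaleC_one)
  note e = scaleC_complex_def words_iff atMost_Suc upt_rec braid_at_sig sig_rows_complex[where q = q, unfolded cr_qs_qt[OF q]]
  have 1: "antisym q (Suc 0) \<xi> [a] = \<xi> [a]" for \<xi> :: "complex coeffs" and a
    by (simp add: antisym_Suc[OF q] e 0)
  have 2: "antisym q (Suc (Suc 0)) \<xi> [a, b] = \<xi> [a, b] - sig q (\<lambda>a b. \<xi> [a, b]) a b" for \<xi> :: "complex coeffs" and a b
    by (simp add: antisym_Suc[OF q] e 1)
  show ?thesis
    by (simp add: numeral_eq_Suc antisym_Suc[OF q, of _ "Suc (Suc n)" for n] e 2 basis_vec_def cong: c1 c2 c3)
      (simp add: algebra_simps qs_qt[OF q])
qed

lemma exterior_relations_4: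
  assumes "exterior_relations q 4 G"
  shows
    "G [Minus, Minus, x, y] = 0" "G [x, Minus, Minus, y] = 0" "G [x, y, Minus, Minus] = 0"
    "G [Plus, Plus, x, y] = 0" "G [x, Plus, Plus, y] = 0" "G [x, y, Plus, Plus] = 0"
    "G [Zero, Zero, x, y] = 0" "G [x, Zero, Zero, y] = 0" "G [x, y, Zero, Zero] = 0"
    "G [Zero, Minus, x, y] = - G [Minus, Zero, x, y]"
    "G [x, Zero, Minus, y] = - G [x, Minus, Zero, y]"
    "G [x, y, Zero, Minus] = - G [x, y, Minus, Zero]"
    "G [Zero, Plus, x, y] = - G [Plus, Zero, x, y]"
    "G [x, Zero, Plus, y] = - G [x, Plus, Zero, y]"
    "G [x, y, Zero, Plus] = - G [x, y, Plus, Zero]"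
    "G [Zed, Minus, x, y] = - (qt q * G [Minus, Zed, x, y])"
    "G [x, Zed, Minus, y] = - (qt q * G [x, Minus, Zed, y])"
    "G [x, y, Zed, Minus] = - (qt q * G [x, y, Minus, Zed])"
    "G [Zed, Plus, x, y] = - (qs q * G [Plus, Zed, x, y])"
    "G [x, Zed, Plus, y] = - (qs q * G [x, Plus, Zed, y])"
    "G [x, y, Zed, Plus] = - (qs q * G [x, y, Plus, Zed])"
    "G [Plus, Minus, x, y] = - G [Minus, Plus, x, y]"
    "G [x, Plus, Minus, y] = - G [x, Minus, Plus, y]"
    "G [x, y, Plus, Minus] = - G [x, y, Minus, Plus]"
    "G [Zed, Zed, x, y] = - ((qs q - qt q) * G [Minus, Plus, x, y])"
    "G [x, Zed, Zed, y] = - ((qs q - qt q) * G [x, Minus, Plus, y])"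
    "G [x, y, Zed, Zed] = - ((qs q - qt q) * G [x, y, Minus, Plus])"
    "G [Zed, Zero, x, y] = - G [Zero, Zed, x, y] + (qs q - 2 + qt q) * G [Minus, Plus, x, y]"
    "G [x, Zed, Zero, y] = - G [x, Zero, Zed, y] + (qs q - 2 + qt q) * G [x, Minus, Plus, y]"
    "G [x, y, Zed, Zero] = - G [x, y, Zero, Zed] + (qs q - 2 + qt q) * G [x, y, Minus, Plus]"
  using assms[unfolded exterior_relations_def, rule_format, of "[]" "[x, y]"]
    assms[unfolded exterior_relations_def, rule_format, of "[x]" "[y]"]
    assms[unfolded exterior_relations_def, rule_format, of "[x, y]" "[]"]
  by simp_all

lemma words_4_cases:
  assumes "w \<in> words 4"
  obtains a b c d where "w = [a, b, c, d]"
  using assms by (auto simp: words_iff numeral_eq_Suc length_Suc_conv)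

lemma words_3_cases:
  assumes "w \<in> words 3"
  obtains a b c where "w = [a, b, c]"
  using assms by (auto simp: words_iff numeral_eq_Suc length_Suc_conv)

lemma exterior_relations_vanish:
  assumes G: "exterior_relations q 4 G" and top: "G top_word = 0" and w: "w \<in> words 4"
  shows "G w = 0"
proof -
  obtain a b c d where w: "w = [a, b, c, d]" using w by (rule words_4_cases)
  show ?thesis
    unfolding w by (cases a; cases b; cases c; cases d;
      simp only: exterior_relations_4[OF G] top mult_zero_right minus_zero add_0)
qed

text \<open>The two factors of the rank-one matrix of A^(4): \<open>vol_coeff\<close> depends on the
  input word, \<open>vol_form\<close> on the output word. Both take the value 1 at
  \<open>top_word\<close>.\<close>

definition vol_coeff :: "real \<Rightarrow> idx list \<Rightarrow> complex" where
  "vol_coeff q w = antisym q 4 (basis_vec w) top_word"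

definition vol_form :: "real \<Rightarrow> complex coeffs" where
  "vol_form q = antisym q 4 (basis_vec top_word)"

lemma exterior_relations_vol_coeff: "q \<noteq> 0 \<Longrightarrow> exterior_relations q 4 (vol_coeff q)"
  unfolding vol_coeff_def by (rule exterior_relations_antisym) (simp_all add: words_iff)

lemmas vol_coeff_rules = exterior_relations_4[OF exterior_relations_vol_coeff]

lemma vol_coeff_top: "q \<noteq> 0 \<Longrightarrow> vol_coeff q top_word = 1"
  by (simp add: vol_coeff_def antisym_top_top)

lemma exterior_relations_diff:
  assumes "exterior_relations q k G" "exterior_relations q k H"
  shows "exterior_relations q k (\<lambda>w. G w - H w * r)"
  using assms unfolding exterior_relations_def by simp (simp add: algebra_simps)

lemma exterior_relations_unique:
  assumes q: "q \<noteq> 0" and G: "exterior_relations q 4 G" and w: "w \<in> words 4"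
  shows "G w = vol_coeff q w * G top_word"
  using exterior_relations_vanish[OF exterior_relations_diff[OF G exterior_relations_vol_coeff[OF q], of "G top_word"] _ w]
  by (simp add: vol_coeff_top[OF q])

lemma antisym_4_basis:
  assumes q: "q \<noteq> 0" and w: "w \<in> words 4"
  shows "antisym q 4 (basis_vec w) v = vol_coeff q w * vol_form q v"
proof (cases "v \<in> words 4")
  case True
  then show ?thesis
    using exterior_relations_unique[OF q exterior_relations_antisym[OF q True] w] by (simp add: vol_form_def)
next
  case False
  have "basis_vec u \<in> tensors 4" if "u \<in> words 4" for u
    using that by (auto simp: tensors_def basis_vec_def)
  from antisym_tensors[OF this, of _ q] w False show ?thesis
    by (simp add: vol_form_def tensors_def words_iff)
qed

lemma antisym_4:
  fixes \<xi> :: "'v::complex_vector coeffs"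
  assumes q: "q \<noteq> 0" and \<xi>: "\<xi> \<in> tensors 4"
  shows "antisym q 4 \<xi> = (\<lambda>v. vol_form q v *\<^sub>C (\<Sum>w\<in>words 4. vol_coeff q w *\<^sub>C \<xi> w))"
proof
  fix v
  show "antisym q 4 \<xi> v = vol_form q v *\<^sub>C (\<Sum>w\<in>words 4. vol_coeff q w *\<^sub>C \<xi> w)"
  proof (cases "v \<in> words 4")
    case True
    then show ?thesis
      by (simp add: antisym_basis[OF q True, of \<xi>] antisym_4_basis[OF q] cv.scale_sum_right scaleC_scaleC mult.commute)
  next
    case False
    have "basis_vec top_word \<in> tensors 4" by (auto simp: tensors_def basis_vec_def words_iff)
    then show ?thesis
      using antisym_tensors[OF \<xi>, of q] antisym_tensors[of "basis_vec top_word" 4 q] False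
      by (simp add: vol_form_def tensors_def)
  qed
qed

lemma sum_words_0: "(\<Sum>w\<in>words 0. h w) = h []"
  by (simp add: words_def)

lemma sum_words_Suc: "(\<Sum>w\<in>words (Suc k). h w) = (\<Sum>a\<in>UNIV. \<Sum>w\<in>words k. h (a # w))"
proof -
  have "words (Suc k) = (\<lambda>(a, w). a # w) ` (UNIV \<times> words k)"
    by (auto simp: words_def length_Suc_conv)
  then show ?thesis
    by (simp add: sum.reindex inj_on_def split_beta sum.cartesian_product)
qed

lemma dual_relations_4:
  assumes "dual_relations q 4 M"
  shows
    "M [Minus, Minus, x, y] = 0" "M [x, Minus, Minus, y] = 0" "M [x, y, Minus, Minus] = 0"
    "M [Plus, Plus, x, y] = 0" "M [x, Plus, Plus, y] = 0" "M [x, y, Plus, Plus] = 0"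
    "M [Zero, Zero, x, y] = 0" "M [x, Zero, Zero, y] = 0" "M [x, y, Zero, Zero] = 0"
    "M [Zed, Zed, x, y] = 0" "M [x, Zed, Zed, y] = 0" "M [x, y, Zed, Zed] = 0"
    "M [Plus, Minus, x, y] = - M [Minus, Plus, x, y]"
    "M [x, Plus, Minus, y] = - M [x, Minus, Plus, y]"
    "M [x, y, Plus, Minus] = - M [x, y, Minus, Plus]"
    "M [Zed, Minus, x, y] = - M [Minus, Zed, x, y]"
    "M [x, Zed, Minus, y] = - M [x, Minus, Zed, y]"
    "M [x, y, Zed, Minus] = - M [x, y, Minus, Zed]"
    "M [Zed, Plus, x, y] = - M [Plus, Zed, x, y]"
    "M [x, Zed, Plus, y] = - M [x, Plus, Zed, y]"
    "M [x, y, Zed, Plus] = - M [x, y, Plus, Zed]"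
    "M [Zed, Zero, x, y] = M [Minus, Plus, x, y] - M [Zero, Zed, x, y]"
    "M [x, Zed, Zero, y] = M [x, Minus, Plus, y] - M [x, Zero, Zed, y]"
    "M [x, y, Zed, Zero] = M [x, y, Minus, Plus] - M [x, y, Zero, Zed]"
    "M [Zero, Minus, x, y] = - qt q * (M [Minus, Zero, x, y] + (1 + qs q) * M [Minus, Zed, x, y])"
    "M [x, Zero, Minus, y] = - qt q * (M [x, Minus, Zero, y] + (1 + qs q) * M [x, Minus, Zed, y])"
    "M [x, y, Zero, Minus] = - qt q * (M [x, y, Minus, Zero] + (1 + qs q) * M [x, y, Minus, Zed])"
    "M [Zero, Plus, x, y] = - qs q * (M [Plus, Zero, x, y] - (1 + qt q) * M [Plus, Zed, x, y])"
    "M [x, Zero, Plus, y] = - qs q * (M [x, Plus, Zero, y] - (1 + qt q) * M [x, Plus, Zed, y])"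
    "M [x, y, Zero, Plus] = - qs q * (M [x, y, Plus, Zero] - (1 + qt q) * M [x, y, Plus, Zed])"
  using assms[unfolded dual_relations_def, rule_format, of "[]" "[x, y]"]
    assms[unfolded dual_relations_def, rule_format, of "[x]" "[y]"]
    assms[unfolded dual_relations_def, rule_format, of "[x, y]" "[]"]
  by simp_all

lemma vol_form_top: "q \<noteq> 0 \<Longrightarrow> vol_form q top_word = 1"
  by (simp add: vol_form_def antisym_top_top)

lemma dual_relations_vol_form: "q \<noteq> 0 \<Longrightarrow> dual_relations q 4 (vol_form q)"
  unfolding vol_form_def by (rule dual_relations_antisym)

lemmas vol_form_rules = dual_relations_4[OF dual_relations_vol_form]

text \<open>The trace of the rank-one matrix A^(4), hence its eigenvalue on the volume form.\<close>

definition vol_eigenvalue :: "real \<Rightarrow> complex" where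
  "vol_eigenvalue q = (\<Sum>w\<in>words 4. vol_coeff q w * vol_form q w)"

text \<open>A q-analogue of 4!, namely 2 [2]^2 [3], with value 24 at q = 1. Its positivity for real
  nonzero q allows the eigenvalue to be cancelled in the Hodge duality.\<close>

lemma vol_eigenvalue:
  assumes q: "q \<noteq> 0"
  shows "vol_eigenvalue q = 2 * qt q * qt q + 6 * qt q + 8 + 6 * qs q + 2 * qs q * qs q"
proof -
  have c: "qs q * qt q = 1" "qt q * qs q = 1" "qs q * (qs q * qt q) = qs q" "qs q * (qt q * qt q) = qt q"
    "qs q * (qs q * (qt q * qt q)) = 1"
    by (simp_all add: qs_qt[OF q] mult.commute[of "qt q" "qs q"])
  have "vol_eigenvalue q = (\<Sum>a\<in>UNIV. \<Sum>b\<in>UNIV. \<Sum>c\<in>UNIV. \<Sum>d\<in>UNIV. vol_coeff q [a, b, c, d] * vol_form q [a, b, c, d])"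
    by (simp add: vol_eigenvalue_def numeral_eq_Suc sum_words_Suc sum_words_0)
  also have "\<dots> = 2 * qt q * qt q + 6 * qt q + 8 + 6 * qs q + 2 * qs q * qs q"
    by (simp add: sum_idx vol_coeff_rules[OF q] vol_form_rules[OF q] vol_coeff_top[OF q] vol_form_top[OF q])
      (simp only: c; simp)
  finally show ?thesis .
qed

lemma tensors_eqI:
  "\<xi> \<in> tensors k \<Longrightarrow> \<xi>' \<in> tensors k \<Longrightarrow> (\<And>w. w \<in> words k \<Longrightarrow> \<xi> w = \<xi>' w) \<Longrightarrow> \<xi> = \<xi>'"
proof
  fix w assume "\<xi> \<in> tensors k" "\<xi>' \<in> tensors k" and "\<And>w. w \<in> words k \<Longrightarrow> \<xi> w = \<xi>' w"
  then show "\<xi> w = \<xi>' w" by (cases "w \<in> words k") (simp_all add: tensors_def)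
qed

lemma antisym_id:
  assumes q: "q \<noteq> 0" and k: "k \<le> 1" and \<xi>: "\<xi> \<in> tensors k"
  shows "antisym q k \<xi> = \<xi>"
proof (rule tensors_eqI[OF antisym_tensors[OF \<xi>] \<xi>])
  fix w assume w: "w \<in> words k"
  from k have "k = 0 \<or> k = Suc 0" by auto
  then show "antisym q k \<xi> w = \<xi> w"
    by (auto simp: antisym_normal_words[OF q w] scaleC_one)
qed

section \<open>The conjugation\<close>

lemma conj_idx_conj_idx [simp]: "conj_idx (conj_idx a) = a"
  by (cases a) simp_all

definition rev_conj :: "idx list \<Rightarrow> idx list" where
  "rev_conj w = rev (map conj_idx w)"

lemma rev_conj_rev_conj [simp]: "rev_conj (rev_conj w) = w"
  by (simp add: rev_conj_def rev_map comp_def)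

lemma length_rev_conj [simp]: "length (rev_conj w) = length w"
  by (simp add: rev_conj_def)

lemma rev_conj_append: "rev_conj (u @ v) = rev_conj v @ rev_conj u"
  by (simp add: rev_conj_def)

lemma sum_rev_conj: "(\<Sum>w\<in>words k. h (rev_conj w)) = (\<Sum>w\<in>words k. h w)"
  by (rule sum.reindex_bij_witness[of _ rev_conj rev_conj]) (simp_all add: words_iff)

lemma dagger_3: "w \<in> words 3 \<Longrightarrow> dagger \<xi> w = cnj (\<xi> (rev_conj w))"
  by (simp add: dagger_def words_iff rev_conj_def)

lemma dagger_4: "w \<in> words 4 \<Longrightarrow> dagger \<xi> w = cnj (\<xi> (rev_conj w))"
  by (simp add: dagger_def words_iff rev_conj_def)

lemma dagger_tensors: "\<xi> \<in> tensors k \<Longrightarrow> dagger \<xi> \<in> tensors k"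
  by (auto simp: tensors_def dagger_def words_iff)

lemma cnj_qs_qt [simp]: "cnj (qs q) = qs q" "cnj (qt q) = qt q"
  by (simp_all add: qs_def qt_def)

text \<open>Reversing words and exchanging \<open>Minus\<close> with \<open>Plus\<close> permutes
  the relations among themselves up to scalars, so the conjugate of a solution is again a
  solution.\<close>

lemma exterior_relations_rev_conj:
  assumes q: "q \<noteq> 0" and G: "exterior_relations q k G"
  shows "exterior_relations q k (\<lambda>w. cnj (G (rev_conj w)))"
  unfolding exterior_relations_def
proof (intro allI impI)
  fix u v :: "idx list" assume "length u + length v + 2 = k"
  then have "length (rev_conj v) + length (rev_conj u) + 2 = k" by simp
  note r = G[unfolded exterior_relations_def, rule_format, OF this]
  have c: "rev_conj (u @ [x, y] @ v) = rev_conj v @ [conj_idx y, conj_idx x] @ rev_conj u" for x y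
    unfolding rev_conj_append by (simp add: rev_conj_def)
  let ?G = "\<lambda>w. cnj (G (rev_conj w))"
  show "?G (u @ [Minus, Minus] @ v) = 0 \<and> ?G (u @ [Plus, Plus] @ v) = 0 \<and> ?G (u @ [Zero, Zero] @ v) = 0 \<and>
     ?G (u @ [Zero, Minus] @ v) = - ?G (u @ [Minus, Zero] @ v) \<and>
     ?G (u @ [Zero, Plus] @ v) = - ?G (u @ [Plus, Zero] @ v) \<and>
     ?G (u @ [Zed, Minus] @ v) = - (qt q * ?G (u @ [Minus, Zed] @ v)) \<and>
     ?G (u @ [Zed, Plus] @ v) = - (qs q * ?G (u @ [Plus, Zed] @ v)) \<and>
     ?G (u @ [Plus, Minus] @ v) = - ?G (u @ [Minus, Plus] @ v) \<and>
     ?G (u @ [Zed, Zed] @ v) = - ((qs q - qt q) * ?G (u @ [Minus, Plus] @ v)) \<and>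
     ?G (u @ [Zed, Zero] @ v) = - ?G (u @ [Zero, Zed] @ v) + (qs q - 2 + qt q) * ?G (u @ [Minus, Plus] @ v)"
    unfolding c conj_idx.simps
    by (simp only: r) (simp add: qs_qt[OF q] mult.left_commute[of "qt q" "qs q"])
qed

text \<open>Solutions of the relations in degree four are proportional. The factor is found by
  sorting \<open>[Zed, Zero, Minus, Plus]\<close>, the reversed conjugate of
  \<open>top_word\<close>.\<close>

lemma vol_coeff_rev_conj:
  assumes q: "q \<noteq> 0" and w: "w \<in> words 4"
  shows "cnj (vol_coeff q (rev_conj w)) = - vol_coeff q w"
proof -
  have "rev_conj top_word = [Zed, Zero, Minus, Plus]" by (simp add: rev_conj_def)
  moreover have "vol_coeff q [Zed, Zero, Minus, Plus] = - 1"
    by (simp add: vol_coeff_rules[OF q] vol_coeff_top[OF q]) (simp add: algebra_simps qs_qt[OF q])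
  ultimately show ?thesis
    using exterior_relations_unique[OF q exterior_relations_rev_conj[OF q exterior_relations_vol_coeff[OF q]] w]
    by simp
qed

text \<open>Conjugating \<sigma> by the involution combined with the flip of the two factors gives
  the inverse of \<sigma>; on V \<otimes> V this reads \<sigma> dagger \<sigma> = dagger.\<close>

lemma sig_rev_conj:
  assumes q: "q \<noteq> 0"
  shows "sig q (\<lambda>a b. cnj (sig q H (conj_idx b) (conj_idx a))) x y = cnj (H (conj_idx y) (conj_idx x))"
  by (cases x; cases y;
      simp only: conj_idx.simps sig_rows_complex[where q = q, unfolded cr_qs_qt[OF q]] complex_cnj_add
        complex_cnj_diff complex_cnj_mult complex_cnj_minus complex_cnj_one complex_cnj_numeral cnj_qs_qt;
      simp add: algebra_simps qs_qt[OF q])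

lemma braid_dagger:
  assumes q: "q \<noteq> 0" and \<xi>: "\<xi> \<in> tensors 3"
  shows "braid_at q 0 (dagger (braid_at q 1 \<xi>)) = dagger \<xi>"
    "braid_at q 1 (dagger (braid_at q 0 \<xi>)) = dagger \<xi>"
proof -
  have "braid_at q 0 (dagger (braid_at q 1 \<xi>)) [a, b, c] = dagger \<xi> [a, b, c]"
    "braid_at q 1 (dagger (braid_at q 0 \<xi>)) [a, b, c] = dagger \<xi> [a, b, c]" for a b c
    using sig_rev_conj[OF q, of "\<lambda>x y. \<xi> [conj_idx c, x, y]" a b]
      sig_rev_conj[OF q, of "\<lambda>x y. \<xi> [x, y, conj_idx a]" b c]
    by (simp_all add: braid_at_sig dagger_3 words_iff rev_conj_def)
  then show "braid_at q 0 (dagger (braid_at q 1 \<xi>)) = dagger \<xi>"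
    "braid_at q 1 (dagger (braid_at q 0 \<xi>)) = dagger \<xi>"
    by (auto intro!: tensors_eqI[of _ 3] braid_at_tensors dagger_tensors \<xi> elim!: words_3_cases)
qed

lemma antisym_3:
  assumes q: "q \<noteq> 0" and \<xi>: "\<xi> \<in> tensors 3"
  shows "antisym q 3 \<xi> = (\<lambda>w. \<xi> w - braid_at q 0 \<xi> w - braid_at q 1 \<xi> w + braid_at q 0 (braid_at q 1 \<xi>) w
    + braid_at q 1 (braid_at q 0 \<xi>) w - braid_at q 1 (braid_at q 0 (braid_at q 1 \<xi>)) w)"
proof (rule tensors_eqI[OF antisym_tensors[OF \<xi>]])
  have "{..2::nat} = {0, 1, 2}" "{..1::nat} = {0, 1}" by auto
  then have nw: "normal_words 3 = {[], [1], [0], [0, 1], [1, 0], [1, 0, 1]}"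
    by (simp add: numeral_eq_Suc upt_rec)
  fix w :: "idx list" assume w: "w \<in> words 3"
  show "antisym q 3 \<xi> w = \<xi> w - braid_at q 0 \<xi> w - braid_at q 1 \<xi> w + braid_at q 0 (braid_at q 1 \<xi>) w
    + braid_at q 1 (braid_at q 0 \<xi>) w - braid_at q 1 (braid_at q 0 (braid_at q 1 \<xi>)) w"
    unfolding antisym_normal_words[OF q w] nw by (simp add: scaleC_one)
next
  show "(\<lambda>w. \<xi> w - braid_at q 0 \<xi> w - braid_at q 1 \<xi> w + braid_at q 0 (braid_at q 1 \<xi>) w
    + braid_at q 1 (braid_at q 0 \<xi>) w - braid_at q 1 (braid_at q 0 (braid_at q 1 \<xi>)) w) \<in> tensors 3"
    using \<xi> braid_at_tensors[OF \<xi>] braid_at_tensors[OF braid_at_tensors[OF \<xi>]]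
      braid_at_tensors[OF braid_at_tensors[OF braid_at_tensors[OF \<xi>]]]
    by (auto simp: tensors_def)
qed

text \<open>The dagger inverts each braid and exchanges the two generators. Multiplying the inverse
  braid of a permutation by the longest braid gives the positive braid of a complementary
  permutation, of opposite sign because the longest element of P(3) is odd. Hence the conjugate of a
  3-form does not depend on the chosen preimage.\<close>

lemma antisym_3_dagger:
  assumes q: "q \<noteq> 0" and \<xi>: "\<xi> \<in> tensors 3"
  shows "antisym q 3 (dagger \<xi>)
    = (\<lambda>w. - braid_at q 0 (braid_at q 1 (braid_at q 0 (dagger (antisym q 3 \<xi>)))) w)"
proof -
  note t = braid_at_tensors[where k = 3 and q = q]
  note d = dagger_tensors[where k = 3]
  let ?W = "\<lambda>\<zeta>. braid_at q 0 (braid_at q 1 (braid_at q 0 \<zeta>))"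
  have W: "?W \<zeta> = braid_at q 1 (braid_at q 0 (braid_at q 1 \<zeta>))" if "\<zeta> \<in> tensors 3" for \<zeta> :: "complex coeffs"
    by (rule tensors_eqI[of _ 3])
      (use that in \<open>auto intro!: t braid_at_relation[OF q, of 0] simp: words_iff\<close>)
  have lin: "braid_at q j (\<lambda>w. a w - b w - c w + e w + f w - g w)
      = (\<lambda>w. braid_at q j a w - braid_at q j b w - braid_at q j c w + braid_at q j e w
          + braid_at q j f w - braid_at q j g w)" for j and a b c e f g :: "complex coeffs"
    by (rule ext) (simp add: braid_at_def split_beta scaleC_complex_def ring_distribs sum.distrib sum_subtractf)
  have dlin: "dagger (\<lambda>w. a w - b w - c w + e w + f w - g w)
      = (\<lambda>w. dagger a w - dagger b w - dagger c w + dagger e w + dagger f w - dagger g w)"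
    for a b c e f g :: "complex coeffs"
    by (rule ext) (simp add: dagger_def ring_distribs)
  note bd = braid_dagger[OF q]
  \<comment> \<open>The longest braid is written so that its innermost factor meets the generator
    under the dagger, where \<open>braid_dagger\<close> cancels the two.\<close>
  have 0: "?W (dagger (braid_at q 0 \<zeta>)) = braid_at q 1 (braid_at q 0 (dagger \<zeta>))"
    and 1: "?W (dagger (braid_at q 1 \<zeta>)) = braid_at q 0 (braid_at q 1 (dagger \<zeta>))"
    if "\<zeta> \<in> tensors 3" for \<zeta> :: "complex coeffs"
    using that by (simp_all only: W t d bd)
  have 10: "?W (dagger (braid_at q 1 (braid_at q 0 \<xi>))) = braid_at q 0 (dagger \<xi>)"
    and 01: "?W (dagger (braid_at q 0 (braid_at q 1 \<xi>))) = braid_at q 1 (dagger \<xi>)"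
    and 101: "?W (dagger (braid_at q 1 (braid_at q 0 (braid_at q 1 \<xi>)))) = dagger \<xi>"
    using \<xi> by (simp_all only: 0 1 t bd)
  have "?W (dagger (antisym q 3 \<xi>)) = (\<lambda>w. - antisym q 3 (dagger \<xi>) w)"
    unfolding antisym_3[OF q \<xi>] antisym_3[OF q d[OF \<xi>]] dlin lin 0[OF \<xi>] 1[OF \<xi>] 10 01 101
      W[OF d[OF \<xi>]] by (rule ext) simp
  then show ?thesis by simp
qed

lemma preimage_forms:
  assumes "\<theta> \<in> forms q k"
  shows "preimage q k \<theta> \<in> tensors k" "antisym q k (preimage q k \<theta>) = \<theta>"
proof -
  have "\<exists>\<xi>. \<xi> \<in> tensors k \<and> antisym q k \<xi> = \<theta>" using assms unfolding forms_def by blast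
  from someI_ex[OF this] show "preimage q k \<theta> \<in> tensors k" "antisym q k (preimage q k \<theta>) = \<theta>"
    unfolding preimage_def by blast+
qed

lemma forms_tensors: "\<theta> \<in> forms q k \<Longrightarrow> \<theta> \<in> tensors k"
  unfolding forms_def using antisym_tensors by blast

lemma forms_low_degree: "q \<noteq> 0 \<Longrightarrow> k \<le> 1 \<Longrightarrow> forms q k = tensors k"
  unfolding forms_def by (force simp: antisym_id)

lemma preimage_low_degree:
  assumes "q \<noteq> 0" "k \<le> 1" "\<theta> \<in> tensors k"
  shows "preimage q k \<theta> = \<theta>"
  using preimage_forms[of \<theta> q k] assms by (metis forms_low_degree antisym_id)

lemma form_conj_3:
  assumes q: "q \<noteq> 0" and \<xi>: "\<xi> \<in> tensors 3"
  shows "form_conj q 3 (antisym q 3 \<xi>) = antisym q 3 (dagger \<xi>)"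
proof -
  have "antisym q 3 \<xi> \<in> forms q 3" using \<xi> by (simp add: forms_def)
  from preimage_forms[OF this] show ?thesis
    unfolding form_conj_def by (simp add: antisym_3_dagger[OF q] \<xi>)
qed

lemma form_conj_low_degree:
  assumes "q \<noteq> 0" "k \<le> 1" "\<xi> \<in> tensors k"
  shows "form_conj q k \<xi> = dagger \<xi>"
  unfolding form_conj_def by (simp add: preimage_low_degree[OF assms] antisym_id[OF assms(1,2) dagger_tensors[OF assms(3)]])

text \<open>The form determines the pairing of any preimage with \<open>vol_coeff\<close>, namely r,
  and by \<open>vol_coeff_rev_conj\<close> the dagger changes this number to -
  \<open>cnj r\<close>.\<close>

lemma form_conj_vol_form:
  assumes q: "q \<noteq> 0"
  shows "form_conj q 4 (\<lambda>w. r * vol_form q w) = (\<lambda>w. - cnj r * vol_form q w)"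
proof -
  let ?\<theta> = "\<lambda>w. r * vol_form q w"
  let ?\<xi> = "\<lambda>w. r * basis_vec top_word w"
  have \<xi>: "?\<xi> \<in> tensors 4" by (auto simp: tensors_def basis_vec_def words_iff)
  have "(\<Sum>w\<in>words 4. vol_coeff q w * ?\<xi> w) = r"
    using finite_words[of 4] by (simp add: basis_vec_def if_distrib vol_coeff_top[OF q] words_iff cong: if_cong)
  then have "antisym q 4 ?\<xi> = ?\<theta>"
    unfolding antisym_4[OF q \<xi>] by (simp add: scaleC_complex_def mult.commute)
  with \<xi> have "?\<theta> \<in> forms q 4" unfolding forms_def by (metis imageI)
  note p = preimage_forms[OF this]
  define p where "p = preimage q 4 ?\<theta>"
  have "r = vol_form q top_word * (\<Sum>w\<in>words 4. vol_coeff q w * p w)"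
    using fun_cong[OF p(2), of top_word] antisym_4[OF q p(1)]
    by (simp add: vol_form_top[OF q] scaleC_complex_def p_def)
  then have r: "r = (\<Sum>w\<in>words 4. vol_coeff q w * p w)" by (simp add: vol_form_top[OF q])
  have "(\<Sum>w\<in>words 4. vol_coeff q w * dagger p w) = (\<Sum>w\<in>words 4. vol_coeff q (rev_conj w) * cnj (p w))"
    using sum_rev_conj[of "\<lambda>w. vol_coeff q (rev_conj w) * cnj (p w)" 4]
    by (simp add: dagger_4 cong: sum.cong)
  also have "\<dots> = cnj (\<Sum>w\<in>words 4. cnj (vol_coeff q (rev_conj w)) * p w)"
    by simp
  also have "\<dots> = - cnj r"
    by (simp add: vol_coeff_rev_conj[OF q] r sum_negf cong: sum.cong)
  finally show ?thesis
    unfolding form_conj_def p_def[symmetric] antisym_4[OF q dagger_tensors[OF p(1)[folded p_def]]]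
    by (simp add: scaleC_complex_def mult.commute)
qed

section \<open>Hodge duality in degrees one and four\<close>

text \<open>Passing from rows to columns of the table keeps iterated braids of a basis word short
  sums of basis words.\<close>

lemma braid_at_basis_vec:
  assumes j: "Suc j < length w"
  shows "braid_at q j (basis_vec w) = (\<lambda>v. \<Sum>(x, y)\<in>UNIV.
    cr (braiding q (w ! j) (w ! Suc j) (x, y)) * basis_vec (w[j := x, Suc j := y]) v)"
proof
  fix v
  show "braid_at q j (basis_vec w) v = (\<Sum>(x, y)\<in>UNIV.
    cr (braiding q (w ! j) (w ! Suc j) (x, y)) * basis_vec (w[j := x, Suc j := y]) v)"
  proof (cases "length v = length w")
    case False
    then have "basis_vec w (v[j := a, Suc j := b]) = 0" "basis_vec (w[j := a, Suc j := b]) v = 0"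
      "basis_vec w v = 0" for a b
      unfolding basis_vec_def by auto
    then show ?thesis unfolding braid_at_def split_beta by simp
  next
    case len: True
    define P where "P \<longleftrightarrow> take j v = take j w \<and> drop (Suc (Suc j)) v = drop (Suc (Suc j)) w"
    have upd: "u[j := a, Suc j := b] = take j u @ [a, b] @ drop (Suc (Suc j)) u" if "Suc j < length u" for u :: "idx list" and a b
      using that by (simp add: upd_conv_take_nth_drop take_Suc_conv_app_nth list_update_append)
    have split: "u = take j u @ [u ! j, u ! Suc j] @ drop (Suc (Suc j)) u" if "Suc j < length u" for u :: "idx list"
      using that by (simp add: Cons_nth_drop_Suc)
    have lt: "length (take j v) = length (take j w)" using len by simp
    have 1: "(v[j := fst p, Suc j := snd p] = w) = (p = (w ! j, w ! Suc j) \<and> P)" for p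
      unfolding upd[OF j[folded len]] P_def
      by (subst split[OF j]) (use lt in \<open>cases p; auto simp: append_eq_append_conv\<close>)
    have 2: "(v = w[j := fst p, Suc j := snd p]) = (p = (v ! j, v ! Suc j) \<and> P)" for p
      unfolding upd[OF j] P_def
      by (subst split[OF j[folded len]]) (use lt in \<open>cases p; auto simp: append_eq_append_conv\<close>)
    have s: "(\<Sum>p\<in>UNIV. f p * (if p = r \<and> P then 1 else 0)) = (if P then f r else (0 :: complex))"
      for f and r :: "idx \<times> idx"
      by (simp add: if_distrib cong: if_cong)
    show ?thesis
      unfolding braid_at_def basis_vec_def split_beta 1 2 scaleC_complex_def s using j len by simp
  qed
qed

lemma braid_at_lin:
  fixes \<xi> :: "complex coeffs"
  shows "braid_at q j (\<lambda>w. \<xi> w + \<zeta> w) = (\<lambda>w. braid_at q j \<xi> w + braid_at q j \<zeta> w)"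
    "braid_at q j (\<lambda>w. - \<xi> w) = (\<lambda>w. - braid_at q j \<xi> w)"
    "braid_at q j (\<lambda>w. c * \<xi> w) = (\<lambda>w. c * braid_at q j \<xi> w)"
  by (rule ext, simp add: braid_at_def split_beta scaleC_complex_def ring_distribs sum.distrib sum_negf
      sum_distrib_left mult.left_commute)+

text \<open>The tensor B_(1,3) applied to \<open>top_word\<close>: the alternating sum of \<sigma>_0
  ... \<sigma>_(i-1) over i = 0, ..., 3, multiplied out with the table of \<sigma>.\<close>

definition top_shuffles :: "real \<Rightarrow> complex coeffs" where
  "top_shuffles q = (\<lambda>w. basis_vec [Minus, Plus, Zero, Zed] w + qt q * basis_vec [Zed, Zero, Zero, Zed] w
     - qt q * basis_vec [Plus, Minus, Zero, Zed] w + (1 - qs q) * basis_vec [Minus, Zero, Plus, Zed] w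
     + basis_vec [Zero, Minus, Plus, Zed] w - (1 + qt q) * basis_vec [Zed, Zero, Zero, Zero] w
     + (1 + qt q) * basis_vec [Plus, Minus, Zero, Zero] w
     - (1 + qs q) * basis_vec [Minus, Zero, Plus, Zero] w - basis_vec [Zed, Minus, Plus, Zero] w)"

lemma shuffle_sum_volume_tensor:
  assumes q: "q \<noteq> 0" and w: "w \<in> words 4"
  shows "shuffle_sum q 1 3 (volume_tensor m) w = \<i> * cr m * top_shuffles q w"
proof -
  have vol: "volume_tensor m = (\<lambda>w. \<i> * cr m * basis_vec top_word w)"
    by (rule ext) (simp add: volume_tensor_def basis_vec_def)
  have w': "w \<in> words (Suc 3)" using w by simp
  have q2: "qt q = 1 / (cr q)\<^sup>2" "qs q = (cr q)\<^sup>2" by (simp_all add: qt_def qs_def)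
  have s: "{..3::nat} = {0, 1, 2, 3}" by auto
  show ?thesis
    unfolding shuffle_sum_1[OF q w'] s
    by (simp add: vol upt_rec braid_at_lin braid_at_basis_vec sum_idx_pair sum_idx unit_vec_def top_shuffles_def
        scaleC_complex_def q2)
      (simp add: algebra_simps)
qed

lemma sum_top_shuffles:
  "(\<Sum>x\<in>words 4. L x * top_shuffles q x) = L [Minus, Plus, Zero, Zed] + qt q * L [Zed, Zero, Zero, Zed]
     - qt q * L [Plus, Minus, Zero, Zed] + (1 - qs q) * L [Minus, Zero, Plus, Zed]
     + L [Zero, Minus, Plus, Zed] - (1 + qt q) * L [Zed, Zero, Zero, Zero]
     + (1 + qt q) * L [Plus, Minus, Zero, Zero]
     - (1 + qs q) * L [Minus, Zero, Plus, Zero] - L [Zed, Minus, Plus, Zero]"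
proof -
  have b: "(\<Sum>x\<in>words 4. L x * (c * basis_vec w x)) = c * L w" if "w \<in> words 4" for w c
    using that finite_words by (simp add: basis_vec_def if_distrib cong: if_cong)
  have b1: "(\<Sum>x\<in>words 4. L x * basis_vec w x) = L w" if "w \<in> words 4" for w
    using b[OF that, of 1] by simp
  show ?thesis
    unfolding top_shuffles_def distrib_left right_diff_distrib sum.distrib sum_subtractf
    by (simp add: b b1 words_iff)
qed

text \<open>The Hodge dual of \<open>\<omega>\<^sub>a\<close> is the antisymmetrisation of \<open>tau q \<alpha> m a\<close>.\<close>

definition tau :: "real \<Rightarrow> real \<Rightarrow> real \<Rightarrow> idx \<Rightarrow> complex coeffs" where
  "tau q \<alpha> m a = dagger (contract (contraction_coeff q \<alpha>) 1 (basis_vec [a])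
     (shuffle_sum q 1 3 (volume_tensor m)))"

lemma words_0: "words 0 = {[]}"
  by (auto simp: words_iff)

lemma volume_tensor_tensors: "volume_tensor m \<in> tensors 4"
  by (auto simp: volume_tensor_def tensors_def words_iff)

lemma shuffle_sum_tensors:
  assumes "\<xi> \<in> tensors (k + s)"
  shows "shuffle_sum q k s \<xi> \<in> tensors (k + s)"
proof -
  have "perm_op q (k + s) p \<xi> w = 0" if "w \<notin> words (k + s)" for p w
    using braid_word_tensors[OF assms] that unfolding perm_op_def tensors_def by blast
  then show ?thesis by (simp add: tensors_def shuffle_sum_def signed_perm_sum_def)
qed

lemma contract_tensors:
  assumes "\<zeta> \<in> tensors (k + s)"
  shows "contract \<Gamma> k \<eta> \<zeta> \<in> tensors s"
proof -
  have "\<zeta> (v @ w) = 0" if "v \<in> words k" "w \<notin> words s" for v w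
    using assms that by (simp add: tensors_def words_iff)
  then show ?thesis by (simp add: tensors_def contract_def)
qed

lemma contract_1:
  "contract \<Gamma> 1 \<eta> \<zeta> w = (\<Sum>a\<in>UNIV. \<Sum>b\<in>UNIV. cnj (\<eta> [a]) * \<Gamma> a b * \<zeta> (b # w))"
  by (simp add: contract_def sum_words_Suc sum_words_0)

text \<open>These numbers are the coefficients of \<open>vol_form\<close> in \<omega>_b \<and>
  \<star>\<omega>_a. They equal -\<i> m times
  \<open>contraction_coeff q \<alpha> (conj_idx b) a\<close>, so the contraction reappears as the
  symbol of the Laplacian.\<close>

lemma pairing_tau:
  assumes q: "q \<noteq> 0"
  shows "(\<Sum>w\<in>words 3. vol_coeff q (b # w) * tau q \<alpha> m a w)
    = - \<i> * cr (m * \<alpha>) * (case (b, a) of (Plus, Minus) \<Rightarrow> 1 | (Minus, Plus) \<Rightarrow> qs q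
        | (Zero, Zed) \<Rightarrow> 1 - qs q | (Zed, Zero) \<Rightarrow> 1 - qs q | (Zed, Zed) \<Rightarrow> 1 + qs q | _ \<Rightarrow> 0)"
proof -
  let ?S = "shuffle_sum q 1 3 (volume_tensor m)"
  let ?\<Gamma> = "contraction_coeff q \<alpha>"
  have real: "cnj (?\<Gamma> a c) = ?\<Gamma> a c" for c by (simp add: contraction_coeff_def)
  have S: "?S (c # w) = \<i> * cr m * top_shuffles q (c # w)" if "w \<in> words 3" for c w
    using that by (intro shuffle_sum_volume_tensor[OF q]) (simp add: words_iff)
  have cnj_ts: "cnj (top_shuffles q w) = top_shuffles q w" for w
    by (simp add: top_shuffles_def basis_vec_def)
  have "tau q \<alpha> m a w = (\<Sum>c\<in>UNIV. ?\<Gamma> a c * (- \<i> * cr m * top_shuffles q (c # rev_conj w)))"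
    if "w \<in> words 3" for w
  proof -
    have "(\<Sum>x\<in>UNIV. \<Sum>c\<in>UNIV. cnj (basis_vec [a] [x]) * ?\<Gamma> x c * ?S (c # rev_conj w))
      = (\<Sum>c\<in>UNIV. ?\<Gamma> a c * ?S (c # rev_conj w))"
      by (subst sum.swap) (simp add: basis_vec_def if_distrib if_distribR cong: if_cong)
    with that show ?thesis
      by (simp add: tau_def dagger_3 contract_1[simplified] S[unfolded One_nat_def] words_iff real cnj_ts mult.assoc)
  qed
  then have "(\<Sum>w\<in>words 3. vol_coeff q (b # w) * tau q \<alpha> m a w)
    = (\<Sum>w\<in>words 3. \<Sum>c\<in>UNIV. vol_coeff q (b # rev_conj (rev_conj w)) *
        (?\<Gamma> a c * (- \<i> * cr m * top_shuffles q (c # rev_conj w))))"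
    by (simp add: sum_distrib_left)
  \<comment> \<open>Reindexing by \<open>rev_conj\<close> moves the reversal caused by the dagger
    from the shuffled tensor to the argument of \<open>vol_coeff\<close>.\<close>
  also have "\<dots> = (\<Sum>w\<in>words 3. \<Sum>c\<in>UNIV. vol_coeff q (b # rev_conj w) *
        (?\<Gamma> a c * (- \<i> * cr m * top_shuffles q (c # w))))"
    by (rule sum_rev_conj)
  also have "\<dots> = - \<i> * cr m * (\<Sum>x\<in>words 4. vol_coeff q (b # rev_conj (tl x)) * ?\<Gamma> a (hd x) * top_shuffles q x)"
    by (subst sum.swap) (simp add: numeral_eq_Suc sum_words_Suc sum_distrib_left mult_ac)
  also have "(\<Sum>x\<in>words 4. vol_coeff q (b # rev_conj (tl x)) * ?\<Gamma> a (hd x) * top_shuffles q x)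
    = cr \<alpha> * (case (b, a) of (Plus, Minus) \<Rightarrow> 1 | (Minus, Plus) \<Rightarrow> qs q
        | (Zero, Zed) \<Rightarrow> 1 - qs q | (Zed, Zero) \<Rightarrow> 1 - qs q | (Zed, Zed) \<Rightarrow> 1 + qs q | _ \<Rightarrow> 0)"
  proof -
    have \<Gamma>: "?\<Gamma> x y = cr \<alpha> * (case (x, y) of (Minus, Minus) \<Rightarrow> 1 | (Plus, Plus) \<Rightarrow> qs q
        | (Zero, Zed) \<Rightarrow> 1 - qs q | (Zed, Zero) \<Rightarrow> 1 - qs q | (Zed, Zed) \<Rightarrow> 1 + qs q | _ \<Rightarrow> 0)" for x y
      by (cases x; cases y) (simp_all add: contraction_coeff_def qs_def)
    show ?thesis
      unfolding sum_top_shuffles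
      by (cases a; cases b; simp add: \<Gamma> rev_conj_def vol_coeff_rules[OF q] vol_coeff_top[OF q];
          simp add: algebra_simps qs_qt[OF q])
  qed
  finally show ?thesis by simp
qed

section \<open>Hodge duality on 1-forms\<close>

definition star_1 :: "real \<Rightarrow> real \<Rightarrow> real \<Rightarrow> complex coeffs \<Rightarrow> complex coeffs" where
  "star_1 q \<alpha> m \<eta> = (\<lambda>w. \<Sum>a\<in>UNIV. \<eta> [a] * antisym q 3 (tau q \<alpha> m a) w)"

lemma tau_tensors: "tau q \<alpha> m a \<in> tensors 3"
  unfolding tau_def
  using shuffle_sum_tensors[of "volume_tensor m" 1 3 q] volume_tensor_tensors[of m]
  by (intro dagger_tensors contract_tensors) simp_all

text \<open>The contraction and the conjugation are both antilinear in the form, so their composite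
  is linear and determined by the four basis forms.\<close>

lemma star_1_eq:
  assumes q: "q \<noteq> 0"
  shows "form_conj q 3 (antisym q 3 (contract (contraction_coeff q \<alpha>) 1 \<eta> (shuffle_sum q 1 3 (volume_tensor m))))
    = star_1 q \<alpha> m \<eta>"
proof -
  let ?S = "shuffle_sum q 1 3 (volume_tensor m)"
  let ?c = "\<lambda>\<eta>. contract (contraction_coeff q \<alpha>) 1 \<eta> ?S"
  have S: "?S \<in> tensors (1 + 3)" using shuffle_sum_tensors[of "volume_tensor m" 1 3 q] volume_tensor_tensors[of m] by simp
  have "?c \<eta> w = (\<Sum>a\<in>UNIV. cnj (\<eta> [a]) * ?c (basis_vec [a]) w)" for w
  proof -
    have "?c (basis_vec [a]) w = (\<Sum>b\<in>UNIV. contraction_coeff q \<alpha> a b * ?S (b # w))" for a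
      unfolding contract_1
      by (subst sum.swap) (simp add: basis_vec_def if_distrib if_distribR cong: if_cong)
    then show ?thesis unfolding contract_1 by (simp add: sum_distrib_left mult.assoc)
  qed
  then have "dagger (?c \<eta>) w = (\<Sum>a\<in>UNIV. \<eta> [a] *\<^sub>C tau q \<alpha> m a w)" for w
    by (simp add: dagger_def tau_def scaleC_complex_def sum_distrib_left mult_ac)
  then have "dagger (?c \<eta>) = (\<lambda>w. \<Sum>a\<in>UNIV. \<eta> [a] *\<^sub>C tau q \<alpha> m a w)" ..
  moreover have "form_conj q 3 (antisym q 3 (?c \<eta>)) = antisym q 3 (dagger (?c \<eta>))"
    by (rule form_conj_3[OF q contract_tensors[OF S]])
  moreover have "antisym q 3 (\<lambda>w. \<Sum>a\<in>UNIV. \<eta> [a] *\<^sub>C tau q \<alpha> m a w) = star_1 q \<alpha> m \<eta>"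
  proof (rule tensors_eqI)
    show "antisym q 3 (\<lambda>w. \<Sum>a\<in>UNIV. \<eta> [a] *\<^sub>C tau q \<alpha> m a w) \<in> tensors 3"
      by (rule antisym_tensors) (use tau_tensors in \<open>simp add: tensors_def\<close>)
    show "star_1 q \<alpha> m \<eta> \<in> tensors 3"
      using antisym_tensors[OF tau_tensors] by (simp add: star_1_def tensors_def)
    show "antisym q 3 (\<lambda>w. \<Sum>a\<in>UNIV. \<eta> [a] *\<^sub>C tau q \<alpha> m a w) w = star_1 q \<alpha> m \<eta> w" if "w \<in> words 3" for w
      unfolding antisym_sum[OF q that] by (simp add: star_1_def scaleC_complex_def)
  qed
  ultimately show ?thesis by simp
qed

lemma dagger_eq_0:
  assumes "dagger \<eta> = (\<lambda>w. 0)"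
  shows "\<eta> = (\<lambda>w. 0)"
proof
  fix w
  have "dagger \<eta> (rev_conj w) = 0" using assms by simp
  then show "\<eta> w = 0" by (simp add: dagger_def rev_conj_def[symmetric])
qed

lemma star_1_sum: "star_1 q \<alpha> m (\<lambda>w. r * \<eta> w + s * \<eta>' w) = (\<lambda>w. r * star_1 q \<alpha> m \<eta> w + s * star_1 q \<alpha> m \<eta>' w)"
  by (rule ext) (simp add: star_1_def distrib_right sum.distrib sum_distrib_left mult.assoc)

lemma is_hodge_inv_linear:
  "is_hodge_inv q \<Gamma> m k T \<Longrightarrow> \<eta> \<in> inv_forms q k \<Longrightarrow> \<eta>' \<in> inv_forms q k \<Longrightarrow>
    T (\<lambda>w. r * \<eta> w + s * \<eta>' w) = (\<lambda>w. r * T \<eta> w + s * T \<eta>' w)"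
  by (simp add: is_hodge_inv_def)

lemma is_hodge_inv_eigen:
  "is_hodge_inv q \<Gamma> m k T \<Longrightarrow> \<eta> \<in> inv_forms q k \<Longrightarrow> \<eta> \<noteq> (\<lambda>w. 0) \<Longrightarrow>
    antisym q k \<eta> = (\<lambda>w. l * \<eta> w) \<Longrightarrow>
    antisym q k (form_conj q k \<eta>) = (\<lambda>w. l' * form_conj q k \<eta> w) \<Longrightarrow>
    T \<eta> = (\<lambda>w. l' / l * form_conj q (4 - k)
          (antisym q (4 - k) (contract \<Gamma> k \<eta> (shuffle_sum q k (4 - k) (volume_tensor m)))) w)"
  by (simp add: is_hodge_inv_def)

lemma forms_1: "q \<noteq> 0 \<Longrightarrow> forms q 1 = tensors 1"
  by (simp add: forms_low_degree)

text \<open>A^(1) is the identity, so every nonzero 1-form and its conjugate have eigenvalue 1 and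
  the ratio of eigenvalues disappears. The choice in \<open>hodge_inv\<close> is resolved by
  exhibiting one solution and proving that all solutions agree on 1-forms.\<close>

lemma hodge_inv_1:
  assumes q: "q \<noteq> 0" and \<eta>: "\<eta> \<in> tensors 1"
  shows "hodge_inv q (contraction_coeff q \<alpha>) m 1 \<eta> = star_1 q \<alpha> m \<eta>"
proof -
  let ?\<Gamma> = "contraction_coeff q \<alpha>"
  note forms = forms_1[OF q]
  have eigen: "l = 1" if t: "\<eta> \<in> tensors 1" "\<eta> \<noteq> (\<lambda>w. 0)" "antisym q 1 \<eta> = (\<lambda>w. l * \<eta> w)"
    for \<eta> :: "complex coeffs" and l
  proof -
    obtain w where w: "\<eta> w \<noteq> 0" using t(2) by auto
    have "\<eta> w = l * \<eta> w" using fun_cong[OF t(3), of w] t(1) by (simp add: antisym_id[OF q])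
    then show ?thesis using w by simp
  qed
  have star: "is_hodge_inv q ?\<Gamma> m 1 (star_1 q \<alpha> m)"
    unfolding is_hodge_inv_def forms
  proof (intro conjI ballI allI impI)
    fix \<eta> :: "complex coeffs" and l l' assume \<eta>: "\<eta> \<in> tensors 1"
    assume h: "\<eta> \<noteq> (\<lambda>w. 0) \<and> antisym q 1 \<eta> = (\<lambda>w. l * \<eta> w) \<and>
      antisym q 1 (form_conj q 1 \<eta>) = (\<lambda>w. l' * form_conj q 1 \<eta> w)"
    have c: "form_conj q 1 \<eta> = dagger \<eta>" using form_conj_low_degree[OF q _ \<eta>] by simp
    have "l = 1" using eigen[OF \<eta>] h by blast
    moreover have "l' = 1"
      using eigen[OF dagger_tensors[OF \<eta>]] h dagger_eq_0[of \<eta>] unfolding c by blast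
    ultimately show "star_1 q \<alpha> m \<eta> = (\<lambda>w. l' / l * form_conj q (4 - 1) (antisym q (4 - 1)
        (contract ?\<Gamma> 1 \<eta> (shuffle_sum q 1 (4 - 1) (volume_tensor m)))) w)"
      using star_1_eq[OF q, of \<alpha> \<eta> m] by simp
  qed (rule star_1_sum)
  have unique: "T \<eta> = star_1 q \<alpha> m \<eta>" if T: "is_hodge_inv q ?\<Gamma> m 1 T" for T
  proof (cases "\<eta> = (\<lambda>w. 0)")
    \<comment> \<open>The eigenvector clause excludes the zero form; its value follows from
      linearity with both coefficients 0.\<close>
    case True
    have "T (\<lambda>w. 0 * \<eta> w + 0 * \<eta> w) = (\<lambda>w. 0 * T \<eta> w + 0 * T \<eta> w)"
      using T \<eta> unfolding is_hodge_inv_def forms by blast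
    then show ?thesis using True by (simp add: star_1_def)
  next
    case False
    have c: "form_conj q 1 \<eta> = dagger \<eta>" using form_conj_low_degree[OF q _ \<eta>] by simp
    have "antisym q 1 \<eta> = (\<lambda>w. 1 * \<eta> w)"
      "antisym q 1 (form_conj q 1 \<eta>) = (\<lambda>w. 1 * form_conj q 1 \<eta> w)"
      using antisym_id[OF q order.refl \<eta>] antisym_id[OF q order.refl dagger_tensors[OF \<eta>]]
      unfolding c by simp_all
    with False \<eta> T have "T \<eta> = (\<lambda>w. 1 / 1 * form_conj q (4 - 1) (antisym q (4 - 1)
        (contract ?\<Gamma> 1 \<eta> (shuffle_sum q 1 (4 - 1) (volume_tensor m)))) w)"
      unfolding is_hodge_inv_def forms by blast
    then show ?thesis using star_1_eq[OF q, of \<alpha> \<eta> m] by simp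
  qed
  have "is_hodge_inv q ?\<Gamma> m 1 (hodge_inv q ?\<Gamma> m 1)"
    unfolding hodge_inv_def using star by (rule someI[of "is_hodge_inv q ?\<Gamma> m 1"])
  then show ?thesis by (rule unique)
qed

section \<open>Hodge duality on 4-forms\<close>

lemma vol_eigenvalue_nonzero:
  assumes q: "q \<noteq> 0"
  shows "vol_eigenvalue q \<noteq> 0"
proof -
  have "vol_eigenvalue q = cr (2 * (1 / q\<^sup>2)\<^sup>2 + 6 * (1 / q\<^sup>2) + 8 + 6 * q\<^sup>2 + 2 * (q\<^sup>2)\<^sup>2)"
    unfolding vol_eigenvalue[OF q] qs_def qt_def by (simp add: power2_eq_square)
  moreover have "2 * (1 / q\<^sup>2)\<^sup>2 + 6 * (1 / q\<^sup>2) + 8 + 6 * q\<^sup>2 + 2 * (q\<^sup>2)\<^sup>2 > 0"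
    by (intro add_nonneg_pos add_pos_nonneg) simp_all
  ultimately show ?thesis by (metis less_irrefl of_real_eq_0_iff)
qed

lemma forms_4:
  assumes q: "q \<noteq> 0"
  shows "\<theta> \<in> forms q 4 \<longleftrightarrow> (\<exists>x. \<theta> = (\<lambda>w. vol_form q w *\<^sub>C x))"
proof
  assume "\<theta> \<in> forms q 4"
  then show "\<exists>x. \<theta> = (\<lambda>w. vol_form q w *\<^sub>C x)"
    unfolding forms_def using antisym_4[OF q] by blast
next
  assume "\<exists>x. \<theta> = (\<lambda>w. vol_form q w *\<^sub>C x)"
  then obtain x where x: "\<theta> = (\<lambda>w. vol_form q w *\<^sub>C x)" by blast
  let ?\<xi> = "\<lambda>w. basis_vec top_word w *\<^sub>C x"
  have \<xi>: "?\<xi> \<in> tensors 4" by (auto simp: tensors_def basis_vec_def words_iff)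
  have "(\<Sum>w\<in>words 4. vol_coeff q w *\<^sub>C ?\<xi> w) = (\<Sum>w\<in>words 4. if w = top_word then x else 0)"
    by (rule sum.cong) (auto simp: basis_vec_def vol_coeff_top[OF q] scaleC_one)
  also have "\<dots> = x" using finite_words by (simp add: words_iff)
  finally have "antisym q 4 ?\<xi> = \<theta>" using antisym_4[OF q \<xi>] x by simp
  with \<xi> show "\<theta> \<in> forms q 4" unfolding forms_def by blast
qed

lemma vol_form_tensors: "vol_form q \<in> tensors 4"
  unfolding vol_form_def by (rule antisym_tensors) (auto simp: tensors_def basis_vec_def words_iff)

lemma antisym_vol_form:
  assumes q: "q \<noteq> 0"
  shows "antisym q 4 (\<lambda>w. r * vol_form q w) = (\<lambda>w. vol_eigenvalue q * (r * vol_form q w))"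
proof -
  have "(\<lambda>w. r * vol_form q w) \<in> tensors 4" using vol_form_tensors[of q] by (simp add: tensors_def)
  from antisym_4[OF q this] show ?thesis
    by (simp add: vol_eigenvalue_def scaleC_complex_def sum_distrib_left sum_distrib_right mult_ac)
qed

text \<open>Only the words - + z 0 and - + z z contract with \<open>top_word\<close> to something
  nonzero. On the second \<open>vol_form\<close> vanishes, and on the first it is -1, which accounts
  for the sign.\<close>

lemma contract_vol_form:
  assumes q: "q \<noteq> 0"
  shows "contract (contraction_coeff q \<alpha>) 4 (\<lambda>w. r * vol_form q w) (volume_tensor m) []
    = cnj r * (- \<i> * cr (m * q\<^sup>2 * \<alpha>\<^sup>2 * ((1 - q\<^sup>2) * \<alpha>)\<^sup>2))"
proof -
  let ?\<Gamma> = "contraction_coeff q \<alpha>"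
  have "contract ?\<Gamma> 4 (\<lambda>w. r * vol_form q w) (volume_tensor m) []
    = (\<Sum>u\<in>words 4. cnj (r * vol_form q u) * (\<Prod>i<4. ?\<Gamma> (u ! i) (top_word ! i)) * (\<i> * cr m))"
    unfolding contract_def
    by (rule sum.cong[OF HOL.refl]) (use finite_words in \<open>simp add: volume_tensor_def if_distrib words_iff cong: if_cong\<close>)
  also have "\<dots> = cnj r * (- \<i> * cr (m * q\<^sup>2 * \<alpha>\<^sup>2 * ((1 - q\<^sup>2) * \<alpha>)\<^sup>2))"
    by (simp add: numeral_eq_Suc sum_words_Suc sum_words_0 sum_idx contraction_coeff_def
        vol_form_rules[OF q] vol_form_top[OF q] power2_eq_square)
  finally show ?thesis .
qed

definition star_4_factor :: "real \<Rightarrow> real \<Rightarrow> real \<Rightarrow> complex" where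
  "star_4_factor q \<alpha> m = \<i> * cr (m * q\<^sup>2 * \<alpha>\<^sup>2 * ((1 - q\<^sup>2) * \<alpha>)\<^sup>2)"

text \<open>The volume form and its conjugate are multiples of each other, so both eigenvalues equal
  \<open>vol_eigenvalue q\<close> and cancel. What remains is the contraction to a scalar,
  conjugated.\<close>

lemma hodge_inv_4:
  assumes q: "q \<noteq> 0"
  shows "hodge_inv q (contraction_coeff q \<alpha>) m 4 (\<lambda>w. r * vol_form q w) = form0 (r * star_4_factor q \<alpha> m)"
proof -
  let ?\<Gamma> = "contraction_coeff q \<alpha>"
  let ?T = "\<lambda>\<eta>. form0 (\<eta> top_word * star_4_factor q \<alpha> m)"
  have forms: "\<eta> \<in> forms q 4 \<longleftrightarrow> (\<exists>r. \<eta> = (\<lambda>w. r * vol_form q w))" for \<eta> :: "complex coeffs"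
    using forms_4[OF q, of \<eta>] by (simp add: scaleC_complex_def mult.commute)
  have top: "vol_form q top_word = 1" by (rule vol_form_top[OF q])
  have formula: "form_conj q (4 - 4) (antisym q (4 - 4) (contract ?\<Gamma> 4 (\<lambda>w. r * vol_form q w)
      (shuffle_sum q 4 (4 - 4) (volume_tensor m)))) = form0 (r * star_4_factor q \<alpha> m)" for r
  proof -
    let ?c = "contract ?\<Gamma> 4 (\<lambda>w. r * vol_form q w) (volume_tensor m)"
    have c: "?c \<in> tensors 0" using volume_tensor_tensors by (intro contract_tensors) simp
    have "shuffle_sum q 4 0 (volume_tensor m) = volume_tensor m"
      by (rule tensors_eqI[of _ 4])
        (use shuffle_sum_tensors[of "volume_tensor m" 4 0 q] volume_tensor_tensors[of m]
          in \<open>simp_all add: shuffle_sum_0_right[OF q]\<close>)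
    moreover have "form_conj q 0 (antisym q 0 ?c) = dagger ?c"
      using c by (simp add: antisym_id[OF q] form_conj_low_degree[OF q])
    moreover have "dagger ?c = form0 (r * star_4_factor q \<alpha> m)"
    proof (rule tensors_eqI[OF dagger_tensors[OF c]])
      show "form0 (r * star_4_factor q \<alpha> m) \<in> tensors 0" by (simp add: form0_def tensors_def words_0)
      show "dagger ?c w = form0 (r * star_4_factor q \<alpha> m) w" if "w \<in> words 0" for w
        using that by (simp add: words_0 dagger_def form0_def contract_vol_form[OF q] star_4_factor_def)
    qed
    ultimately show ?thesis by simp
  qed
  have eigen: "l = vol_eigenvalue q"
    if "antisym q 4 (\<lambda>w. r * vol_form q w) = (\<lambda>w. l * (r * vol_form q w))" "r \<noteq> 0" for l r
    using fun_cong[OF that(1), of top_word] that(2) by (simp add: antisym_vol_form[OF q] top)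
  have "is_hodge_inv q ?\<Gamma> m 4 ?T"
    unfolding is_hodge_inv_def forms
  proof (intro conjI ballI allI impI)
    fix \<eta> \<eta>' :: "complex coeffs" and r s
    show "?T (\<lambda>w. r * \<eta> w + s * \<eta>' w) = (\<lambda>w. r * ?T \<eta> w + s * ?T \<eta>' w)"
      by (rule ext) (simp add: form0_def algebra_simps)
  next
    fix \<eta> :: "complex coeffs" and l l' assume "\<eta> \<in> forms q 4"
    then obtain r where \<eta>: "\<eta> = (\<lambda>w. r * vol_form q w)" unfolding forms by blast
    assume h: "\<eta> \<noteq> (\<lambda>w. 0) \<and> antisym q 4 \<eta> = (\<lambda>w. l * \<eta> w) \<and>
      antisym q 4 (form_conj q 4 \<eta>) = (\<lambda>w. l' * form_conj q 4 \<eta> w)"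
    then have r: "r \<noteq> 0" unfolding \<eta> by auto
    have l: "l = vol_eigenvalue q" using h r unfolding \<eta> by (intro eigen) auto
    have "l' = vol_eigenvalue q"
      using h r unfolding \<eta> form_conj_vol_form[OF q] by (intro eigen[of "- cnj r"]) auto
    then show "?T \<eta> = (\<lambda>w. l' / l * form_conj q (4 - 4) (antisym q (4 - 4)
        (contract ?\<Gamma> 4 \<eta> (shuffle_sum q 4 (4 - 4) (volume_tensor m)))) w)"
      unfolding \<eta> formula l using vol_eigenvalue_nonzero[OF q] top by simp
  qed
  then have T: "is_hodge_inv q ?\<Gamma> m 4 (hodge_inv q ?\<Gamma> m 4)"
    unfolding hodge_inv_def by (rule someI[of "is_hodge_inv q ?\<Gamma> m 4"])
  have mem: "(\<lambda>w. r * vol_form q w) \<in> forms q 4" unfolding forms by blast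
  show ?thesis
  proof (cases "r = 0")
    case True
    have "hodge_inv q ?\<Gamma> m 4 (\<lambda>w. 0 * (r * vol_form q w) + 0 * (r * vol_form q w))
      = (\<lambda>w. 0 * hodge_inv q ?\<Gamma> m 4 (\<lambda>w. r * vol_form q w) w + 0 * hodge_inv q ?\<Gamma> m 4 (\<lambda>w. r * vol_form q w) w)"
      by (rule is_hodge_inv_linear[OF T mem mem])
    then show ?thesis using True by (simp add: form0_def)
  next
    case False
    have nonzero: "(\<lambda>w. r * vol_form q w) \<noteq> (\<lambda>w. 0)"
      using False top fun_cong[of "\<lambda>w. r * vol_form q w" "\<lambda>w. 0" top_word] by auto
    have "antisym q 4 (form_conj q 4 (\<lambda>w. r * vol_form q w))
        = (\<lambda>w. vol_eigenvalue q * form_conj q 4 (\<lambda>w. r * vol_form q w) w)"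
      unfolding form_conj_vol_form[OF q] by (rule antisym_vol_form[OF q])
    from is_hodge_inv_eigen[OF T mem nonzero antisym_vol_form[OF q] this]
    have "hodge_inv q ?\<Gamma> m 4 (\<lambda>w. r * vol_form q w)
      = (\<lambda>w. vol_eigenvalue q / vol_eigenvalue q * form_conj q (4 - 4) (antisym q (4 - 4)
        (contract ?\<Gamma> 4 (\<lambda>w. r * vol_form q w) (shuffle_sum q 4 (4 - 4) (volume_tensor m)))) w)"
      .
    then show ?thesis unfolding formula using vol_eigenvalue_nonzero[OF q] by simp
  qed
qed

lemma hodge_left_4:
  fixes x :: "'a::complex_algebra_1"
  assumes q: "q \<noteq> 0"
  shows "hodge_left q (contraction_coeff q \<alpha>) m 4 (\<lambda>w. vol_form q w *\<^sub>C x) = form0 (star_4_factor q \<alpha> m *\<^sub>C x)"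
proof -
  let ?\<Gamma> = "contraction_coeff q \<alpha>"
  let ?k = "star_4_factor q \<alpha> m"
  have top: "vol_form q top_word = 1" by (rule vol_form_top[OF q])
  have forms: "\<eta> \<in> forms q 4 \<longleftrightarrow> (\<exists>r. \<eta> = (\<lambda>w. r * vol_form q w))" for \<eta> :: "complex coeffs"
    using forms_4[OF q, of \<eta>] by (simp add: scaleC_complex_def mult.commute)
  have "is_hodge_left q ?\<Gamma> m 4 (\<lambda>\<theta> :: 'a coeffs. form0 (?k *\<^sub>C \<theta> top_word))"
    unfolding is_hodge_left_def
  proof (intro conjI ballI allI)
    fix \<theta> \<theta>' :: "'a coeffs"
    show "form0 (?k *\<^sub>C (\<theta> top_word + \<theta>' top_word)) = (\<lambda>w. form0 (?k *\<^sub>C \<theta> top_word) w + form0 (?k *\<^sub>C \<theta>' top_word) w)"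
      by (rule ext) (simp add: form0_def scaleC_add_right)
  next
    fix x :: 'a and \<eta> :: "complex coeffs" assume "\<eta> \<in> inv_forms q 4"
    then obtain r where \<eta>: "\<eta> = (\<lambda>w. r * vol_form q w)" unfolding forms by blast
    show "form0 (?k *\<^sub>C left_mult x \<eta> top_word) = left_mult x (hodge_inv q ?\<Gamma> m 4 \<eta>)"
      unfolding \<eta> hodge_inv_4[OF q]
      by (rule ext) (simp add: form0_def left_mult_def top scaleC_scaleC mult.commute)
  qed
  then have T: "is_hodge_left q ?\<Gamma> m 4 (hodge_left q ?\<Gamma> m 4 :: 'a coeffs \<Rightarrow> _)"
    unfolding hodge_left_def by (rule someI[of "is_hodge_left q ?\<Gamma> m 4"])
  have "(\<lambda>w. 1 * vol_form q w) \<in> inv_forms q 4" unfolding forms by blast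
  then have "hodge_left q ?\<Gamma> m 4 (left_mult x (\<lambda>w. 1 * vol_form q w))
      = left_mult x (hodge_inv q ?\<Gamma> m 4 (\<lambda>w. 1 * vol_form q w))"
    using T unfolding is_hodge_left_def by blast
  then show ?thesis
    unfolding hodge_inv_4[OF q] by (auto simp: left_mult_def form0_def fun_eq_iff)
qed

lemma hodge_left_1:
  fixes X :: "idx \<Rightarrow> 'a::complex_algebra_1"
  assumes q: "q \<noteq> 0"
  shows "hodge_left q (contraction_coeff q \<alpha>) m 1 (form1 X)
    = (\<lambda>w. \<Sum>a\<in>UNIV. antisym q 3 (tau q \<alpha> m a) w *\<^sub>C X a)"
proof -
  let ?\<Gamma> = "contraction_coeff q \<alpha>"
  note forms = forms_1[OF q]
  have star_basis: "star_1 q \<alpha> m (basis_vec [a]) w = antisym q 3 (tau q \<alpha> m a) w" for a w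
    by (simp add: star_1_def basis_vec_def if_distrib if_distribR cong: if_cong)
  have basis: "basis_vec [a] \<in> tensors 1" for a by (auto simp: tensors_def basis_vec_def words_iff)
  have "is_hodge_left q ?\<Gamma> m 1 (\<lambda>\<theta> :: 'a coeffs. \<lambda>w. \<Sum>a\<in>UNIV. antisym q 3 (tau q \<alpha> m a) w *\<^sub>C \<theta> [a])"
    unfolding is_hodge_left_def forms
  proof (intro conjI ballI allI)
    fix x :: 'a and \<eta> :: "complex coeffs" assume \<eta>: "\<eta> \<in> tensors 1"
    show "(\<lambda>w. \<Sum>a\<in>UNIV. antisym q 3 (tau q \<alpha> m a) w *\<^sub>C left_mult x \<eta> [a]) = left_mult x (hodge_inv q ?\<Gamma> m 1 \<eta>)"
      unfolding hodge_inv_1[OF q \<eta>]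
      by (rule ext) (simp add: left_mult_def star_1_def scaleC_scaleC cv.scale_sum_left mult.commute)
  qed (simp add: scaleC_add_right sum.distrib)
  then have T: "is_hodge_left q ?\<Gamma> m 1 (hodge_left q ?\<Gamma> m 1 :: 'a coeffs \<Rightarrow> _)"
    unfolding hodge_left_def by (rule someI[of "is_hodge_left q ?\<Gamma> m 1"])
  let ?H = "hodge_left q ?\<Gamma> m 1 :: 'a coeffs \<Rightarrow> _"
  let ?m = "\<lambda>a. left_mult (X a) (basis_vec [a])"
  have add: "?H (\<lambda>w. \<theta> w + \<theta>' w) = (\<lambda>w. ?H \<theta> w + ?H \<theta>' w)" if "\<theta> \<in> tensors 1" "\<theta>' \<in> tensors 1" for \<theta> \<theta>'
    using T that unfolding is_hodge_left_def forms by blast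
  have m: "?m a \<in> tensors 1" for a using basis by (simp add: tensors_def left_mult_def)
  have add_mem: "(\<lambda>w. \<theta> w + \<theta>' w) \<in> tensors 1" if "\<theta> \<in> tensors 1" "\<theta>' \<in> tensors 1" for \<theta> \<theta>' :: "'a coeffs"
    using that by (simp add: tensors_def)
  have H: "?H (?m a) = (\<lambda>w. antisym q 3 (tau q \<alpha> m a) w *\<^sub>C X a)" for a
  proof -
    have "?H (?m a) = left_mult (X a) (hodge_inv q ?\<Gamma> m 1 (basis_vec [a]))"
      using T basis unfolding is_hodge_left_def forms by blast
    then show ?thesis unfolding hodge_inv_1[OF q basis] by (simp add: left_mult_def star_basis)
  qed
  \<comment> \<open>\<open>is_hodge_left\<close> gives additivity and the value on
    \<open>left_mult x \<eta>\<close>, so the 1-form is split into its four components.\<close>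
  have "form1 X = (\<lambda>w. ((?m Minus w + ?m Plus w) + ?m Zero w) + ?m Zed w)"
  proof
    fix w show "form1 X w = ((?m Minus w + ?m Plus w) + ?m Zero w) + ?m Zed w"
    proof (cases w)
      case (Cons a v)
      then show ?thesis by (cases v; cases a) (simp_all add: form1_def left_mult_def basis_vec_def scaleC_one)
    qed (simp add: form1_def left_mult_def basis_vec_def)
  qed
  then show ?thesis by (simp only: add m add_mem H sum_idx)
qed

section \<open>Actions of dually paired Hopf algebras\<close>

lemma cbilinearI:
  assumes "\<And>x x' y. B (x + x') y = B x y + B x' y" "\<And>x y y'. B x (y + y') = B x y + B x y'"
    "\<And>r x y. B (r *\<^sub>C x) y = r *\<^sub>C B x y" "\<And>r x y. B x (r *\<^sub>C y) = r *\<^sub>C B x y"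
  shows "cbilinear B"
  using assms unfolding cbilinear_def clinear_iff by simp

lemma cbilinearD:
  assumes "cbilinear B"
  shows "B (x + x') y = B x y + B x' y" "B x (y + y') = B x y + B x y'"
    "B (r *\<^sub>C x) y = r *\<^sub>C B x y" "B x (r *\<^sub>C y) = r *\<^sub>C B x y"
  using assms unfolding cbilinear_def clinear_iff by auto

lemma clinearD:
  assumes "clinear g"
  shows "g (x + y) = g x + g y" "g (r *\<^sub>C x) = r *\<^sub>C g x" "g 0 = 0" "g (- x) = - g x" "g (x - y) = g x - g y"
proof -
  interpret g: Vector_Spaces.linear scaleC scaleC g by fact
  show "g (x + y) = g x + g y" "g (r *\<^sub>C x) = r *\<^sub>C g x" "g 0 = 0" "g (- x) = - g x" "g (x - y) = g x - g y"
    by (simp_all add: g.add g.scale g.zero g.neg g.diff)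
qed

lemmas tensor_lift_linear = clinearD[OF clinear_tensor_lift]

lemma linear_tensor_lift:
  assumes "clinear g"
  shows "g (tensor_lift B t) = tensor_lift (\<lambda>x y. g (B x y)) t"
proof -
  interpret g: Vector_Spaces.linear scaleC scaleC g by fact
  show ?thesis by (simp add: tensor_lift_def free_lift_def g.sum g.scale split_beta)
qed

context hopf_algebra
begin

lemma comult_linear: "\<Delta> (x + y) = \<Delta> x + \<Delta> y" "\<Delta> (r *\<^sub>C x) = r *\<^sub>C \<Delta> x"
  using comult_hom by (simp_all add: algebra_hom_def clinear_iff)

lemma comult_mult: "\<Delta> (x * y) = \<Delta> x * \<Delta> y" and comult_one: "\<Delta> 1 = 1 \<otimes> 1"
  using comult_hom by (simp_all add: algebra_hom_def one_tensor_def)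

text \<open>Coassociativity as it is used in Sweedler notation: a trilinear expression in the three
  legs may be read with either bracketing.\<close>

lemma coassoc_trilinear:
  fixes T :: "'a \<Rightarrow> 'a \<Rightarrow> 'a \<Rightarrow> 'c::complex_vector"
  assumes T1: "\<And>y z. clinear (\<lambda>x. T x y z)" and T2: "\<And>x z. clinear (\<lambda>y. T x y z)" and T3: "\<And>x y. clinear (T x y)"
  shows "tensor_lift (\<lambda>x z. tensor_lift (\<lambda>x1 x2. T x1 x2 z) (\<Delta> x)) (\<Delta> w)
    = tensor_lift (\<lambda>x y. tensor_lift (\<lambda>y1 y2. T x y1 y2) (\<Delta> y)) (\<Delta> w)"
proof -
  note t = clinearD(1,2)[OF T1] clinearD(1,2)[OF T2] clinearD(1,2)[OF T3]
  note p = tensor_pure_add_left tensor_pure_add_right tensor_pure_scaleC_left tensor_pure_scaleC_right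
  have B23: "cbilinear (T x)" for x by (rule cbilinearI) (simp_all add: t)
  have B12: "cbilinear (\<lambda>x1 x2. T x1 x2 z)" for z by (rule cbilinearI) (simp_all add: t)
  have Tx: "T (x + x') = (\<lambda>a b. T x a b + T x' a b)" "T (r *\<^sub>C x) = (\<lambda>a b. r *\<^sub>C T x a b)" for x x' r
    by (intro ext; simp add: t)+
  let ?L = "tensor_lift (\<lambda>x t. tensor_lift (T x) t)"
  have BL: "cbilinear (\<lambda>x t. tensor_lift (T x) t)"
    by (rule cbilinearI) (simp_all add: Tx tensor_lift_fun_add tensor_lift_fun_scaleC tensor_lift_linear[OF B23])
  have BR: "cbilinear (\<lambda>x y. tensor_lift (T x) (\<Delta> y))"
    by (rule cbilinearI)
      (simp_all add: Tx tensor_lift_fun_add tensor_lift_fun_scaleC comult_linear tensor_lift_linear[OF B23])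
  have BLeft: "cbilinear (\<lambda>x z. tensor_lift (\<lambda>x1 x2. T x1 x2 z) (\<Delta> x))"
    by (rule cbilinearI)
      (simp_all add: t tensor_lift_fun_add tensor_lift_fun_scaleC comult_linear tensor_lift_linear[OF B12])
  have Bid: "cbilinear (\<lambda>x y. x \<otimes> \<Delta> y)" "cbilinear (\<lambda>x y. \<Delta> x \<otimes> y)"
    by (rule cbilinearI; simp add: comult_linear p)+
  have Ba: "cbilinear (\<lambda>x y. x \<otimes> (y \<otimes> z))" for z :: 'a
    by (rule cbilinearI) (simp_all add: p)
  have Bassoc: "cbilinear (\<lambda>t z. tensor_lift (\<lambda>x y. x \<otimes> (y \<otimes> z)) t :: ('a, ('a, 'a) tensor) tensor)"
    by (rule cbilinearI) (simp_all add: p tensor_lift_fun_add tensor_lift_fun_scaleC tensor_lift_linear[OF Ba])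
  have right: "?L (tensor_map id \<Delta> s) = tensor_lift (\<lambda>x y. tensor_lift (T x) (\<Delta> y)) s" for s
    unfolding tensor_map_def id_apply
    by (induction s rule: tensor_induct)
      (simp_all add: tensor_lift_pure[OF BL] tensor_lift_pure[OF BR] tensor_lift_pure[OF Bid(1)]
        tensor_lift_linear[OF BL] tensor_lift_linear[OF BR] tensor_lift_linear[OF Bid(1)])
  have left0: "?L (tensor_lift (\<lambda>x y. x \<otimes> (y \<otimes> z)) t) = tensor_lift (\<lambda>x1 x2. T x1 x2 z) t" for z t
    by (induction t rule: tensor_induct)
      (simp_all add: tensor_lift_pure[OF BL] tensor_lift_pure[OF Ba] tensor_lift_pure[OF B12] tensor_lift_pure[OF B23]
        tensor_lift_linear[OF BL] tensor_lift_linear[OF Ba] tensor_lift_linear[OF B12])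
  have left: "?L (tensor_assoc (tensor_map \<Delta> id s)) = tensor_lift (\<lambda>x z. tensor_lift (\<lambda>x1 x2. T x1 x2 z) (\<Delta> x)) s" for s
    unfolding tensor_map_def tensor_assoc_def id_apply
    by (induction s rule: tensor_induct)
      (simp_all add: tensor_lift_pure[OF Bid(2)] tensor_lift_pure[OF Bassoc] left0 tensor_lift_pure[OF BLeft]
        tensor_lift_linear[OF BL] tensor_lift_linear[OF Bassoc] tensor_lift_linear[OF BLeft] tensor_lift_linear[OF Bid(2)])
  show ?thesis using left right coassoc by metis
qed

end

context hopf_pairing
begin

abbreviation lact (infixr "\<triangleright>" 75) where "h \<triangleright> x \<equiv> left_action \<Delta>A pair h x"
abbreviation ract (infixl "\<triangleleft>" 75) where "x \<triangleleft> h \<equiv> right_action \<Delta>A pair x h"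

lemmas pair_linear = cbilinearD[OF pair_bilinear]

lemma cbilinear_lact: "cbilinear (\<lambda>x1 x2. pair h x2 *\<^sub>C x1)"
  by (rule cbilinearI) (simp_all add: pair_linear scaleC_add_left scaleC_add_right scaleC_scaleC scaleC_complex_def mult_ac)

lemma cbilinear_ract: "cbilinear (\<lambda>x1 x2. pair h x1 *\<^sub>C x2)"
  by (rule cbilinearI) (simp_all add: pair_linear scaleC_add_left scaleC_add_right scaleC_scaleC scaleC_complex_def mult_ac)

lemma clinear_lact: "clinear (left_action \<Delta>A pair h)"
  unfolding clinear_iff left_action_def
  by (simp add: A.comult_linear tensor_lift_linear[OF cbilinear_lact])

lemma clinear_ract: "clinear (\<lambda>x. right_action \<Delta>A pair x h)"
  unfolding clinear_iff right_action_def
  by (simp add: A.comult_linear tensor_lift_linear[OF cbilinear_ract])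

lemmas lact_linear = clinearD[OF clinear_lact]
lemmas ract_linear = clinearD[OF clinear_ract]

lemma lact_add: "(h + k) \<triangleright> x = h \<triangleright> x + k \<triangleright> x"
  by (simp add: left_action_def pair_linear scaleC_add_left tensor_lift_fun_add)

lemma lact_scaleC: "(r *\<^sub>C h) \<triangleright> x = r *\<^sub>C (h \<triangleright> x)"
  unfolding left_action_def
  by (subst tensor_lift_fun_scaleC[symmetric]) (simp add: pair_linear scaleC_complex_def)

lemma ract_add: "x \<triangleleft> (h + k) = x \<triangleleft> h + x \<triangleleft> k"
  by (simp add: right_action_def pair_linear scaleC_add_left tensor_lift_fun_add)

lemma ract_scaleC: "x \<triangleleft> (r *\<^sub>C h) = r *\<^sub>C (x \<triangleleft> h)"
  unfolding right_action_def
  by (subst tensor_lift_fun_scaleC[symmetric]) (simp add: pair_linear scaleC_complex_def)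

lemma ract_diff: "x \<triangleleft> (h - k) = x \<triangleleft> h - x \<triangleleft> k"
  using ract_add[of x "h - k" k] by simp

lemma clinear_lact_left: "clinear (\<lambda>h. h \<triangleright> x)"
  by (simp add: clinear_iff lact_add lact_scaleC)

lemma lact_one: "1 \<triangleright> x = x"
  by (simp add: left_action_def pair_one_left A.counit_right)

lemma ract_one: "x \<triangleleft> 1 = x"
  by (simp add: right_action_def pair_one_left A.counit_left)

lemma lact_unit: "h \<triangleright> 1 = \<epsilon>U h *\<^sub>C 1"
  by (simp add: left_action_def A.comult_one tensor_lift_pure[OF cbilinear_lact] pair_one_right)

lemma ract_unit: "1 \<triangleleft> h = \<epsilon>U h *\<^sub>C 1"
  by (simp add: right_action_def A.comult_one tensor_lift_pure[OF cbilinear_ract] pair_one_right)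

lemma clinear_scaleC_const: "clinear (\<lambda>r. r *\<^sub>C x)" for x :: "'c::complex_vector"
  by (simp add: clinear_iff scaleC_add_left scaleC_scaleC scaleC_complex_def)

lemma lact_mult: "(h * k) \<triangleright> x = h \<triangleright> (k \<triangleright> x)"
proof -
  have "h \<triangleright> (k \<triangleright> x) = tensor_lift (\<lambda>x z. pair k z *\<^sub>C (h \<triangleright> x)) (\<Delta>A x)"
    unfolding left_action_def[of _ _ k] by (simp add: linear_tensor_lift[OF clinear_lact] lact_linear)
  also have "\<dots> = tensor_lift (\<lambda>x z. tensor_lift (\<lambda>x1 x2. (pair h x2 * pair k z) *\<^sub>C x1) (\<Delta>A x)) (\<Delta>A x)"
    unfolding left_action_def by (simp only: tensor_lift_fun_scaleC[symmetric] scaleC_scaleC mult.commute)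
  also have "\<dots> = tensor_lift (\<lambda>x y. tensor_lift (\<lambda>y1 y2. (pair h y1 * pair k y2) *\<^sub>C x) (\<Delta>A y)) (\<Delta>A x)"
    by (rule A.coassoc_trilinear)
      (simp_all add: clinear_iff pair_linear scaleC_add_left scaleC_add_right scaleC_scaleC scaleC_complex_def algebra_simps)
  also have "\<dots> = (h * k) \<triangleright> x"
    unfolding left_action_def pair_mult_left by (simp add: linear_tensor_lift[OF clinear_scaleC_const])
  finally show ?thesis ..
qed

lemma ract_mult: "x \<triangleleft> (h * k) = x \<triangleleft> h \<triangleleft> k"
proof -
  have "x \<triangleleft> h \<triangleleft> k = tensor_lift (\<lambda>x y. pair h x *\<^sub>C (y \<triangleleft> k)) (\<Delta>A x)"
    unfolding right_action_def[of _ _ _ h] by (simp add: linear_tensor_lift[OF clinear_ract] ract_linear)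
  also have "\<dots> = tensor_lift (\<lambda>x y. tensor_lift (\<lambda>y1 y2. (pair h x * pair k y1) *\<^sub>C y2) (\<Delta>A y)) (\<Delta>A x)"
    unfolding right_action_def by (simp only: tensor_lift_fun_scaleC[symmetric] scaleC_scaleC)
  also have "\<dots> = tensor_lift (\<lambda>x z. tensor_lift (\<lambda>x1 x2. (pair h x1 * pair k x2) *\<^sub>C z) (\<Delta>A x)) (\<Delta>A x)"
    by (rule A.coassoc_trilinear[symmetric])
      (simp_all add: clinear_iff pair_linear scaleC_add_left scaleC_add_right scaleC_scaleC scaleC_complex_def algebra_simps)
  also have "\<dots> = x \<triangleleft> (h * k)"
    unfolding right_action_def pair_mult_left
    by (rule arg_cong[of _ _ "\<lambda>B. tensor_lift B (\<Delta>A x)"], intro ext)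
      (rule linear_tensor_lift[OF clinear_scaleC_const, symmetric])
  finally show ?thesis ..
qed

text \<open>In a threefold coproduct \<open>k\<close> pairs with the first leg and \<open>h\<close>
  with the third, so the order of the actions does not matter.\<close>

lemma ract_lact: "right_action \<Delta>A pair (left_action \<Delta>A pair h x) k = left_action \<Delta>A pair h (right_action \<Delta>A pair x k)"
proof -
  have "right_action \<Delta>A pair (left_action \<Delta>A pair h x) k
      = tensor_lift (\<lambda>x z. pair h z *\<^sub>C right_action \<Delta>A pair x k) (\<Delta>A x)"
    unfolding left_action_def by (simp add: linear_tensor_lift[OF clinear_ract] ract_linear)
  also have "\<dots> = tensor_lift (\<lambda>x z. tensor_lift (\<lambda>x1 x2. (pair k x1 * pair h z) *\<^sub>C x2) (\<Delta>A x)) (\<Delta>A x)"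
    unfolding right_action_def by (simp only: tensor_lift_fun_scaleC[symmetric] scaleC_scaleC mult.commute)
  also have "\<dots> = tensor_lift (\<lambda>x y. tensor_lift (\<lambda>y1 y2. (pair k x * pair h y2) *\<^sub>C y1) (\<Delta>A y)) (\<Delta>A x)"
    by (rule A.coassoc_trilinear)
      (simp_all add: clinear_iff pair_linear scaleC_add_left scaleC_add_right scaleC_scaleC scaleC_complex_def algebra_simps)
  also have "\<dots> = tensor_lift (\<lambda>x y. pair k x *\<^sub>C left_action \<Delta>A pair h y) (\<Delta>A x)"
    unfolding left_action_def by (simp only: tensor_lift_fun_scaleC[symmetric] scaleC_scaleC)
  also have "\<dots> = left_action \<Delta>A pair h (right_action \<Delta>A pair x k)"
    unfolding right_action_def by (simp add: linear_tensor_lift[OF clinear_lact] lact_linear)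
  finally show ?thesis .
qed

lemma lact_prod: "h \<triangleright> (x * y) = tensor_lift (\<lambda>h1 h2. (h1 \<triangleright> x) * (h2 \<triangleright> y)) (\<Delta>U h)"
proof -
  let ?l = "\<lambda>h. tensor_lift (\<lambda>x1 x2. pair h x2 *\<^sub>C x1)"
  note tl = tensor_lift_linear[OF cbilinear_lact]
  have "?l h (s * t) = tensor_lift (\<lambda>h1 h2. ?l h1 s * ?l h2 t) (\<Delta>U h)" for s t
  proof (induction s rule: tensor_induct)
    case (pure x1 x2)
    show ?case
    proof (induction t rule: tensor_induct)
      case (pure y1 y2)
      show ?case
        by (simp add: times_tensor_pure tensor_lift_pure[OF cbilinear_lact] pair_mult_right
            linear_tensor_lift[OF clinear_scaleC_const] scaleC_mult_left scaleC_mult_right scaleC_scaleC mult.commute)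
    qed (simp add: times_tensor_right tl distrib_left tensor_lift_fun_add)
  qed (simp add: times_tensor_left tl distrib_right tensor_lift_fun_add)
  then show ?thesis unfolding left_action_def A.comult_mult .
qed

lemma ract_prod: "(x * y) \<triangleleft> h = tensor_lift (\<lambda>h1 h2. (x \<triangleleft> h1) * (y \<triangleleft> h2)) (\<Delta>U h)"
proof -
  let ?r = "\<lambda>h. tensor_lift (\<lambda>x1 x2. pair h x1 *\<^sub>C x2)"
  note tl = tensor_lift_linear[OF cbilinear_ract]
  have "?r h (s * t) = tensor_lift (\<lambda>h1 h2. ?r h1 s * ?r h2 t) (\<Delta>U h)" for s t
  proof (induction s rule: tensor_induct)
    case (pure x1 x2)
    show ?case
    proof (induction t rule: tensor_induct)
      case (pure y1 y2)
      show ?case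
        by (simp add: times_tensor_pure tensor_lift_pure[OF cbilinear_ract] pair_mult_right
            linear_tensor_lift[OF clinear_scaleC_const] scaleC_mult_left scaleC_mult_right scaleC_scaleC mult.commute)
    qed (simp add: times_tensor_right tl distrib_left tensor_lift_fun_add)
  qed (simp add: times_tensor_left tl distrib_right tensor_lift_fun_add)
  then show ?thesis unfolding right_action_def A.comult_mult .
qed

end

section \<open>Generators, relations and their actions\<close>

lemma presented_relation:
  assumes "presented_by g R" and "r \<in> R"
  shows "free_eval g r = 0"
proof -
  have "free_lift (\<lambda>w. monom ([] @ w @ [])) r \<in> free_ideal R"
    unfolding free_ideal_def using assms(2) by (intro cv.span_base) blast
  then show ?thesis using assms(1) by (simp add: presented_by_def free_lift_monom)
qed

lemma free_eval_linear:
  "free_eval g (x + y) = free_eval g x + free_eval g y" "free_eval g (x - y) = free_eval g x - free_eval g y"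
  "free_eval g (r *\<^sub>C x) = r *\<^sub>C free_eval g x" "free_eval g (monom w) = prod_list (map g w)"
  unfolding free_eval_def by (simp_all add: clinearD[OF clinear_free_lift] free_lift_single scaleC_one)

context suq2_duality
begin

lemma U_relations:
  "K * Ki = 1" "Ki * K = 1" "K * E = cr q *\<^sub>C (E * K)" "Ki * E = cr (1 / q) *\<^sub>C (E * Ki)"
  "K * F = cr (1 / q) *\<^sub>C (F * K)" "Ki * F = cr q *\<^sub>C (F * Ki)"
  "E * F = F * E + cr (1 / (q - 1 / q)) *\<^sub>C (K * K - Ki * Ki)"
  using presented_relation[OF U.presented, of "monom [GK, GK_inv] - monom []"]
    presented_relation[OF U.presented, of "monom [GK_inv, GK] - monom []"]
    presented_relation[OF U.presented, of "monom [GK, GE] - cr q *\<^sub>C monom [GE, GK]"]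
    presented_relation[OF U.presented, of "monom [GK_inv, GE] - cr (1 / q) *\<^sub>C monom [GE, GK_inv]"]
    presented_relation[OF U.presented, of "monom [GK, GF] - cr (1 / q) *\<^sub>C monom [GF, GK]"]
    presented_relation[OF U.presented, of "monom [GK_inv, GF] - cr q *\<^sub>C monom [GF, GK_inv]"]
    presented_relation[OF U.presented, of "monom [GE, GF] - monom [GF, GE]
        - cr (1 / (q - 1 / q)) *\<^sub>C (monom [GK, GK] - monom [GK_inv, GK_inv])"]
  by (simp_all add: uqsu2_relations_def free_eval_linear algebra_simps)

lemma A_relations:
  "a * c = cr q *\<^sub>C (c * a)" "a * star c = cr q *\<^sub>C (star c * a)" "c * star c = star c * c"
  "star a * a = 1 - star c * c" "a * star a = 1 - cr (q\<^sup>2) *\<^sub>C (c * star c)"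
  "star c * star a = cr q *\<^sub>C (star a * star c)" "c * star a = cr q *\<^sub>C (star a * c)"
  using presented_relation[OF A.presented, of "monom [Ga, Gc] - cr q *\<^sub>C monom [Gc, Ga]"]
    presented_relation[OF A.presented, of "monom [Ga, Gc_star] - cr q *\<^sub>C monom [Gc_star, Ga]"]
    presented_relation[OF A.presented, of "monom [Gc, Gc_star] - monom [Gc_star, Gc]"]
    presented_relation[OF A.presented, of "monom [Ga_star, Ga] + monom [Gc_star, Gc] - monom []"]
    presented_relation[OF A.presented, of "monom [Ga, Ga_star] + cr (q\<^sup>2) *\<^sub>C monom [Gc, Gc_star] - monom []"]
    presented_relation[OF A.presented, of "monom [Gc_star, Ga_star] - cr q *\<^sub>C monom [Ga_star, Gc_star]"]
    presented_relation[OF A.presented, of "monom [Gc, Ga_star] - cr q *\<^sub>C monom [Ga_star, Gc]"]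
  by (simp_all add: suq2_relations_def free_eval_linear eq_diff_eq)

abbreviation h where "h \<equiv> cr (q powr (1 / 2))"
abbreviation hi where "hi \<equiv> cr (q powr (- 1 / 2))"

lemma q_nonzero: "q \<noteq> 0" and cr_q_nonzero: "cr q \<noteq> 0"
  using q_range by auto

lemma h_hi: "h * hi = 1" "hi * h = 1" "h * h = cr q" "hi * hi = cr (1 / q)"
  using q_range by (simp_all flip: of_real_mult powr_add add: powr_minus_divide)

lemma h_nonzero: "h \<noteq> 0" "hi \<noteq> 0"
  using h_hi by auto

lemma lact_pure: "\<Delta>A x = x1 \<otimes> x2 + y1 \<otimes> y2 \<Longrightarrow> k \<triangleright> x = pair k x2 *\<^sub>C x1 + pair k y2 *\<^sub>C y1"
  by (simp add: left_action_def tensor_lift_linear[OF P.cbilinear_lact] tensor_lift_pure[OF P.cbilinear_lact])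

lemma ract_pure: "\<Delta>A x = x1 \<otimes> x2 + y1 \<otimes> y2 \<Longrightarrow> x \<triangleleft> k = pair k x1 *\<^sub>C x2 + pair k y1 *\<^sub>C y2"
  by (simp add: right_action_def tensor_lift_linear[OF P.cbilinear_ract] tensor_lift_pure[OF P.cbilinear_ract])

lemma pair_scaleC: "pair k (r *\<^sub>C x) = r * pair k x" "pair k (- x) = - pair k x"
  using P.pair_linear(4)[of k r x] P.pair_linear(4)[of k "- 1" x] by (simp_all add: scaleC_complex_def)

lemma comult_star_c: "\<Delta>A (star c) = a \<otimes> star c + star c \<otimes> star a"
proof -
  have "(- cr q) *\<^sub>C \<Delta>A (star c) = \<Delta>A ((- cr q) *\<^sub>C star c)"
    by (simp only: A.comult_linear)
  also have "\<dots> = (- cr q) *\<^sub>C (a \<otimes> star c + star c \<otimes> star a)"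
    unfolding A.comult_c_star by (simp only: tensor_pure_scaleC_left tensor_pure_scaleC_right scaleC_add_right)
  finally show ?thesis using cr_q_nonzero by (simp only: cv.scale_cancel_left neg_equal_0_iff_equal) simp
qed

lemma lact_gen:
  "K \<triangleright> a = hi *\<^sub>C a" "K \<triangleright> star a = h *\<^sub>C star a" "K \<triangleright> c = hi *\<^sub>C c" "K \<triangleright> star c = h *\<^sub>C star c"
  "Ki \<triangleright> a = h *\<^sub>C a" "Ki \<triangleright> star a = hi *\<^sub>C star a" "Ki \<triangleright> c = h *\<^sub>C c" "Ki \<triangleright> star c = hi *\<^sub>C star c"
  "E \<triangleright> a = - (cr q *\<^sub>C star c)" "E \<triangleright> star a = 0" "E \<triangleright> c = star a" "E \<triangleright> star c = 0"
  "F \<triangleright> a = 0" "F \<triangleright> star a = c" "F \<triangleright> c = 0" "F \<triangleright> star c = - (cr (1 / q) *\<^sub>C a)"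
  using cr_q_nonzero q_nonzero
  by (simp_all add: lact_pure[OF A.comult_a] lact_pure[OF A.comult_c] lact_pure[OF A.comult_a_star]
      lact_pure[OF comult_star_c] pair_scaleC pair_K pair_Ki pair_E pair_F scaleC_one)

lemma ract_gen:
  "a \<triangleleft> K = hi *\<^sub>C a" "star a \<triangleleft> K = h *\<^sub>C star a" "c \<triangleleft> K = h *\<^sub>C c" "star c \<triangleleft> K = hi *\<^sub>C star c"
  "a \<triangleleft> Ki = h *\<^sub>C a" "star a \<triangleleft> Ki = hi *\<^sub>C star a" "c \<triangleleft> Ki = hi *\<^sub>C c" "star c \<triangleleft> Ki = h *\<^sub>C star c"
  "a \<triangleleft> E = 0" "star a \<triangleleft> E = - (cr q *\<^sub>C star c)" "c \<triangleleft> E = a" "star c \<triangleleft> E = 0"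
  "a \<triangleleft> F = c" "star a \<triangleleft> F = 0" "c \<triangleleft> F = 0" "star c \<triangleleft> F = - (cr (1 / q) *\<^sub>C star a)"
  using cr_q_nonzero q_nonzero
  by (simp_all add: ract_pure[OF A.comult_a] ract_pure[OF A.comult_c] ract_pure[OF A.comult_a_star]
      ract_pure[OF comult_star_c] pair_scaleC pair_K pair_Ki pair_E pair_F scaleC_one)

text \<open>\<open>K\<close> is group-like and invertible, which forces the value 1. Applying the
  counit to \<open>K * E = cr q *\<^sub>C (E * K)\<close>, and to the analogous relation of
  \<open>Ki\<close> with \<open>F\<close>, gives a number equal to q times itself.\<close>

lemma counit_gen: "\<epsilon>U K = 1" "\<epsilon>U Ki = 1" "\<epsilon>U E = 0" "\<epsilon>U F = 0"
proof -
  note lin = clinearD(1,2)[OF U.counit_hom[unfolded algebra_hom_def, THEN conjunct1]]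
  have hom: "\<epsilon>U (x * y) = \<epsilon>U x * \<epsilon>U y" "\<epsilon>U (r *\<^sub>C x) = r * \<epsilon>U x" "\<epsilon>U 1 = 1" for x y r
    using U.counit_hom lin(2)[of r x] by (simp_all add: algebra_hom_def scaleC_complex_def)
  have B: "cbilinear (\<lambda>x1 x2. \<epsilon>U x1 *\<^sub>C x2)"
    by (intro cbilinearI) (simp_all add: lin scaleC_complex_def scaleC_add_left scaleC_add_right scaleC_scaleC mult.commute)
  have "\<epsilon>U K *\<^sub>C K = K" using U.counit_left[of K] by (simp add: U.comult_K tensor_lift_pure[OF B])
  then have "\<epsilon>U K *\<^sub>C (K * Ki) = K * Ki" by (metis scaleC_mult_left)
  then have "\<epsilon>U K *\<^sub>C (1 :: 'u) = 1 *\<^sub>C 1" by (simp add: U_relations scaleC_one)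
  then show K: "\<epsilon>U K = 1" by (simp only: cv.scale_cancel_right) simp
  show Ki: "\<epsilon>U Ki = 1" using hom(1)[of K Ki] by (simp add: U_relations hom K)
  have "\<epsilon>U E = cr q * \<epsilon>U E" using arg_cong[OF U_relations(3), of \<epsilon>U] by (simp add: hom K)
  then show "\<epsilon>U E = 0" using q_range by auto
  have "\<epsilon>U F = cr q * \<epsilon>U F" using arg_cong[OF U_relations(6), of \<epsilon>U] by (simp add: hom Ki)
  then show "\<epsilon>U F = 0" using q_range by auto
qed

lemma cbilinear_lact_pair: "cbilinear (\<lambda>h1 h2. (h1 \<triangleright> x) * (h2 \<triangleright> y))"
  by (rule cbilinearI) (simp_all add: P.lact_add P.lact_scaleC distrib_left distrib_right scaleC_mult_left scaleC_mult_right)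

lemma cbilinear_ract_pair: "cbilinear (\<lambda>h1 h2. (x \<triangleleft> h1) * (y \<triangleleft> h2))"
  by (rule cbilinearI) (simp_all add: P.ract_add P.ract_scaleC distrib_left distrib_right scaleC_mult_left scaleC_mult_right)

lemma lact_product:
  "K \<triangleright> (x * y) = (K \<triangleright> x) * (K \<triangleright> y)" "Ki \<triangleright> (x * y) = (Ki \<triangleright> x) * (Ki \<triangleright> y)"
  "E \<triangleright> (x * y) = (E \<triangleright> x) * (K \<triangleright> y) + (Ki \<triangleright> x) * (E \<triangleright> y)"
  "F \<triangleright> (x * y) = (F \<triangleright> x) * (K \<triangleright> y) + (Ki \<triangleright> x) * (F \<triangleright> y)"
  by (simp_all add: P.lact_prod U.comult_K U.comult_Ki U.comult_E U.comult_F
      tensor_lift_linear[OF cbilinear_lact_pair] tensor_lift_pure[OF cbilinear_lact_pair])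

lemma ract_product:
  "(x * y) \<triangleleft> K = (x \<triangleleft> K) * (y \<triangleleft> K)" "(x * y) \<triangleleft> Ki = (x \<triangleleft> Ki) * (y \<triangleleft> Ki)"
  "(x * y) \<triangleleft> E = (x \<triangleleft> E) * (y \<triangleleft> K) + (x \<triangleleft> Ki) * (y \<triangleleft> E)"
  "(x * y) \<triangleleft> F = (x \<triangleleft> F) * (y \<triangleleft> K) + (x \<triangleleft> Ki) * (y \<triangleleft> F)"
  by (simp_all add: P.ract_prod U.comult_K U.comult_Ki U.comult_E U.comult_F
      tensor_lift_linear[OF cbilinear_ract_pair] tensor_lift_pure[OF cbilinear_ract_pair])

lemma lact_unit_gen: "K \<triangleright> 1 = 1" "Ki \<triangleright> 1 = 1" "E \<triangleright> 1 = 0" "F \<triangleright> 1 = 0"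
  by (simp_all add: P.lact_unit counit_gen scaleC_one)

lemma ract_unit_gen: "1 \<triangleleft> K = 1" "1 \<triangleleft> Ki = 1" "1 \<triangleleft> E = 0" "1 \<triangleleft> F = 0"
  by (simp_all add: P.ract_unit counit_gen scaleC_one)

end

section \<open>The quantum tangent space\<close>

text \<open>Lagrange interpolation: compose, over the i in \<open>S\<close>, the operators (T_k - ev
  k i) / (ev k j - ev k i), where k depends on i and separates it from j.\<close>

lemma joint_eigenvectors_projection:
  fixes v :: "'i \<Rightarrow> 'v::complex_vector"
  assumes lin: "\<And>k. clinear (T k)"
    and eigen: "\<And>k i. i \<in> I \<Longrightarrow> T k (v i) = ev k i *\<^sub>C v i"
    and sep: "\<And>i j. i \<in> I \<Longrightarrow> j \<in> I \<Longrightarrow> i \<noteq> j \<Longrightarrow> \<exists>k. ev k i \<noteq> ev k j"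
    and S: "finite S" "S \<subseteq> I" and j: "j \<in> I" "j \<notin> S"
  shows "\<exists>P. clinear P \<and> P (v j) = v j \<and> (\<forall>i\<in>S. P (v i) = 0)"
  using S j
proof (induction S rule: finite_induct)
  case empty
  then show ?case by (intro exI[of _ id]) (simp add: clinear_iff)
next
  case (insert i S)
  then obtain P where P: "clinear P" "P (v j) = v j" "\<And>i. i \<in> S \<Longrightarrow> P (v i) = 0" by auto
  obtain k where k: "ev k i \<noteq> ev k j" using sep[of i j] insert by auto
  define r where "r = 1 / (ev k j - ev k i)"
  let ?Q = "\<lambda>x. r *\<^sub>C (P (T k x) - ev k i *\<^sub>C P x)"
  have Q: "?Q (v n) = (r * (ev k n - ev k i)) *\<^sub>C P (v n)" if "n \<in> I" for n
    using that by (simp add: eigen clinearD[OF P(1)] flip: cv.scale_left_diff_distrib)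
  have "clinear ?Q"
    by (simp add: clinear_iff clinearD[OF P(1)] clinearD[OF lin] scaleC_add_right cv.scale_right_diff_distrib mult_ac)
  moreover have "?Q (v j) = v j"
    unfolding Q[OF insert.prems(2)] using k by (simp add: P r_def scaleC_one)
  moreover have "?Q (v n) = 0" if "n \<in> insert i S" for n
  proof -
    have "n \<in> I" using that insert.prems by auto
    from Q[OF this] show ?thesis using that P(3) by auto
  qed
  ultimately show ?case by blast
qed

lemma joint_eigenvectors_independent:
  fixes v :: "'i \<Rightarrow> 'v::complex_vector"
  assumes lin: "\<And>k. clinear (T k)"
    and eigen: "\<And>k i. i \<in> I \<Longrightarrow> T k (v i) = ev k i *\<^sub>C v i"
    and sep: "\<And>i j. i \<in> I \<Longrightarrow> j \<in> I \<Longrightarrow> i \<noteq> j \<Longrightarrow> \<exists>k. ev k i \<noteq> ev k j"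
    and nz: "\<And>i. i \<in> I \<Longrightarrow> v i \<noteq> 0"
  shows "inj_on v I" and "cv.independent (v ` I)"
proof -
  note proj = joint_eigenvectors_projection[of T I v ev, OF lin eigen sep]
  show inj: "inj_on v I"
  proof (rule inj_onI, rule ccontr)
    fix i j assume ij: "i \<in> I" "j \<in> I" "v i = v j" "i \<noteq> j"
    then obtain P where "P (v j) = v j" "P (v i) = 0" using proj[of "{i}" j] by auto
    with ij nz show False by auto
  qed
  show "cv.independent (v ` I)"
    unfolding cv.dependent_def
  proof
    assume "\<exists>a\<in>v ` I. a \<in> cv.span (v ` I - {a})"
    then obtain j where j: "j \<in> I" and "v j \<in> cv.span (v ` I - {v j})" by blast
    then obtain t r where t: "finite t" "t \<subseteq> v ` I - {v j}" and sum: "v j = (\<Sum>x\<in>t. r x *\<^sub>C x)"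
      unfolding cv.span_explicit by blast
    then obtain S where S: "S \<subseteq> I - {j}" "finite S" "t = v ` S"
      using finite_subset_image[of t v "I - {j}"] by blast
    then obtain P where P: "clinear P" "P (v j) = v j" "\<And>i. i \<in> S \<Longrightarrow> P (v i) = 0"
      using proj[of S j] j by blast
    interpret P: Vector_Spaces.linear scaleC scaleC P by (rule P(1))
    have "v j = P (\<Sum>x\<in>t. r x *\<^sub>C x)" using P(2) sum by simp
    also have "\<dots> = 0" unfolding P.sum P.scale using P(3) S(3) by (intro sum.neutral) auto
    finally show False using nz[OF j] by simp
  qed
qed

section \<open>Commutation relations of the tangent vectors and the Casimir element\<close>

context suq2_duality
begin

abbreviation L where "L \<equiv> Lvec q K Ki E F"

lemma scalars:
  "cr (1 / (q - 1 / q)\<^sup>2) = cr (1 / (q - 1 / q)) * cr (1 / (q - 1 / q))"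
  "cr (q\<^sup>2) = cr q * cr q" "cr (1 / q\<^sup>2) = cr (1 / q) * cr (1 / q)"
  "cr (q\<^sup>2 - 1 / q\<^sup>2) = cr q * cr q - cr (1 / q) * cr (1 / q)"
  "cr ((q - 1 / q)\<^sup>2) = (cr q - cr (1 / q)) * (cr q - cr (1 / q))"
  "cr (q + 1 / q) = cr q + cr (1 / q)" "cr (q - 1 / q) = cr q - cr (1 / q)"
  "cr (1 + q\<^sup>2) = 1 + cr q * cr q" "cr (2 * (q\<^sup>2 - 1)) = 2 * (cr q * cr q - 1)" "cr (2 * q) = 2 * cr q"
  by (simp_all add: power2_eq_square)

text \<open>The scalars q, 1/q, 1/(q - 1/q) and the two square roots are treated as symbols subject
  to these relations, which turns identities in the quantum enveloping algebra into polynomial ideal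
  membership.\<close>

lemma scalar_relations:
  "cr q * cr (1 / q) = 1" "cr (1 / (q - 1 / q)) * (cr q - cr (1 / q)) = 1" "h * hi = 1"
proof -
  have "q * q < 1 * 1" using q_range by (intro mult_strict_mono) auto
  then have "q - 1 / q \<noteq> 0" using q_nonzero by (simp add: field_simps)
  then have "cr (1 / (q - 1 / q)) * cr (q - 1 / q) = 1" by (simp only: of_real_mult[symmetric]) simp
  then show "cr (1 / (q - 1 / q)) * (cr q - cr (1 / q)) = 1" by (simp only: scalars)
  show "cr q * cr (1 / q) = 1" using q_nonzero by (simp only: of_real_mult[symmetric]) simp
qed (rule h_hi)

text \<open>The relations with an arbitrary right factor, so that they rewrite inside right-nested
  products. The normal order puts \<open>F\<close> before \<open>E\<close> before \<open>K\<close>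
  and \<open>Ki\<close>.\<close>

lemma U_normal_order:
  "K * (Ki * x) = x" "Ki * (K * x) = x" "K * (E * x) = cr q *\<^sub>C (E * (K * x))"
  "Ki * (E * x) = cr (1 / q) *\<^sub>C (E * (Ki * x))" "K * (F * x) = cr (1 / q) *\<^sub>C (F * (K * x))"
  "Ki * (F * x) = cr q *\<^sub>C (F * (Ki * x))"
  "E * (F * x) = F * (E * x) + cr (1 / (q - 1 / q)) *\<^sub>C (K * (K * x) - Ki * (Ki * x))"
  using arg_cong[OF U_relations(1), of "\<lambda>y. y * x"] arg_cong[OF U_relations(2), of "\<lambda>y. y * x"]
    arg_cong[OF U_relations(3), of "\<lambda>y. y * x"] arg_cong[OF U_relations(4), of "\<lambda>y. y * x"]
    arg_cong[OF U_relations(5), of "\<lambda>y. y * x"] arg_cong[OF U_relations(6), of "\<lambda>y. y * x"]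
    arg_cong[OF U_relations(7), of "\<lambda>y. y * x"]
  by (simp_all only: mult.assoc scaleC_mult_left distrib_right left_diff_distrib mult_1_left)

lemmas U_order = mult.assoc scaleC_mult_left scaleC_mult_right distrib_left distrib_right
  left_diff_distrib right_diff_distrib mult_1_left mult_1_right U_relations U_normal_order

lemma L_Zero_central:
  shows "L Zero * E = E * L Zero"
    "L Zero * F = F * L Zero"
    "L Zero * K = K * L Zero"
    "L Zero * Ki = Ki * L Zero"
proof -
  show "L Zero * E = E * L Zero"
  proof (rule functionals_separate)
    fix g :: "'u \<Rightarrow> complex" assume g: "clinear g"
    show "g (L Zero * E) = g (E * L Zero)"
      using scalar_relations
      by (simp only: Lvec.simps U_order clinearD[OF g] scaleC_complex_def scalars) algebra
  qed
  show "L Zero * F = F * L Zero"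
  proof (rule functionals_separate)
    fix g :: "'u \<Rightarrow> complex" assume g: "clinear g"
    show "g (L Zero * F) = g (F * L Zero)"
      using scalar_relations
      by (simp only: Lvec.simps U_order clinearD[OF g] scaleC_complex_def scalars) algebra
  qed
  show "L Zero * K = K * L Zero"
  proof (rule functionals_separate)
    fix g :: "'u \<Rightarrow> complex" assume g: "clinear g"
    show "g (L Zero * K) = g (K * L Zero)"
      using scalar_relations
      by (simp only: Lvec.simps U_order clinearD[OF g] scaleC_complex_def scalars) algebra
  qed
  show "L Zero * Ki = Ki * L Zero"
  proof (rule functionals_separate)
    fix g :: "'u \<Rightarrow> complex" assume g: "clinear g"
    show "g (L Zero * Ki) = g (Ki * L Zero)"
      using scalar_relations
      by (simp only: Lvec.simps U_order clinearD[OF g] scaleC_complex_def scalars) algebra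
  qed
qed

text \<open>The quadratic parts are three of the equations in \<open>sig_fixed\<close>; the other
  three follow from the centrality of \<open>L Zero\<close>. The first-order remainders are the
  source of \<open>mc\<close>.\<close>

lemma L_relations:
  shows "L Zed * L Minus = cr (q\<^sup>2) *\<^sub>C (L Minus * L Zed) + cr q *\<^sub>C L Minus"
    "L Zed * L Plus = cr (1 / q\<^sup>2) *\<^sub>C (L Plus * L Zed) - cr (1 / q) *\<^sub>C L Plus"
    "L Plus * L Minus = L Minus * L Plus - cr (q\<^sup>2 - 1 / q\<^sup>2) *\<^sub>C (L Zed * L Zed) + cr ((q - 1 / q)\<^sup>2) *\<^sub>C (L Zero * L Zed) - cr (q + 1 / q) *\<^sub>C L Zed + cr (q - 1 / q) *\<^sub>C L Zero"
proof -
  show "L Zed * L Minus = cr (q\<^sup>2) *\<^sub>C (L Minus * L Zed) + cr q *\<^sub>C L Minus"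
  proof (rule functionals_separate)
    fix g :: "'u \<Rightarrow> complex" assume g: "clinear g"
    show "g (L Zed * L Minus) = g (cr (q\<^sup>2) *\<^sub>C (L Minus * L Zed) + cr q *\<^sub>C L Minus)"
      using scalar_relations
      by (simp only: Lvec.simps U_order clinearD[OF g] scaleC_complex_def scalars) algebra
  qed
  show "L Zed * L Plus = cr (1 / q\<^sup>2) *\<^sub>C (L Plus * L Zed) - cr (1 / q) *\<^sub>C L Plus"
  proof (rule functionals_separate)
    fix g :: "'u \<Rightarrow> complex" assume g: "clinear g"
    show "g (L Zed * L Plus) = g (cr (1 / q\<^sup>2) *\<^sub>C (L Plus * L Zed) - cr (1 / q) *\<^sub>C L Plus)"
      using scalar_relations
      by (simp only: Lvec.simps U_order clinearD[OF g] scaleC_complex_def scalars) algebra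
  qed
  show "L Plus * L Minus = L Minus * L Plus - cr (q\<^sup>2 - 1 / q\<^sup>2) *\<^sub>C (L Zed * L Zed) + cr ((q - 1 / q)\<^sup>2) *\<^sub>C (L Zero * L Zed) - cr (q + 1 / q) *\<^sub>C L Zed + cr (q - 1 / q) *\<^sub>C L Zero"
  proof (rule functionals_separate)
    fix g :: "'u \<Rightarrow> complex" assume g: "clinear g"
    show "g (L Plus * L Minus) = g (L Minus * L Plus - cr (q\<^sup>2 - 1 / q\<^sup>2) *\<^sub>C (L Zed * L Zed) + cr ((q - 1 / q)\<^sup>2) *\<^sub>C (L Zero * L Zed) - cr (q + 1 / q) *\<^sub>C L Zed + cr (q - 1 / q) *\<^sub>C L Zero)"
      using scalar_relations
      by (simp only: Lvec.simps U_order clinearD[OF g] scaleC_complex_def scalars) algebra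
  qed
qed

text \<open>L_- L_+ is F E K^(-2) up to a scalar, F E is L_0 plus a combination of 1, K^2 and
  K^(-2), and K^(-2) is affine in L_z. This eliminates the ladder operators from the Laplace
  operator, after which all quadratic terms cancel.\<close>

lemma L_Minus_Plus:
  "L Minus * L Plus = cr (1 / q) *\<^sub>C (L Zero + cr (q - 1 / q) *\<^sub>C (L Zero * L Zed) + L Zed
     - cr (1 / q) *\<^sub>C (L Zed * L Zed))"
proof (rule functionals_separate)
  fix g :: "'u \<Rightarrow> complex" assume g: "clinear g"
  show "g (L Minus * L Plus) = g (cr (1 / q) *\<^sub>C (L Zero + cr (q - 1 / q) *\<^sub>C (L Zero * L Zed) + L Zed
     - cr (1 / q) *\<^sub>C (L Zed * L Zed)))"
    using scalar_relations
    by (simp only: Lvec.simps U_order clinearD[OF g] scaleC_complex_def scalars) algebra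
qed

lemma Laplace_element:
  "L Plus * L Minus + cr (q\<^sup>2) *\<^sub>C (L Minus * L Plus) + cr (1 + q\<^sup>2) *\<^sub>C (L Zed * L Zed)
     - cr (2 * (q\<^sup>2 - 1)) *\<^sub>C (L Zero * L Zed) = cr (2 * q) *\<^sub>C L Zero"
proof (rule functionals_separate)
  fix g :: "'u \<Rightarrow> complex" assume g: "clinear g"
  show "g (L Plus * L Minus + cr (q\<^sup>2) *\<^sub>C (L Minus * L Plus) + cr (1 + q\<^sup>2) *\<^sub>C (L Zed * L Zed)
     - cr (2 * (q\<^sup>2 - 1)) *\<^sub>C (L Zero * L Zed)) = g (cr (2 * q) *\<^sub>C L Zero)"
    using scalar_relations(1)
    by (simp only: L_relations(3) L_Minus_Plus clinearD[OF g] scaleC_complex_def scalars) algebra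
qed

lemma casimir_L_Zero:
  "casimir q K Ki E F = L Zero + cr ((qnum q (1 / 2))\<^sup>2 - 1 / 4) *\<^sub>C 1"
proof -
  have "(qnum q (1 / 2))\<^sup>2 = (q + 1 / q - 2) / (q - 1 / q)\<^sup>2"
  proof -
    let ?u = "q powr (1 / 2)" and ?v = "q powr (- 1 / 2)"
    have uv: "?u * ?v = 1" "?u * ?u = q" "?v * ?v = 1 / q"
      using q_range by (simp_all flip: powr_add add: powr_minus_divide)
    have "(?u - ?v)\<^sup>2 = ?u * ?u - 2 * (?u * ?v) + ?v * ?v" by (simp add: power2_eq_square algebra_simps)
    then have "(?u - ?v)\<^sup>2 = q + 1 / q - 2" unfolding uv by simp
    moreover have "qnum q (1 / 2) = (?u - ?v) / (q - 1 / q)" by (simp add: qnum_def)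
    ultimately show ?thesis by (simp only: power_divide)
  qed
  then have c: "cr ((qnum q (1 / 2))\<^sup>2 - 1 / 4)
      = cr (1 / (q - 1 / q)) * cr (1 / (q - 1 / q)) * (cr q + cr (1 / q) - 2) - 1 / 4"
    by (simp add: power2_eq_square)
  show ?thesis
  proof (rule functionals_separate)
    fix g :: "'u \<Rightarrow> complex" assume g: "clinear g"
    show "g (casimir q K Ki E F) = g (L Zero + cr ((qnum q (1 / 2))\<^sup>2 - 1 / 4) *\<^sub>C 1)"
      by (simp only: c casimir_def Lvec.simps clinearD[OF g] scaleC_complex_def scalars) algebra
  qed
qed

end

section \<open>The eigenvector basis\<close>

declare Lvec.simps [simp del]

text \<open>The q-number identity [l+1][n-l] = [l][n+1-l] + [n-2l], with p = q, r = 1/q, X = q^l, Y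
  = q^(-l), A = q^n, B = q^(-n) and w = 1/(q - 1/q).\<close>

lemma down_identity:
  fixes p r w X Y A B :: complex
  assumes "p * r = 1" "w * (p - r) = 1"
  shows "w * w * ((p * X - r * Y) * (p * A * (r * Y) - r * B * (p * X)))
    = w * w * ((X - Y) * (p * A * Y - r * B * X)) + w * (A * (Y * Y) - B * (X * X))"
proof -
  have 1: "p * A * (r * Y) = A * Y" "r * B * (p * X) = B * X" using assms(1) by algebra+
  have "(p * X - r * Y) * (A * Y - B * X) = (X - Y) * (p * A * Y - r * B * X) + (p - r) * (A * (Y * Y) - B * (X * X))"
    by (simp add: algebra_simps)
  then show ?thesis unfolding 1 using assms(2) by algebra
qed

section \<open>Actions on monomials\<close>

context suq2_duality
begin

abbreviation w where "w \<equiv> cr (1 / (q - 1 / q))"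
abbreviation mono where "mono i j \<equiv> c ^ i * star a ^ j"

lemma lact_powers:
  "K \<triangleright> c ^ i = hi ^ i *\<^sub>C c ^ i" "Ki \<triangleright> c ^ i = h ^ i *\<^sub>C c ^ i" "F \<triangleright> c ^ i = 0"
  "K \<triangleright> star a ^ i = h ^ i *\<^sub>C star a ^ i" "Ki \<triangleright> star a ^ i = hi ^ i *\<^sub>C star a ^ i" "E \<triangleright> star a ^ i = 0"
  by (induction i)
    (simp_all add: lact_product lact_gen lact_unit_gen scaleC_mult_left scaleC_mult_right scaleC_one)

lemma ract_powers:
  "c ^ i \<triangleleft> K = h ^ i *\<^sub>C c ^ i" "c ^ i \<triangleleft> Ki = hi ^ i *\<^sub>C c ^ i" "c ^ i \<triangleleft> F = 0"
  "star a ^ i \<triangleleft> K = h ^ i *\<^sub>C star a ^ i" "star a ^ i \<triangleleft> Ki = hi ^ i *\<^sub>C star a ^ i" "star a ^ i \<triangleleft> F = 0"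
  by (induction i)
    (simp_all add: ract_product ract_gen ract_unit_gen scaleC_mult_left scaleC_mult_right scaleC_one)

lemma star_a_c: "star a * c = cr (1 / q) *\<^sub>C (c * star a)"
  using A_relations(7) scalar_relations(1) by (simp add: scaleC_one mult.commute)

lemma star_a_c_power: "star a * c ^ i = cr (1 / q) ^ i *\<^sub>C (c ^ i * star a)"
proof (induction i)
  case (Suc i)
  have "star a * c ^ Suc i = (star a * c) * c ^ i" by (simp add: mult.assoc)
  also have "\<dots> = cr (1 / q) *\<^sub>C (c * (star a * c ^ i))" by (simp only: star_a_c scaleC_mult_left mult.assoc)
  finally show ?case by (simp add: Suc scaleC_mult_right mult.assoc)
qed (simp add: scaleC_one)

text \<open>The coefficient only has to be nonzero; positivity is the form that passes through the
  induction, since the two summands of each step cannot cancel.\<close>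

lemma E_lact_c_power: "\<exists>e>0. E \<triangleright> c ^ Suc i = cr e *\<^sub>C (c ^ i * star a)"
proof (induction i)
  case 0
  show ?case by (intro exI[of _ 1]) (simp add: lact_gen scaleC_one)
next
  case (Suc i)
  then obtain e where e: "e > 0" "E \<triangleright> c ^ Suc i = cr e *\<^sub>C (c ^ i * star a)" by blast
  let ?e = "(q powr (- 1 / 2)) ^ Suc i * (1 / q) ^ Suc i + q powr (1 / 2) * e"
  have "E \<triangleright> c ^ Suc (Suc i) = (E \<triangleright> c) * (K \<triangleright> c ^ Suc i) + (Ki \<triangleright> c) * (E \<triangleright> c ^ Suc i)"
    by (simp only: power_Suc[of c "Suc i"] lact_product)
  also have "\<dots> = hi ^ Suc i *\<^sub>C (star a * c ^ Suc i) + (h * cr e) *\<^sub>C (c * (c ^ i * star a))"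
    by (simp only: e lact_powers lact_gen scaleC_mult_left scaleC_mult_right scaleC_scaleC
        mult.commute[of "cr e"])
  also have "\<dots> = (hi ^ Suc i * cr (1 / q) ^ Suc i + h * cr e) *\<^sub>C (c ^ Suc i * star a)"
    unfolding star_a_c_power[of "Suc i"]
    by (simp only: scaleC_scaleC scaleC_add_left power_Suc[of c] mult.assoc)
  also have "hi ^ Suc i * cr (1 / q) ^ Suc i + h * cr e = cr ?e" by simp
  finally have "E \<triangleright> c ^ Suc (Suc i) = cr ?e *\<^sub>C (c ^ Suc i * star a)" .
  moreover have "?e > 0" using e q_range by (intro add_pos_pos mult_pos_pos zero_less_power) auto
  ultimately show ?case by blast
qed

lemma F_lact_star_a_power: "\<exists>e>0. F \<triangleright> star a ^ Suc i = cr e *\<^sub>C (c * star a ^ i)"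
proof (induction i)
  case 0
  show ?case by (intro exI[of _ 1]) (simp add: lact_gen scaleC_one)
next
  case (Suc i)
  then obtain e where e: "e > 0" "F \<triangleright> star a ^ Suc i = cr e *\<^sub>C (c * star a ^ i)" by blast
  let ?e = "(q powr (1 / 2)) ^ Suc i + q powr (- 1 / 2) * e * (1 / q)"
  have "F \<triangleright> star a ^ Suc (Suc i) = (F \<triangleright> star a) * (K \<triangleright> star a ^ Suc i) + (Ki \<triangleright> star a) * (F \<triangleright> star a ^ Suc i)"
    by (simp only: power_Suc[of "star a" "Suc i"] lact_product)
  also have "\<dots> = h ^ Suc i *\<^sub>C (c * star a ^ Suc i) + (hi * cr e) *\<^sub>C ((star a * c) * star a ^ i)"
    by (simp only: e lact_powers lact_gen scaleC_mult_left scaleC_mult_right scaleC_scaleC mult.assoc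
        mult.commute[of "cr e"])
  also have "\<dots> = (h ^ Suc i + hi * cr e * cr (1 / q)) *\<^sub>C (c * star a ^ Suc i)"
    by (simp only: star_a_c scaleC_mult_left scaleC_scaleC scaleC_add_left power_Suc[of "star a"] mult.assoc)
  also have "h ^ Suc i + hi * cr e * cr (1 / q) = cr ?e" by simp
  finally have "F \<triangleright> star a ^ Suc (Suc i) = cr ?e *\<^sub>C (c * star a ^ Suc i)" .
  moreover have "?e > 0" using e q_range by (intro add_pos_pos mult_pos_pos zero_less_power) auto
  ultimately show ?case by blast
qed

lemma F_lact_mono: "\<exists>r. r \<noteq> 0 \<and> F \<triangleright> mono i (Suc j) = r *\<^sub>C mono (Suc i) j"
proof -
  obtain e where e: "e > 0" "F \<triangleright> star a ^ Suc j = cr e *\<^sub>C (c * star a ^ j)" using F_lact_star_a_power by blast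
  have "F \<triangleright> mono i (Suc j) = (h ^ i * cr e) *\<^sub>C mono (Suc i) j"
    by (simp only: lact_product lact_powers e power_Suc2[of c] scaleC_mult_left scaleC_mult_right scaleC_scaleC mult.assoc
        mult_zero_left add_0 cv.scale_zero_right mult.commute[of "cr e"])
  then show ?thesis using e(1) h_nonzero by (intro exI[of _ "h ^ i * cr e"]) simp
qed

lemma E_lact_mono: "\<exists>r. E \<triangleright> mono (Suc i) j = r *\<^sub>C mono i (Suc j) \<and> r \<noteq> 0"
proof -
  obtain e where e: "e > 0" "E \<triangleright> c ^ Suc i = cr e *\<^sub>C (c ^ i * star a)" using E_lact_c_power by blast
  have "E \<triangleright> mono (Suc i) j = (h ^ j * cr e) *\<^sub>C mono i (Suc j)"
    by (simp only: lact_product lact_powers e power_Suc[of "star a"] scaleC_mult_left scaleC_mult_right scaleC_scaleC mult.assoc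
        mult_zero_right add_0_right cv.scale_zero_right mult.commute[of "cr e"])
  then show ?thesis using e(1) h_nonzero by (intro exI[of _ "h ^ j * cr e"]) simp
qed

text \<open>In an algebra given by a presentation nonvanishing has to be detected. The pairing of
  \<open>K\<close> with \<open>star a ^ j\<close> is q^(j/2), which settles i = 0, and
  \<open>E\<close> carries each monomial to a nonzero multiple of one with a lower power of
  \<open>c\<close>.\<close>

lemma mono_nonzero: "mono i j \<noteq> 0"
proof (induction i arbitrary: j)
  case 0
  have "pair K (star a ^ j) = h ^ j"
  proof (induction j)
    case 0
    show ?case by (simp add: P.pair_one_right counit_gen)
  next
    case (Suc j)
    have "cbilinear (\<lambda>h1 h2. pair h1 x * pair h2 y)" for x y
      by (rule cbilinearI) (simp_all add: P.pair_linear scaleC_complex_def algebra_simps)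
    then show ?case by (simp add: P.pair_mult_right U.comult_K tensor_lift_pure Suc pair_K)
  qed
  then have "pair K (star a ^ j) \<noteq> 0" using h_nonzero by simp
  moreover have "pair K 0 = 0" using pair_scaleC(1)[of K 0 0] by simp
  ultimately have "star a ^ j \<noteq> 0" by metis
  then show ?case by simp
next
  case (Suc i)
  then show ?case using E_lact_mono[of i j] P.lact_linear(3)[of E]
    by (metis cv.scale_eq_0_iff)
qed

text \<open>The eigenvalue [J][J+1] at spin J = n/2, multiplied out so that no half-integral powers
  occur.\<close>

definition casimir_ev :: "nat \<Rightarrow> complex" where
  "casimir_ev n = w * w * (cr q ^ Suc n + cr (1 / q) ^ Suc n - cr q - cr (1 / q))"

lemma L_Zero_star_a_power: "L Zero \<triangleright> star a ^ n = casimir_ev n *\<^sub>C star a ^ n"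
proof -
  have p: "h ^ n * h ^ n = cr q ^ n" "hi ^ n * hi ^ n = cr (1 / q) ^ n"
    by (simp_all only: h_hi flip: power_mult_distrib)
  have "L Zero \<triangleright> star a ^ n
      = (w * w) *\<^sub>C (cr q *\<^sub>C (cr q ^ n *\<^sub>C star a ^ n - star a ^ n) + cr (1 / q) *\<^sub>C (cr (1 / q) ^ n *\<^sub>C star a ^ n - star a ^ n))"
    by (simp only: Lvec.simps scalars clinearD[OF P.clinear_lact_left] P.lact_mult P.lact_one lact_powers
        P.lact_linear scaleC_scaleC p add_0_right)
  then show ?thesis
    by (simp only: casimir_ev_def distrib_left right_diff_distrib scaleC_add_right scaleC_add_left
        cv.scale_left_diff_distrib cv.scale_right_diff_distrib scaleC_scaleC power_Suc mult.assoc)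
      (simp only: algebra_simps)
qed

text \<open>\<open>E\<close> kills \<open>star a ^ n\<close>, so \<open>L Zero\<close> is computed
  there directly. \<open>F\<close> trades a factor \<open>star a\<close> for a factor
  \<open>c\<close> and commutes with \<open>L Zero\<close>, which spreads the eigenvalue over the
  multiplet.\<close>

lemma L_Zero_mono: "L Zero \<triangleright> mono i j = casimir_ev (i + j) *\<^sub>C mono i j"
proof (induction i arbitrary: j)
  case 0
  show ?case by (simp add: L_Zero_star_a_power)
next
  case (Suc i)
  obtain r where r: "r \<noteq> 0" "F \<triangleright> mono i (Suc j) = r *\<^sub>C mono (Suc i) j" using F_lact_mono by blast
  have "r *\<^sub>C (L Zero \<triangleright> mono (Suc i) j) = L Zero \<triangleright> (F \<triangleright> mono i (Suc j))"
    by (simp only: r P.lact_linear)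
  also have "\<dots> = F \<triangleright> (L Zero \<triangleright> mono i (Suc j))"
    by (simp only: P.lact_mult[symmetric] L_Zero_central)
  also have "\<dots> = r *\<^sub>C (casimir_ev (Suc i + j) *\<^sub>C mono (Suc i) j)"
    by (simp only: Suc P.lact_linear r) (simp add: mult.commute)
  finally show ?case using r(1) by (simp only: cv.scale_cancel_left) simp
qed

section \<open>Joint eigenvectors and their independence\<close>

text \<open>The eigenvectors labelled by exponents i = J - n/2 and j = J + n/2, which keeps the
  labels natural numbers.\<close>

definition vec :: "nat \<times> nat \<times> nat \<Rightarrow> 'a" where
  "vec = (\<lambda>(i, j, l). mono i j \<triangleleft> E ^ l)"

definition vec_index :: "(nat \<times> nat \<times> nat) set" where
  "vec_index = {(i, j, l). l \<le> i + j}"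

lemma vec_simps: "vec (i, j, 0) = mono i j" "vec (i, j, Suc l) = vec (i, j, l) \<triangleleft> E"
  by (simp_all add: vec_def P.ract_one P.ract_mult power_Suc2 del: power_Suc)

lemma vec_L_Zero: "L Zero \<triangleright> vec (i, j, l) = casimir_ev (i + j) *\<^sub>C vec (i, j, l)"
  by (simp add: vec_def P.ract_linear L_Zero_mono flip: P.ract_lact)

lemma vec_K: "K \<triangleright> vec (i, j, l) = (hi ^ i * h ^ j) *\<^sub>C vec (i, j, l)"
  by (simp add: vec_def P.ract_linear lact_product lact_powers scaleC_mult_left scaleC_mult_right flip: P.ract_lact)

lemma vec_ract_K:
  "vec (i, j, l) \<triangleleft> K = (h ^ (i + j) * cr (1 / q) ^ l) *\<^sub>C vec (i, j, l)"
  "vec (i, j, l) \<triangleleft> Ki = (hi ^ (i + j) * cr q ^ l) *\<^sub>C vec (i, j, l)"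
proof (induction l)
  case 0
  show "vec (i, j, 0) \<triangleleft> K = (h ^ (i + j) * cr (1 / q) ^ 0) *\<^sub>C vec (i, j, 0)"
    "vec (i, j, 0) \<triangleleft> Ki = (hi ^ (i + j) * cr q ^ 0) *\<^sub>C vec (i, j, 0)"
    by (simp_all add: vec_simps ract_product ract_powers scaleC_mult_left scaleC_mult_right power_add mult.commute)
next
  case (Suc l)
  have c: "E * K = cr (1 / q) *\<^sub>C (K * E)" "E * Ki = cr q *\<^sub>C (Ki * E)"
    using scalar_relations(1) by (simp_all add: U_relations scaleC_one mult.commute)
  show "vec (i, j, Suc l) \<triangleleft> K = (h ^ (i + j) * cr (1 / q) ^ Suc l) *\<^sub>C vec (i, j, Suc l)"
    "vec (i, j, Suc l) \<triangleleft> Ki = (hi ^ (i + j) * cr q ^ Suc l) *\<^sub>C vec (i, j, Suc l)"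
    by (simp_all only: vec_simps P.ract_mult[symmetric] c P.ract_scaleC)
      (simp_all only: P.ract_mult Suc P.ract_linear scaleC_scaleC power_Suc mult_ac)
qed

text \<open>The product [l][n+1-l], familiar as the matrix coefficient along a string of weight
  vectors.\<close>

definition down :: "nat \<Rightarrow> nat \<Rightarrow> complex" where
  "down n l = w * w * ((cr q ^ l - cr (1 / q) ^ l) * (cr q ^ Suc n * cr (1 / q) ^ l - cr (1 / q) ^ Suc n * cr q ^ l))"

lemma down_Suc:
  "down n (Suc l) = down n l + w * (cr q ^ n * (cr (1 / q) ^ l * cr (1 / q) ^ l) - cr (1 / q) ^ n * (cr q ^ l * cr q ^ l))"
proof -
  show ?thesis unfolding down_def power_Suc by (rule down_identity[OF scalar_relations(1,2)])
qed

text \<open>The usual string computation: exchanging \<open>E\<close> and \<open>F\<close>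
  contributes [n-2l] by the weights in \<open>vec_ract_K\<close>, and these contributions sum to
  [l+1][n-l].\<close>

lemma vec_ract_F: "vec (i, j, Suc l) \<triangleleft> F = down (i + j) (Suc l) *\<^sub>C vec (i, j, l)"
proof (induction l)
  let ?n = "i + j"
  have step: "vec (i, j, Suc l) \<triangleleft> F = vec (i, j, l) \<triangleleft> F \<triangleleft> E
      + (w * (cr q ^ ?n * (cr (1 / q) ^ l * cr (1 / q) ^ l) - cr (1 / q) ^ ?n * (cr q ^ l * cr q ^ l))) *\<^sub>C vec (i, j, l)" for l
  proof -
    have p: "h ^ ?n * h ^ ?n = cr q ^ ?n" "hi ^ ?n * hi ^ ?n = cr (1 / q) ^ ?n"
      by (simp_all only: h_hi flip: power_mult_distrib)
    have "vec (i, j, Suc l) \<triangleleft> F = vec (i, j, l) \<triangleleft> (E * F)"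
      by (simp only: vec_simps P.ract_mult)
    also have "\<dots> = vec (i, j, l) \<triangleleft> F \<triangleleft> E + w *\<^sub>C (vec (i, j, l) \<triangleleft> K \<triangleleft> K - vec (i, j, l) \<triangleleft> Ki \<triangleleft> Ki)"
      by (simp only: U_relations P.ract_add P.ract_scaleC P.ract_diff P.ract_mult)
    also have "vec (i, j, l) \<triangleleft> K \<triangleleft> K - vec (i, j, l) \<triangleleft> Ki \<triangleleft> Ki
        = ((h ^ ?n * h ^ ?n) * (cr (1 / q) ^ l * cr (1 / q) ^ l) - (hi ^ ?n * hi ^ ?n) * (cr q ^ l * cr q ^ l)) *\<^sub>C vec (i, j, l)"
      by (simp only: vec_ract_K P.ract_linear scaleC_scaleC cv.scale_left_diff_distrib mult_ac)
    finally show ?thesis unfolding p scaleC_scaleC .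
  qed
  {
    case 0
    have "vec (i, j, 0) \<triangleleft> F = 0"
      by (simp add: vec_simps ract_product ract_powers)
    then show ?case unfolding step by (simp add: P.ract_linear down_Suc[of _ 0, simplified] down_def)
  next
    case (Suc l)
    show ?case
      unfolding step[of "Suc l"] Suc P.ract_linear vec_simps(2)[symmetric] down_Suc[of ?n "Suc l"]
      by (simp only: scaleC_add_left)
  }
qed

lemma q_power_less_1: "q ^ Suc n < 1" "1 < (1 / q) ^ Suc n"
  using q_range by (simp_all only: power_Suc_less_one one_less_power zero_less_Suc less_divide_eq_1_pos)

lemma q_power_inject: "q ^ m = q ^ n \<longleftrightarrow> m = n"
  using power_strict_decreasing[of m n q] power_strict_decreasing[of n m q] q_range
  by (metis less_irrefl nat_neq_iff)

lemma w_nonzero: "w \<noteq> 0"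
  using scalar_relations(2) by (metis mult_zero_left zero_neq_one)

text \<open>For 0 < q < 1 the sum of q^(k+1) and its inverse increases strictly with k, so
  \<open>L Zero\<close> separates spins.\<close>

lemma casimir_ev_inject: "casimir_ev m = casimir_ev n \<longleftrightarrow> m = n"
proof
  assume eq: "casimir_ev m = casimir_ev n"
  define f where "f k = q ^ Suc k + (1 / q) ^ Suc k" for k
  have "f k < f (Suc k)" for k
  proof -
    have "f (Suc k) - f k = (1 - q) * ((1 / q) ^ Suc (Suc k) - q ^ Suc k)"
      using q_nonzero by (simp add: f_def field_simps)
    moreover have "\<dots> > 0"
      using q_range q_power_less_1[of k] q_power_less_1[of "Suc k"] by (intro mult_pos_pos) linarith+
    ultimately show ?thesis by linarith
  qed
  then have "strict_mono f" by (simp add: strict_mono_Suc_iff)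
  moreover have "cr (f m) = cr (f n)"
  proof -
    have "w * w * (cr (f m) - cr q - cr (1 / q)) = w * w * (cr (f n) - cr q - cr (1 / q))"
      using eq by (simp add: casimir_ev_def f_def)
    then show ?thesis using w_nonzero by simp
  qed
  then have "f m = f n" by (simp only: of_real_eq_iff)
  ultimately show "m = n" by (simp add: strict_mono_eq)
qed simp

text \<open>For l < n both [l+1] and [n-l] are nonzero; up to scalars they are the two negative
  factors below. Thus \<open>F\<close> detects that the string of right translates by
  \<open>E\<close> has not broken off.\<close>

lemma down_nonzero:
  assumes "l < n"
  shows "down n (Suc l) \<noteq> 0"
proof -
  obtain k where k: "n = Suc (l + k)" using assms less_iff_Suc_add by auto
  have "q ^ Suc n * (1 / q) ^ Suc l = q ^ Suc k * (q * (1 / q)) ^ Suc l"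
    by (simp only: k power_mult_distrib) (simp add: power_add mult_ac)
  then have 1: "q ^ Suc n * (1 / q) ^ Suc l < 1"
    using q_nonzero q_power_less_1(1)[of k] by simp
  have "(1 / q) ^ Suc n * q ^ Suc l = (1 / q) ^ Suc k * ((1 / q) * q) ^ Suc l"
    by (simp only: k power_mult_distrib) (simp add: power_add mult_ac)
  then have 2: "(1 / q) ^ Suc n * q ^ Suc l > 1"
    using q_nonzero q_power_less_1(2)[of k] by simp
  have "(q ^ Suc l - (1 / q) ^ Suc l) * (q ^ Suc n * (1 / q) ^ Suc l - (1 / q) ^ Suc n * q ^ Suc l) > 0"
    using 1 2 q_power_less_1[of l] by (intro mult_neg_neg) linarith+
  then have "cr ((q ^ Suc l - (1 / q) ^ Suc l) * (q ^ Suc n * (1 / q) ^ Suc l - (1 / q) ^ Suc n * q ^ Suc l)) \<noteq> 0"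
    by (simp only: of_real_eq_0_iff)
  moreover have "down n (Suc l)
      = w * w * cr ((q ^ Suc l - (1 / q) ^ Suc l) * (q ^ Suc n * (1 / q) ^ Suc l - (1 / q) ^ Suc n * q ^ Suc l))"
    by (simp only: down_def of_real_mult of_real_diff of_real_power)
  ultimately show ?thesis using w_nonzero by (simp only: mult_eq_0_iff simp_thms)
qed

lemma vec_nonzero: "l \<le> i + j \<Longrightarrow> vec (i, j, l) \<noteq> 0"
proof (induction l)
  case 0
  show ?case using mono_nonzero by (simp add: vec_simps)
next
  case (Suc l)
  show ?case
  proof
    assume "vec (i, j, Suc l) = 0"
    then have "down (i + j) (Suc l) *\<^sub>C vec (i, j, l) = 0"
      using vec_ract_F[of i j l] by (simp add: P.ract_linear)
    then show False using Suc down_nonzero[of l "i + j"] by simp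
  qed
qed

lemma vec_independent: "inj_on vec vec_index" "cv.independent (vec ` vec_index)"
proof -
  define T where "T = (\<lambda>k :: nat. \<lambda>x. if k = 0 then L Zero \<triangleright> x else if k = 1 then K \<triangleright> x else x \<triangleleft> K)"
  define ev where "ev = (\<lambda>k :: nat. \<lambda>(i, j, l). if k = 0 then casimir_ev (i + j) else if k = 1 then hi ^ i * h ^ j
      else h ^ (i + j) * cr (1 / q) ^ l)"
  have lin: "clinear (T k)" for k
    unfolding T_def by (cases "k = 0"; cases "k = 1") (simp_all add: P.clinear_lact P.clinear_ract)
  have eigen: "T k (vec n) = ev k n *\<^sub>C vec n" for k n
    by (cases n) (simp add: T_def ev_def vec_L_Zero vec_K vec_ract_K)
  have sep: "\<exists>k. ev k m \<noteq> ev k n" if "m \<noteq> n" for m n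
  proof (rule ccontr)
    assume "\<nexists>k. ev k m \<noteq> ev k n"
    then have eq: "ev k m = ev k n" for k by blast
    obtain i j l where m: "m = (i, j, l)" by (cases m)
    obtain i' j' l' where n: "n = (i', j', l')" by (cases n)
    have sum: "i + j = i' + j'" using eq[of 0] by (simp add: ev_def m n casimir_ev_inject)
    \<comment> \<open>The left weight q^((j-i)/2) times q^((i+j)/2) is q^j; as i + j is already
      known, this isolates j.\<close>
    have hh: "hi ^ i * h ^ j * h ^ (i + j) = cr (q ^ j)" for i j
    proof -
      have "hi ^ i * h ^ j * h ^ (i + j) = (hi * h) ^ i * (h * h) ^ j"
        by (simp only: power_mult_distrib power_add mult_ac)
      then show ?thesis by (simp only: h_hi power_one mult_1_left of_real_power)
    qed
    have "hi ^ i * h ^ j = hi ^ i' * h ^ j'" using eq[of 1] by (simp add: ev_def m n)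
    then have "cr (q ^ j) = cr (q ^ j')" using hh[of i j] hh[of i' j'] sum by simp
    then have j: "j = j'" by (simp only: of_real_eq_iff q_power_inject)
    have "h ^ (i + j) * cr (1 / q) ^ l = h ^ (i' + j') * cr (1 / q) ^ l'" using eq[of 2] by (simp add: ev_def m n)
    then have "cr (1 / q) ^ l = cr (1 / q) ^ l'"
      using h_nonzero sum by (simp del: of_real_divide)
    then have "cr ((1 / q) ^ l) = cr ((1 / q) ^ l')" by (simp only: of_real_power)
    then have "q ^ l = q ^ l'" by (simp only: of_real_eq_iff) (simp add: power_one_over)
    then show False using that m n j sum q_power_inject by simp
  qed
  have nz: "vec n \<noteq> 0" if "n \<in> vec_index" for n
    using that vec_nonzero by (auto simp: vec_index_def)
  show "inj_on vec vec_index" "cv.independent (vec ` vec_index)"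
    using joint_eigenvectors_independent[of T vec_index vec ev, OF lin eigen sep nz] by blast+
qed

section \<open>The word-length filtration and spanning\<close>

text \<open>Built from words of exactly n letters, so these subspaces are not nested by
  construction; nesting is imposed later on the index sets \<open>vec_index_le\<close>.\<close>

primrec deg :: "nat \<Rightarrow> 'a set" where
  "deg 0 = cv.span {1}"
| "deg (Suc n) = cv.span {x * y | x y. x \<in> {a, star a, c, star c} \<and> y \<in> deg n}"

lemma subspace_deg: "cv.subspace (deg n)"
  by (cases n) simp_all

lemma deg_mult_gen:
  assumes x: "x \<in> cv.span {a, star a, c, star c}" and y: "y \<in> deg n"
  shows "x * y \<in> deg (Suc n)"
  using x
proof (induction x rule: cv.span_induct_alt)
  case base
  show ?case by (simp add: cv.span_zero)
next
  case (step r x x')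
  have "x * y \<in> deg (Suc n)" unfolding deg.simps using step(1) y by (intro cv.span_base) blast
  then show ?case using step(2) subspace_deg[of "Suc n"]
    by (simp only: distrib_right scaleC_mult_left) (intro cv.subspace_add cv.subspace_scale)
qed

lemma ract_deg:
  assumes "T \<in> {K, Ki, E}" and "x \<in> deg n"
  shows "x \<triangleleft> T \<in> deg n"
  using assms
proof (induction n arbitrary: x T)
  case 0
  from 0(2) show ?case unfolding deg.simps
  proof (induction x rule: cv.span_induct_alt)
    case (step r x y)
    have "x \<triangleleft> T \<in> cv.span {1}" using step(1) 0(1) by (auto simp: ract_unit_gen cv.span_zero intro: cv.span_base)
    then show ?case using step(2) by (simp only: P.ract_linear) (intro cv.span_add cv.span_scale)
  qed (simp add: P.ract_linear cv.span_zero)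
next
  case (Suc n)
  have gens: "g \<triangleleft> T' \<in> cv.span {a, star a, c, star c}" if "g \<in> {a, star a, c, star c}" "T' \<in> {K, Ki, E}" for g T'
    using that by (auto simp: ract_gen intro!: cv.span_neg cv.span_scale cv.span_zero intro: cv.span_base)
  from Suc.prems(2) show ?case unfolding deg.simps(2)
  proof (induction x rule: cv.span_induct_alt)
    case (step r x z)
    then obtain g y where x: "x = g * y" "g \<in> {a, star a, c, star c}" "y \<in> deg n" by blast
    have m: "(g \<triangleleft> T') * (y \<triangleleft> T'') \<in> deg (Suc n)" if "T' \<in> {K, Ki, E}" "T'' \<in> {K, Ki, E}" for T' T''
      using deg_mult_gen[OF gens[OF x(2) that(1)] Suc.IH[OF that(2) x(3)]] .
    have "x \<triangleleft> T \<in> deg (Suc n)"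
      using Suc.prems(1) m[of K K] m[of Ki Ki] m[of E K] m[of Ki E] cv.subspace_add[OF subspace_deg, of _ "Suc n"]
      unfolding x(1) by (auto simp del: deg.simps simp: ract_product)
    then show ?case using step(2) unfolding deg.simps(2)
      by (simp only: P.ract_linear) (intro cv.span_add cv.span_scale)
  qed (simp add: P.ract_linear cv.span_zero)
qed

lemma vec_deg: "vec (i, j, l) \<in> deg (i + j)"
proof (induction l)
  case 0
  have "star a ^ j \<in> deg j"
  proof (induction j)
    case (Suc j)
    then show ?case unfolding power_Suc by (intro deg_mult_gen cv.span_base) auto
  qed (simp add: cv.span_base)
  then have "mono i j \<in> deg (i + j)"
  proof (induction i)
    case (Suc i)
    then show ?case unfolding power_Suc mult.assoc add_Suc by (intro deg_mult_gen cv.span_base) auto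
  qed simp
  then show ?case by (simp add: vec_simps)
next
  case (Suc l)
  then show ?case by (simp add: vec_simps ract_deg)
qed

lemma deg_UNIV: "cv.span (\<Union>n. deg n) = UNIV"
proof -
  have "prod_list (map (suq2_gen a c) v) \<in> deg (length v)" for v
  proof (induction v)
    case (Cons g v)
    have "suq2_gen a c g \<in> {a, star a, c, star c}" by (cases g) auto
    then show ?case using Cons by (auto simp del: deg.simps intro!: deg_mult_gen intro: cv.span_base)
  qed (simp add: cv.span_base)
  then have m: "prod_list (map (suq2_gen a c) v) \<in> cv.span (\<Union>n. deg n)" for v
    by (intro cv.span_base) blast
  have "free_eval (suq2_gen a c) p \<in> cv.span (\<Union>n. deg n)" for p
    unfolding free_eval_def free_lift_def by (rule cv.span_sum) (rule cv.span_scale[OF m])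
  moreover have "x \<in> range (free_eval (suq2_gen a c))" for x
    using A.presented unfolding presented_by_def by simp
  ultimately show ?thesis by (metis UNIV_eq_I imageE)
qed

text \<open>Ordered monomials, indexed like the eigenvectors \<open>vec\<close> so that dimensions can be compared.\<close>

definition standard_mon :: "nat \<times> nat \<times> nat \<Rightarrow> 'a" where
  "standard_mon = (\<lambda>(i, j, l). if j \<le> l then a ^ (l - j) * c ^ (i + j - l) * star c ^ j
     else star a ^ (j - l) * c ^ i * star c ^ l)"

definition vec_index_le :: "nat \<Rightarrow> (nat \<times> nat \<times> nat) set" where
  "vec_index_le n = {(i, j, l). i + j \<le> n \<and> l \<le> i + j}"

lemma finite_vec_index_le: "finite (vec_index_le n)"
  by (rule finite_subset[of _ "{..n} \<times> {..n} \<times> {..n}"]) (auto simp: vec_index_le_def)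

lemma standard_mon_mem:
  assumes "i + j + k \<le> n"
  shows "a ^ i * c ^ j * star c ^ k \<in> standard_mon ` vec_index_le n"
    "star a ^ i * c ^ j * star c ^ k \<in> standard_mon ` vec_index_le n"
proof -
  \<comment> \<open>The witnesses solve the exponent equations of \<open>standard_mon\<close>. For i
    = 0 the second index falls into the other branch of that definition, which then gives the same
    monomial.\<close>
  show "a ^ i * c ^ j * star c ^ k \<in> standard_mon ` vec_index_le n"
    using assms by (intro image_eqI[of _ _ "(i + j, k, i + k)"]) (auto simp: standard_mon_def vec_index_le_def)
  show "star a ^ i * c ^ j * star c ^ k \<in> standard_mon ` vec_index_le n"
    using assms by (intro image_eqI[of _ _ "(j, i + k, k)"]) (auto simp: standard_mon_def vec_index_le_def)
qed

lemma standard_mon_cases: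
  assumes "x \<in> standard_mon ` vec_index_le n"
  obtains i j k where "i + j + k \<le> n" "x = a ^ i * c ^ j * star c ^ k"
    | i j k where "i + j + k \<le> n" "x = star a ^ i * c ^ j * star c ^ k"
proof -
  from assms obtain i j l where x: "x = standard_mon (i, j, l)" and le: "i + j \<le> n" "l \<le> i + j"
    by (auto simp: vec_index_le_def)
  show thesis
  proof (cases "j \<le> l")
    case True
    then show thesis using that(1)[of "l - j" "i + j - l" j] x le by (simp add: standard_mon_def)
  next
    case False
    then show thesis using that(2)[of "j - l" i l] x le by (simp add: standard_mon_def)
  qed
qed

lemma c_power_commute:
  "star c * c ^ j = c ^ j * star c"
  "c * a ^ i = cr (1 / q) ^ i *\<^sub>C (a ^ i * c)" "star c * a ^ i = cr (1 / q) ^ i *\<^sub>C (a ^ i * star c)"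
  "c * star a ^ i = cr q ^ i *\<^sub>C (star a ^ i * c)" "star c * star a ^ i = cr q ^ i *\<^sub>C (star a ^ i * star c)"
proof -
  have ca: "c * a = cr (1 / q) *\<^sub>C (a * c)" "star c * a = cr (1 / q) *\<^sub>C (a * star c)"
    using scalar_relations(1) by (simp_all add: A_relations(1,2) scaleC_one mult.commute del: of_real_divide)
  have gen: "x * y ^ i = r ^ i *\<^sub>C (y ^ i * x)" if xy: "x * y = r *\<^sub>C (y * x)" for x y :: 'a and r i
  proof (induction i)
    case (Suc i)
    have "x * y ^ Suc i = (x * y) * y ^ i" by (simp add: mult.assoc)
    also have "\<dots> = r *\<^sub>C (y * (x * y ^ i))" by (simp only: xy scaleC_mult_left mult.assoc)
    finally show ?case by (simp add: Suc scaleC_mult_right mult.assoc)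
  qed (simp add: scaleC_one)
  show "star c * c ^ j = c ^ j * star c" using gen[of "star c" c 1 j] A_relations(3) by (simp add: scaleC_one)
  show "c * a ^ i = cr (1 / q) ^ i *\<^sub>C (a ^ i * c)" "star c * a ^ i = cr (1 / q) ^ i *\<^sub>C (a ^ i * star c)"
    "c * star a ^ i = cr q ^ i *\<^sub>C (star a ^ i * c)" "star c * star a ^ i = cr q ^ i *\<^sub>C (star a ^ i * star c)"
    using gen ca A_relations(6,7) by blast+
qed

text \<open>Reordering only costs scalars, except when \<open>star a\<close> meets \<open>a\<close>
  or conversely. That pair becomes 1 minus a multiple of \<open>star c * c\<close>, so the total
  degree still grows by at most one.\<close>

lemma standard_mon_step:
  assumes g: "g \<in> {a, star a, c, star c}" and x: "x \<in> standard_mon ` vec_index_le n"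
  shows "g * x \<in> cv.span (standard_mon ` vec_index_le (Suc n))"
proof -
  let ?M = "standard_mon ` vec_index_le (Suc n)"
  note base = cv.span_base[OF standard_mon_mem(1)] cv.span_base[OF standard_mon_mem(2)]
  have cs: "c * (y ^ i * c ^ j * star c ^ k) = r ^ i *\<^sub>C (y ^ i * c ^ Suc j * star c ^ k)"
    if "c * y ^ i = r ^ i *\<^sub>C (y ^ i * c)" for y i j k r
    by (simp add: that scaleC_mult_left mult.assoc flip: mult.assoc[of c "y ^ i"])
  have css: "star c * (y ^ i * c ^ j * star c ^ k) = r ^ i *\<^sub>C (y ^ i * c ^ j * star c ^ Suc k)"
    if "star c * y ^ i = r ^ i *\<^sub>C (y ^ i * star c)" for y i j k r
  proof -
    have "star c * (y ^ i * c ^ j * star c ^ k) = r ^ i *\<^sub>C (y ^ i * (star c * c ^ j) * star c ^ k)"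
      by (simp only: mult.assoc[symmetric] that scaleC_mult_left)
    then show ?thesis by (simp only: c_power_commute(1) power_Suc mult.assoc)
  qed
  from x show ?thesis
  proof (cases rule: standard_mon_cases)
    case (1 i j k)
    have m: "r *\<^sub>C (a ^ i' * c ^ j' * star c ^ k') \<in> cv.span ?M" if "i' + j' + k' \<le> Suc n" for r i' j' k'
      using that by (intro cv.span_scale base)
    consider "g = a" | "g = star a" | "g = c" | "g = star c" using g by blast
    then show ?thesis
    proof cases
      case g: 1
      then have "g * x = 1 *\<^sub>C (a ^ Suc i * c ^ j * star c ^ k)" by (simp add: 1 mult.assoc scaleC_one)
      then show ?thesis using m[of "Suc i" j k 1] 1 by simp
    next
      case g: 2
      show ?thesis
      proof (cases i)
        case 0
        then have "g * x = star a ^ 1 * c ^ j * star c ^ k" by (simp add: g 1 mult.assoc)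
        then show ?thesis using base(2)[of 1 j k "Suc n"] 1 0 by simp
      next
        case (Suc i')
        have "g * x = (star a * a) * (a ^ i' * c ^ j * star c ^ k)" by (simp add: g 1 Suc mult.assoc)
        also have "\<dots> = 1 *\<^sub>C (a ^ i' * c ^ j * star c ^ k) - star c * (c * (a ^ i' * c ^ j * star c ^ k))"
          by (simp add: A_relations(4) left_diff_distrib mult.assoc scaleC_one)
        also have "star c * (c * (a ^ i' * c ^ j * star c ^ k))
            = (cr (1 / q) ^ i' * cr (1 / q) ^ i') *\<^sub>C (a ^ i' * c ^ Suc j * star c ^ Suc k)"
          by (simp only: cs[OF c_power_commute(2)] scaleC_mult_right css[OF c_power_commute(3)] scaleC_scaleC)
        finally show ?thesis
          using m[of i' j k 1] m[of i' "Suc j" "Suc k"] 1 Suc by (auto intro!: cv.span_diff)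
      qed
    next
      case g: 3
      have "g * x = cr (1 / q) ^ i *\<^sub>C (a ^ i * c ^ Suc j * star c ^ k)"
        unfolding g 1(2) by (rule cs[OF c_power_commute(2)])
      then show ?thesis using m[of i "Suc j" k] 1 by simp
    next
      case g: 4
      have "g * x = cr (1 / q) ^ i *\<^sub>C (a ^ i * c ^ j * star c ^ Suc k)"
        unfolding g 1(2) by (rule css[OF c_power_commute(3)])
      then show ?thesis using m[of i j "Suc k"] 1 by simp
    qed
  next
    case (2 i j k)
    have m: "r *\<^sub>C (star a ^ i' * c ^ j' * star c ^ k') \<in> cv.span ?M" if "i' + j' + k' \<le> Suc n" for r i' j' k'
      using that by (intro cv.span_scale base)
    consider "g = a" | "g = star a" | "g = c" | "g = star c" using g by blast
    then show ?thesis
    proof cases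
      case g: 1
      show ?thesis
      proof (cases i)
        case 0
        then have "g * x = a ^ 1 * c ^ j * star c ^ k" by (simp add: g 2 mult.assoc)
        then show ?thesis using base(1)[of 1 j k "Suc n"] 2 0 by simp
      next
        case (Suc i')
        have "g * x = (a * star a) * (star a ^ i' * c ^ j * star c ^ k)" by (simp add: g 2 Suc mult.assoc)
        also have "\<dots> = 1 *\<^sub>C (star a ^ i' * c ^ j * star c ^ k)
            - cr (q\<^sup>2) *\<^sub>C (star c * (c * (star a ^ i' * c ^ j * star c ^ k)))"
          unfolding A_relations(5) by (simp add: A_relations(3) left_diff_distrib mult.assoc scaleC_mult_left scaleC_one)
        also have "star c * (c * (star a ^ i' * c ^ j * star c ^ k))
            = (cr q ^ i' * cr q ^ i') *\<^sub>C (star a ^ i' * c ^ Suc j * star c ^ Suc k)"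
          by (simp only: cs[OF c_power_commute(4)] scaleC_mult_right css[OF c_power_commute(5)] scaleC_scaleC)
        finally show ?thesis
          using m[of i' j k 1] m[of i' "Suc j" "Suc k"] 2 Suc by (auto intro!: cv.span_diff)
      qed
    next
      case g: 2
      then have "g * x = 1 *\<^sub>C (star a ^ Suc i * c ^ j * star c ^ k)" by (simp add: 2 mult.assoc scaleC_one)
      then show ?thesis using m[of "Suc i" j k 1] 2 by simp
    next
      case g: 3
      have "g * x = cr q ^ i *\<^sub>C (star a ^ i * c ^ Suc j * star c ^ k)"
        unfolding g 2(2) by (rule cs[OF c_power_commute(4)])
      then show ?thesis using m[of i "Suc j" k] 2 by simp
    next
      case g: 4
      have "g * x = cr q ^ i *\<^sub>C (star a ^ i * c ^ j * star c ^ Suc k)"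
        unfolding g 2(2) by (rule css[OF c_power_commute(5)])
      then show ?thesis using m[of i j "Suc k"] 2 by simp
    qed
  qed
qed

lemma deg_standard_mon: "deg n \<subseteq> cv.span (standard_mon ` vec_index_le n)"
proof (induction n)
  case 0
  have "1 \<in> standard_mon ` vec_index_le 0" using standard_mon_mem(1)[of 0 0 0 0] by simp
  then show ?case by (simp add: cv.span_minimal cv.span_base)
next
  case (Suc n)
  have "g * y \<in> cv.span (standard_mon ` vec_index_le (Suc n))"
    if g: "g \<in> {a, star a, c, star c}" and y: "y \<in> cv.span (standard_mon ` vec_index_le n)" for g y
    using y
  proof (induction y rule: cv.span_induct_alt)
    case (step r x y)
    then show ?case using standard_mon_step[OF g step(1)]
      by (simp only: distrib_left scaleC_mult_right) (intro cv.span_add cv.span_scale)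
  qed (simp add: cv.span_zero)
  then show ?case unfolding deg.simps using Suc by (intro cv.span_minimal) auto
qed

lemma deg_vec: "deg n \<subseteq> cv.span (vec ` vec_index_le n)"
proof -
  let ?V = "vec ` vec_index_le n" and ?M = "standard_mon ` vec_index_le n"
  have sub: "vec_index_le n \<subseteq> vec_index" by (auto simp: vec_index_le_def vec_index_def)
  have indep: "cv.independent ?V"
    using vec_independent(2) sub by (meson cv.independent_mono image_mono)
  have mono_deg: "deg m \<subseteq> cv.span (standard_mon ` vec_index_le n)" if "m \<le> n" for m
  proof -
    have "vec_index_le m \<subseteq> vec_index_le n" using that by (auto simp: vec_index_le_def)
    then show ?thesis using deg_standard_mon[of m] cv.span_mono[OF image_mono] by blast
  qed
  have VM: "?V \<subseteq> cv.span ?M"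
  proof
    fix x assume "x \<in> ?V"
    then obtain i j l where x: "x = vec (i, j, l)" "i + j \<le> n" by (auto simp: vec_index_le_def)
    show "x \<in> cv.span ?M" using vec_deg[of i j l] mono_deg[OF x(2)] x(1) by blast
  qed
  have "card ?V = card (vec_index_le n)"
    using inj_on_subset[OF vec_independent(1) sub] by (rule card_image)
  then have card: "card ?M \<le> card ?V" using card_image_le[OF finite_vec_index_le] by simp
  have "?M \<subseteq> cv.span ?V"
  proof (rule ccontr)
    assume "\<not> ?M \<subseteq> cv.span ?V"
    then obtain x where x: "x \<in> ?M" "x \<notin> cv.span ?V" by blast
    \<comment> \<open>Steinitz exchange: adjoining \<open>x\<close> would give an independent set
      inside the span of \<open>?M\<close> with more elements than \<open>?M\<close>.\<close>
    then have "cv.independent (insert x ?V)" using indep by (simp add: cv.independent_insert cv.span_base)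
    moreover have "insert x ?V \<subseteq> cv.span ?M" using x VM by (auto intro: cv.span_base)
    ultimately have "card (insert x ?V) \<le> card ?M"
      using cv.independent_span_bound[OF finite_imageI[OF finite_vec_index_le]] by blast
    moreover have "x \<notin> ?V" using x(2) cv.span_base by blast
    ultimately show False using card finite_vec_index_le by simp
  qed
  then have "cv.span ?M \<subseteq> cv.span ?V" by (simp add: cv.span_minimal)
  then show ?thesis using deg_standard_mon by blast
qed

lemma vec_span: "cv.span (vec ` vec_index) = UNIV"
proof -
  have "vec_index_le n \<subseteq> vec_index" for n by (auto simp: vec_index_le_def vec_index_def)
  then have "deg n \<subseteq> cv.span (vec ` vec_index)" for n
    using deg_vec[of n] cv.span_mono[OF image_mono] by blast
  then have "cv.span (\<Union>n. deg n) \<subseteq> cv.span (vec ` vec_index)"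
    by (intro cv.span_minimal) auto
  then show ?thesis using deg_UNIV by auto
qed

section \<open>Relabelling by n, J and l\<close>

definition phi_params :: "int \<times> real \<times> nat \<Rightarrow> nat \<times> nat \<times> nat" where
  "phi_params = (\<lambda>(n, J, l). (nat \<lfloor>J - real_of_int n / 2\<rfloor>, nat \<lfloor>J + real_of_int n / 2\<rfloor>, l))"

lemma phi_vec: "phi \<Delta>A pair a c E x = vec (phi_params x)"
  by (cases x) (simp add: phi_def phi_params_def vec_def)

lemma phi_params_eq:
  assumes "(n, J, l) \<in> phi_index"
  obtains i j where "phi_params (n, J, l) = (i, j, l)" "J = (real i + real j) / 2" "n = int j - int i" "l \<le> i + j"
proof -
  from assms obtain k :: nat where k: "J = \<bar>real_of_int n\<bar> / 2 + real k" "real l \<le> 2 * J"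
    by (auto simp: phi_index_def)
  \<comment> \<open>The integer k in the definition of \<open>phi_index\<close> is the smaller
    exponent; the sign of n tells which one that is.\<close>
  define i where "i = (if n \<ge> 0 then k else k + nat (- n))"
  define j where "j = (if n \<ge> 0 then k + nat n else k)"
  have ij: "J - real_of_int n / 2 = real i" "J + real_of_int n / 2 = real j"
    using k(1) by (auto simp: i_def j_def field_simps)
  show thesis
  proof
    show "phi_params (n, J, l) = (i, j, l)" by (simp add: phi_params_def ij)
    show "J = (real i + real j) / 2" using ij by simp
    show "n = int j - int i" using k(1) by (auto simp: i_def j_def)
    show "l \<le> i + j" using k(2) ij by linarith
  qed
qed

lemma phi_params_bij: "inj_on phi_params phi_index" "phi_params ` phi_index = vec_index"
proof -
  show "inj_on phi_params phi_index"
  proof (rule inj_onI)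
    fix x y assume xy: "x \<in> phi_index" "y \<in> phi_index" and eq: "phi_params x = phi_params y"
    obtain n J l where x: "x = (n, J, l)" by (cases x)
    obtain n' J' l' where y: "y = (n', J', l')" by (cases y)
    from xy(1)[unfolded x] obtain i j where
      1: "phi_params (n, J, l) = (i, j, l)" "J = (real i + real j) / 2" "n = int j - int i" by (rule phi_params_eq)
    from xy(2)[unfolded y] obtain i' j' where
      2: "phi_params (n', J', l') = (i', j', l')" "J' = (real i' + real j') / 2" "n' = int j' - int i'" by (rule phi_params_eq)
    show "x = y" using eq 1 2 unfolding x y by simp
  qed
  show "phi_params ` phi_index = vec_index"
  proof
    show "phi_params ` phi_index \<subseteq> vec_index"
    proof
      fix y assume "y \<in> phi_params ` phi_index"
      then obtain n J l where m: "(n, J, l) \<in> phi_index" and y: "y = phi_params (n, J, l)" by auto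
      from m obtain i j where "phi_params (n, J, l) = (i, j, l)" "l \<le> i + j" by (rule phi_params_eq)
      then show "y \<in> vec_index" by (simp add: y vec_index_def)
    qed
    show "vec_index \<subseteq> phi_params ` phi_index"
    proof
      fix y assume "y \<in> vec_index"
      then obtain i j l where y: "y = (i, j, l)" "l \<le> i + j" by (auto simp: vec_index_def)
      let ?n = "int j - int i" and ?J = "(real i + real j) / 2"
      have "?J = \<bar>real_of_int ?n\<bar> / 2 + real (min i j)" by (simp add: min_def field_simps)
      then have "(?n, ?J, l) \<in> phi_index" using y(2) by (auto simp: phi_index_def)
      moreover have "phi_params (?n, ?J, l) = y"
      proof -
        have "?J - real_of_int ?n / 2 = real i" "?J + real_of_int ?n / 2 = real j" by (simp_all add: field_simps)
        then show ?thesis unfolding phi_params_def prod.case y(1) by (simp only: floor_of_nat nat_int)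
      qed
      ultimately show "y \<in> phi_params ` phi_index" by (metis imageI)
    qed
  qed
qed

lemma phi_basis:
  "inj_on (phi \<Delta>A pair a c E) phi_index"
  "cv.independent (phi \<Delta>A pair a c E ` phi_index)" "cv.span (phi \<Delta>A pair a c E ` phi_index) = UNIV"
proof -
  have phi: "phi \<Delta>A pair a c E = vec \<circ> phi_params" by (rule ext) (simp add: phi_vec)
  show "inj_on (phi \<Delta>A pair a c E) phi_index"
    unfolding phi using phi_params_bij vec_independent(1) by (simp add: comp_inj_on)
  show "cv.independent (phi \<Delta>A pair a c E ` phi_index)" "cv.span (phi \<Delta>A pair a c E ` phi_index) = UNIV"
    unfolding phi image_comp[symmetric] phi_params_bij(2) using vec_independent(2) vec_span by simp_all
qed

lemma casimir_ev_qnum: "casimir_ev n = cr (qnum q (real n / 2) * qnum q (real n / 2 + 1))"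
proof -
  define J where "J = real n / 2"
  let ?x = "q powr J" and ?y = "q powr (- J)"
  have xx: "?x * ?x = q ^ n"
    using q_range by (simp add: J_def powr_realpow flip: powr_add)
  have y: "?y = 1 / ?x" by (rule powr_minus_divide)
  have xy: "?x * ?y = 1" "?x * ?x = q ^ n" "?y * ?y = (1 / q) ^ n"
    using xx q_range by (simp_all only: y times_divide_eq_right times_divide_eq_left mult_1_right power_one_over) simp_all
  have "q powr (J + 1) = ?x * q" "q powr (- (J + 1)) = ?y * (1 / q)"
    using q_range by (simp_all add: powr_add powr_minus_divide field_simps powr_diff powr_minus)
  then have "qnum q J * qnum q (J + 1) = (1 / (q - 1 / q)) * (1 / (q - 1 / q)) * ((?x - ?y) * (?x * q - ?y * (1 / q)))"
    by (simp add: qnum_def)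
  also have "(?x - ?y) * (?x * q - ?y * (1 / q)) = (?x * ?x) * q + (?y * ?y) * (1 / q) - (?x * ?y) * (q + 1 / q)"
    by (simp add: algebra_simps)
  also have "\<dots> = q * q ^ n + (1 / q) * (1 / q) ^ n - q - 1 / q" unfolding xy by simp
  finally have "cr (qnum q J * qnum q (J + 1)) = casimir_ev n"
    by (simp only: casimir_ev_def of_real_mult of_real_diff of_real_add of_real_power power_Suc)
  then show ?thesis by (simp only: J_def)
qed

lemma L_Zero_phi:
  assumes "(n, J, l) \<in> phi_index"
  shows "L Zero \<triangleright> phi \<Delta>A pair a c E (n, J, l) = cr (qnum q J * qnum q (J + 1)) *\<^sub>C phi \<Delta>A pair a c E (n, J, l)"
proof -
  from assms obtain i j where ij: "phi_params (n, J, l) = (i, j, l)" "J = (real i + real j) / 2" by (rule phi_params_eq)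
  have J: "J = real (i + j) / 2" using ij(2) by simp
  show ?thesis unfolding phi_vec ij(1) vec_L_Zero casimir_ev_qnum by (simp only: J)
qed

end

section \<open>The exterior derivative\<close>

text \<open>Structure constants of the Maurer-Cartan equations \<open>d \<omega>\<^sub>e = \<Sum> mc q e x y \<omega>\<^sub>x \<and> \<omega>\<^sub>y\<close>, read off from the
  commutation relations of the \<open>L\<^sub>a\<close>.\<close>

definition mc :: "real \<Rightarrow> idx \<Rightarrow> idx \<Rightarrow> idx \<Rightarrow> complex" where
  "mc q e x y = (if (x, y) = (Minus, Zed) \<and> e = Minus then cr (1 / q)
     else if (x, y) = (Plus, Zed) \<and> e = Plus then - cr q
     else if (x, y) = (Minus, Plus) \<and> e = Zed then - cr (q + 1 / q)
     else if (x, y) = (Minus, Plus) \<and> e = Zero then cr (q - 1 / q) else 0)"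

text \<open>A tensor whose antisymmetrisation turns out to be \<open>d\<close> of the invariant form
  of the word. It encodes d(\<omega>_a \<and> \<omega>_v) = d \<omega>_a \<and> \<omega>_v -
  \<omega>_a \<and> d \<omega>_v with the Maurer-Cartan constants.\<close>

primrec d_word :: "real \<Rightarrow> idx list \<Rightarrow> complex coeffs" where
  "d_word q [] = (\<lambda>w. 0)"
| "d_word q (a # v) = (\<lambda>w. case w of [] \<Rightarrow> 0
     | x # u \<Rightarrow> (case u of [] \<Rightarrow> 0 | y # u' \<Rightarrow> mc q a x y * basis_vec v u')
        - (if x = a then d_word q v u else 0))"

lemma d_word_tensors: "d_word q v \<in> tensors (Suc (length v))"
proof (induction v)
  case (Cons a v)
  have "basis_vec v u' = 0" if "length u' \<noteq> length v" for u' using that by (auto simp: basis_vec_def)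
  then show ?case using Cons by (auto simp: tensors_def words_iff split: list.splits)
qed (simp add: tensors_def)

lemma sum_d_word_Cons:
  "(\<Sum>w\<in>words (Suc (length (a # v))). G w * d_word q (a # v) w)
    = (\<Sum>x\<in>UNIV. \<Sum>y\<in>UNIV. mc q a x y * G (x # y # v)) - (\<Sum>w\<in>words (Suc (length v)). G (a # w) * d_word q v w)"
proof -
  have b: "(\<Sum>u\<in>words (length v). H u * (r * basis_vec v u)) = r * H v" for H r
    using finite_words by (simp add: basis_vec_def words_iff if_distrib cong: if_cong)
  have ifs: "(\<Sum>y\<in>A. \<Sum>u\<in>B. if P then H y u else 0) = (if P then \<Sum>y\<in>A. \<Sum>u\<in>B. H y u else 0)"
    for P A B and H :: "idx \<Rightarrow> idx list \<Rightarrow> complex" by simp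
  have "(\<Sum>w\<in>words (Suc (length (a # v))). G w * d_word q (a # v) w)
    = (\<Sum>x\<in>UNIV. \<Sum>y\<in>UNIV. \<Sum>u\<in>words (length v). G (x # y # u) * (mc q a x y * basis_vec v u))
      - (\<Sum>x\<in>UNIV. if x = a then (\<Sum>w\<in>words (Suc (length v)). G (x # w) * d_word q v w) else 0)"
    by (simp add: sum_words_Suc right_diff_distrib sum_subtractf if_distrib[of "(*) _"] cong: if_cong)
      (simp add: ifs)
  then show ?thesis by (simp add: b)
qed

text \<open>The analogue of unimodularity: for a classical Lie group the closedness of invariant
  forms of codimension one says that the adjoint traces vanish. Here it is a check over the 64 words
  of length three.\<close>

lemma vol_coeff_d_word:
  assumes q: "q \<noteq> 0" and v: "v \<in> words 3"
  shows "(\<Sum>w\<in>words 4. vol_coeff q w * d_word q v w) = 0"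
proof -
  obtain a b c where v: "v = [a, b, c]" using v by (rule words_3_cases)
  have "(\<Sum>w\<in>words 4. vol_coeff q w * d_word q v w) = (\<Sum>w\<in>words (Suc (length [a, b, c])). vol_coeff q w * d_word q [a, b, c] w)"
    unfolding v by (simp add: numeral_eq_Suc)
  also have "\<dots> = (\<Sum>x\<in>UNIV. \<Sum>y\<in>UNIV. mc q a x y * vol_coeff q [x, y, b, c])
      - ((\<Sum>x\<in>UNIV. \<Sum>y\<in>UNIV. mc q b x y * vol_coeff q [a, x, y, c])
      - (\<Sum>x\<in>UNIV. \<Sum>y\<in>UNIV. mc q c x y * vol_coeff q [a, b, x, y]))"
    unfolding sum_d_word_Cons by simp
  also have "\<dots> = 0"
    by (cases a; cases b; cases c;
        simp add: sum_idx mc_def vol_coeff_rules[OF q] del: of_real_divide of_real_add of_real_diff;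
        simp add: qs_def qt_def q power2_eq_square field_simps)
  finally show ?thesis .
qed

lemma forms_lincomb:
  assumes q: "q \<noteq> 0" and "\<And>i. i \<in> I \<Longrightarrow> F i \<in> forms q k"
  shows "(\<lambda>w. \<Sum>i\<in>I. c i *\<^sub>C F i w) \<in> forms q k"
proof -
  have p: "preimage q k (F i) \<in> tensors k" "antisym q k (preimage q k (F i)) = F i" if "i \<in> I" for i
    using preimage_forms[OF assms(2)[OF that]] by auto
  let ?\<xi> = "\<lambda>w. \<Sum>i\<in>I. c i *\<^sub>C preimage q k (F i) w"
  have \<xi>: "?\<xi> \<in> tensors k" using p(1) by (simp add: tensors_def)
  have eq: "antisym q k ?\<xi> = (\<lambda>w. \<Sum>i\<in>I. c i *\<^sub>C F i w)"
  proof (rule tensors_eqI[OF antisym_tensors[OF \<xi>]])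
    show "(\<lambda>w. \<Sum>i\<in>I. c i *\<^sub>C F i w) \<in> tensors k"
      using forms_tensors[OF assms(2)] by (simp add: tensors_def)
    show "antisym q k ?\<xi> w = (\<Sum>i\<in>I. c i *\<^sub>C F i w)" if "w \<in> words k" for w
      unfolding antisym_sum[OF q that] using p(2) by simp
  qed
  have "antisym q k ?\<xi> \<in> forms q k" unfolding forms_def using \<xi> by (rule imageI)
  then show ?thesis by (simp only: eq)
qed

lemma zero_forms: "q \<noteq> 0 \<Longrightarrow> (\<lambda>w. 0) \<in> forms q k"
  using forms_lincomb[of q "{}"] by simp

lemma antisym_map:
  fixes g :: "'v::complex_vector \<Rightarrow> 'w::complex_vector"
  assumes q: "q \<noteq> 0" and g: "clinear g" and \<xi>: "\<xi> \<in> tensors k"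
  shows "antisym q k (\<lambda>w. g (\<xi> w)) = (\<lambda>w. g (antisym q k \<xi> w))"
proof (rule tensors_eqI)
  have 0: "g 0 = 0" by (rule clinearD[OF g])
  show "antisym q k (\<lambda>w. g (\<xi> w)) \<in> tensors k"
    by (rule antisym_tensors) (use \<xi> in \<open>simp add: tensors_def 0\<close>)
  show "(\<lambda>w. g (antisym q k \<xi> w)) \<in> tensors k"
    using antisym_tensors[OF \<xi>, of q] by (simp add: tensors_def 0)
qed (simp add: antisym_linear_map[OF q g])

definition tensor_cons :: "(idx \<Rightarrow> 'v \<Rightarrow> 'w) \<Rightarrow> 'v coeffs \<Rightarrow> 'w::zero coeffs" where
  "tensor_cons G \<xi> = (\<lambda>w. case w of [] \<Rightarrow> 0 | a # u \<Rightarrow> G a (\<xi> u))"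

lemma tensor_cons_tensors:
  assumes "\<And>a. G a 0 = 0" and "\<xi> \<in> tensors k"
  shows "tensor_cons G \<xi> \<in> tensors (Suc k)"
  using assms by (auto simp: tensor_cons_def tensors_def words_iff split: list.split)

text \<open>By \<open>antisym_Suc\<close> the antisymmetriser sees the tail only through its own
  antisymmetrisation. This makes the wedge with a 1-form independent of the preimage chosen in
  \<open>wedge\<close>.\<close>

lemma antisym_tensor_cons_cong:
  assumes q: "q \<noteq> 0" and G: "\<And>a. clinear (G a)" and \<xi>: "\<xi> \<in> tensors k" "\<xi>' \<in> tensors k"
    and eq: "antisym q k \<xi> = antisym q k \<xi>'"
  shows "antisym q (Suc k) (tensor_cons G \<xi>) = antisym q (Suc k) (tensor_cons G \<xi>')"
proof (rule tensors_eqI)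
  have 0: "G a 0 = 0" for a by (rule clinearD[OF G])
  show "antisym q (Suc k) (tensor_cons G \<xi>) \<in> tensors (Suc k)" "antisym q (Suc k) (tensor_cons G \<xi>') \<in> tensors (Suc k)"
    by (intro antisym_tensors tensor_cons_tensors 0 \<xi>)+
  fix v :: "idx list" assume v: "v \<in> words (Suc k)"
  have "antisym q k (\<lambda>u. tensor_cons G \<xi> (a # u)) = antisym q k (\<lambda>u. tensor_cons G \<xi>' (a # u))" for a
    unfolding tensor_cons_def list.case antisym_map[OF q G \<xi>(1)] antisym_map[OF q G \<xi>(2)] eq ..
  then show "antisym q (Suc k) (tensor_cons G \<xi>) v = antisym q (Suc k) (tensor_cons G \<xi>') v"
    unfolding antisym_Suc[OF q v] by simp
qed

section \<open>Invariant 1-forms as combinations of exact forms\<close>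

locale suq2_calculus = suq2_duality q \<Delta>U \<epsilon>U SU K Ki E F \<Delta>A \<epsilon>A SA a c pair
  + exterior_derivative q "left_action \<Delta>A pair" "Lvec q K Ki E F" f d
  for q :: real
    and \<Delta>U :: "'u::complex_algebra_1 \<Rightarrow> ('u, 'u) tensor" and \<epsilon>U SU and K Ki E F :: 'u
    and \<Delta>A :: "'a::complex_star_algebra \<Rightarrow> ('a, 'a) tensor" and \<epsilon>A SA and a c :: 'a
    and pair :: "'u \<Rightarrow> 'a \<Rightarrow> complex"
    and f :: "idx \<Rightarrow> idx \<Rightarrow> 'u" and d :: "'a coeffs \<Rightarrow> 'a coeffs" +
  assumes struct: "structure_elements \<Delta>U L f"
begin

abbreviation act where "act \<equiv> left_action \<Delta>A pair"

lemma L_lact_prod: "L e \<triangleright> (x * y) = x * (L e \<triangleright> y) + (\<Sum>b\<in>UNIV. (L b \<triangleright> x) * (f b e \<triangleright> y))"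
proof -
  have "\<Delta>U (L e) = 1 \<otimes> L e + (\<Sum>b\<in>UNIV. L b \<otimes> f b e)"
    using struct by (simp add: structure_elements_def)
  then show ?thesis
    unfolding P.lact_prod sum_idx
    by (simp add: tensor_lift_linear[OF cbilinear_lact_pair] tensor_lift_pure[OF cbilinear_lact_pair] P.lact_one)
qed

text \<open>A solution \<open>x\<^sub>g\<close> of \<open>\<Sum> x\<^sub>g du\<^sub>g = \<omega>\<^sub>e\<close>, where \<open>u\<^sub>g\<close> runs through the four generators.\<close>

definition dual_coeff :: "idx \<Rightarrow> suq2_letter \<Rightarrow> 'a" where
  "dual_coeff e g = (case (e, g) of
      (Plus, Ga) \<Rightarrow> - (cr q *\<^sub>C c) | (Plus, Gc) \<Rightarrow> a
    | (Minus, Ga_star) \<Rightarrow> star c | (Minus, Gc_star) \<Rightarrow> - (cr q *\<^sub>C star a)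
    | (Zed, Ga) \<Rightarrow> star a | (Zed, Gc) \<Rightarrow> star c
    | (Zed, Ga_star) \<Rightarrow> - a | (Zed, Gc_star) \<Rightarrow> - (cr q * cr q) *\<^sub>C c
    | (Zero, Ga) \<Rightarrow> ((1 - w * (cr q - 1)) / casimir_ev 1) *\<^sub>C star a
    | (Zero, Gc) \<Rightarrow> ((1 - w * (cr q - 1)) / casimir_ev 1) *\<^sub>C star c
    | (Zero, Ga_star) \<Rightarrow> (w * (cr q - 1) / casimir_ev 1) *\<^sub>C a
    | (Zero, Gc_star) \<Rightarrow> (w * (cr q - 1) / casimir_ev 1 * (cr q * cr q)) *\<^sub>C c
    | _ \<Rightarrow> 0)"

lemma UNIV_suq2_letter: "UNIV = {Ga, Ga_star, Gc, Gc_star}"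
  using suq2_letter.exhaust by auto

lemma casimir_ev_1_nonzero: "casimir_ev 1 \<noteq> 0"
proof -
  have "casimir_ev 0 = 0" by (simp add: casimir_ev_def)
  then show ?thesis using casimir_ev_inject[of 1 0] by simp
qed

lemma L_gen:
  "L Plus \<triangleright> a = - (cr q *\<^sub>C star c)" "L Plus \<triangleright> c = star a" "L Plus \<triangleright> star a = 0" "L Plus \<triangleright> star c = 0"
  "L Minus \<triangleright> a = 0" "L Minus \<triangleright> c = 0" "L Minus \<triangleright> star a = c" "L Minus \<triangleright> star c = - (cr (1 / q) *\<^sub>C a)"
  "L Zed \<triangleright> a = (w * (cr q - 1)) *\<^sub>C a" "L Zed \<triangleright> c = (w * (cr q - 1)) *\<^sub>C c"
  "L Zed \<triangleright> star a = (w * (cr (1 / q) - 1)) *\<^sub>C star a" "L Zed \<triangleright> star c = (w * (cr (1 / q) - 1)) *\<^sub>C star c"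
  by (simp_all only: Lvec.simps P.lact_scaleC clinearD[OF P.clinear_lact_left] P.lact_mult P.lact_one lact_gen P.lact_linear
      scaleC_scaleC h_hi scaleC_one cv.scale_zero_right cv.scale_minus_right cv.scale_left_diff_distrib right_diff_distrib
      cv.scale_right_diff_distrib mult_1_right) (simp_all add: h_hi h_hi(1)[simplified] mult_ac scaleC_one)

lemma L_Zero_gen: "L Zero \<triangleright> a = casimir_ev 1 *\<^sub>C a" "L Zero \<triangleright> c = casimir_ev 1 *\<^sub>C c"
  "L Zero \<triangleright> star a = casimir_ev 1 *\<^sub>C star a" "L Zero \<triangleright> star c = casimir_ev 1 *\<^sub>C star c"
proof -
  show c: "L Zero \<triangleright> c = casimir_ev 1 *\<^sub>C c" using L_Zero_mono[of 1 0] by (simp del: One_nat_def)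
  show sa: "L Zero \<triangleright> star a = casimir_ev 1 *\<^sub>C star a" using L_Zero_mono[of 0 1] by (simp del: One_nat_def)
  have "(L Zero \<triangleright> c) \<triangleleft> E = L Zero \<triangleright> (c \<triangleleft> E)" by (rule P.ract_lact)
  then show "L Zero \<triangleright> a = casimir_ev 1 *\<^sub>C a" by (simp add: c P.ract_linear ract_gen)
  have "(L Zero \<triangleright> star a) \<triangleleft> E = L Zero \<triangleright> (star a \<triangleleft> E)" by (rule P.ract_lact)
  then have "cr q *\<^sub>C (L Zero \<triangleright> star c) = cr q *\<^sub>C (casimir_ev 1 *\<^sub>C star c)"
    unfolding sa P.ract_linear ract_gen P.lact_linear neg_equal_iff_equal
    by (simp only: cv.scale_minus_right neg_equal_iff_equal cv.scale_left_commute[of "casimir_ev 1" "cr q"])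
  then show "L Zero \<triangleright> star c = casimir_ev 1 *\<^sub>C star c"
    using cr_q_nonzero by (simp only: cv.scale_cancel_left) blast
qed

text \<open>\<open>L Zed\<close> acts by one scalar on \<open>a\<close>, \<open>c\<close> and by
  another on their adjoints, and \<open>L Zero\<close> by a common scalar on all four, so for these
  operators only the two block sums matter. Their values solve the resulting 2 by 2 linear system;
  the other two identities treat the ladder operators.\<close>

lemma dual_coeff_blocks:
  "dual_coeff e Ga * a + dual_coeff e Gc * c
    = (case e of Zed \<Rightarrow> 1 | Zero \<Rightarrow> (1 - w * (cr q - 1)) / casimir_ev 1 | _ \<Rightarrow> 0) *\<^sub>C 1"
  "dual_coeff e Ga_star * star a + dual_coeff e Gc_star * star c
    = (case e of Zed \<Rightarrow> - 1 | Zero \<Rightarrow> w * (cr q - 1) / casimir_ev 1 | _ \<Rightarrow> 0) *\<^sub>C 1"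
  "dual_coeff e Ga * - (cr q *\<^sub>C star c) + dual_coeff e Gc * star a = (if e = Plus then 1 else 0) *\<^sub>C 1"
  "dual_coeff e Ga_star * c + dual_coeff e Gc_star * - (cr (1 / q) *\<^sub>C a) = (if e = Minus then 1 else 0) *\<^sub>C 1"
proof -
  have q1: "cr (1 / q) * cr q = 1" using scalar_relations(1) by (simp only: mult.commute)
  have unit: "star a * a + star c * c = 1" "a * star a + (cr q * cr q) *\<^sub>C (c * star c) = 1"
    using A_relations(4,5) by (simp_all add: power2_eq_square)
  have qq: "cr q * cr q * cr (1 / q) = cr q" using scalar_relations(1) by (simp only: mult.assoc mult_1_right)
  have lin: "r *\<^sub>C x + r *\<^sub>C y = r *\<^sub>C (x + y)" for r and x y :: 'a by (simp only: scaleC_add_right)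
  show "dual_coeff e Ga * a + dual_coeff e Gc * c
    = (case e of Zed \<Rightarrow> 1 | Zero \<Rightarrow> (1 - w * (cr q - 1)) / casimir_ev 1 | _ \<Rightarrow> 0) *\<^sub>C 1"
    by (cases e; simp only: dual_coeff_def prod.case idx.case suq2_letter.case scaleC_mult_left lin unit mult_minus_left;
        simp add: A_relations scaleC_one)
  show "dual_coeff e Ga_star * star a + dual_coeff e Gc_star * star c
    = (case e of Zed \<Rightarrow> - 1 | Zero \<Rightarrow> w * (cr q - 1) / casimir_ev 1 | _ \<Rightarrow> 0) *\<^sub>C 1"
    by (cases e; simp only: dual_coeff_def prod.case idx.case suq2_letter.case scaleC_mult_left lin unit mult_minus_left
        scaleC_scaleC[symmetric] minus_add_distrib[symmetric] cv.scale_minus_left;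
        simp add: A_relations scaleC_one power2_eq_square)
  show "dual_coeff e Ga * - (cr q *\<^sub>C star c) + dual_coeff e Gc * star a = (if e = Plus then 1 else 0) *\<^sub>C 1"
    using unit(2)
    by (cases e; simp add: dual_coeff_def scaleC_mult_left scaleC_mult_right A_relations(6) scaleC_one add.commute)
  show "dual_coeff e Ga_star * c + dual_coeff e Gc_star * - (cr (1 / q) *\<^sub>C a) = (if e = Minus then 1 else 0) *\<^sub>C 1"
    using unit(1) qq q1 scalar_relations(1)
    by (cases e; simp add: dual_coeff_def scaleC_mult_left scaleC_mult_right A_relations(1) scaleC_one mult.assoc add.commute q1 scaleC_scaleC
        del: of_real_divide)
qed

lemma dual_coeff_sum:
  "(\<Sum>g\<in>UNIV. dual_coeff e g * (L b \<triangleright> suq2_gen a c g)) = (if e = b then 1 else 0)"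
proof -
  have expand: "(\<Sum>g\<in>UNIV. dual_coeff e g * (L b \<triangleright> suq2_gen a c g))
    = (dual_coeff e Ga * (L b \<triangleright> a) + dual_coeff e Gc * (L b \<triangleright> c))
      + (dual_coeff e Ga_star * (L b \<triangleright> star a) + dual_coeff e Gc_star * (L b \<triangleright> star c))"
    by (simp add: UNIV_suq2_letter add_ac)
  have lin: "r *\<^sub>C x + r *\<^sub>C y = r *\<^sub>C (x + y)" for r and x y :: 'a by (simp only: scaleC_add_right)
  have n: "casimir_ev 1 * z / casimir_ev 1 = z" "z / casimir_ev 1 * casimir_ev 1 = z" for z using casimir_ev_1_nonzero by simp_all
  have w: "w * (cr q - 1) - w * (cr (1 / q) - 1) = 1" using scalar_relations(2) by algebra
  show ?thesis
  proof (cases b)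
    case Minus
    then show ?thesis unfolding expand using dual_coeff_blocks(4)[of e]
      by (simp add: L_gen scaleC_one del: mult_minus_right)
  next
    case Plus
    then show ?thesis unfolding expand using dual_coeff_blocks(3)[of e]
      by (simp add: L_gen scaleC_one del: mult_minus_right)
  next
    case Zero
    have "(\<Sum>g\<in>UNIV. dual_coeff e g * (L b \<triangleright> suq2_gen a c g))
      = casimir_ev 1 *\<^sub>C ((case e of Zed \<Rightarrow> 1 | Zero \<Rightarrow> (1 - w * (cr q - 1)) / casimir_ev 1 | _ \<Rightarrow> 0) *\<^sub>C 1
        + (case e of Zed \<Rightarrow> - 1 | Zero \<Rightarrow> w * (cr q - 1) / casimir_ev 1 | _ \<Rightarrow> 0) *\<^sub>C 1)"
      unfolding expand unfolding Zero L_Zero_gen scaleC_mult_right lin dual_coeff_blocks ..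
    also have "\<dots> = (casimir_ev 1 * ((case e of Zed \<Rightarrow> 1 | Zero \<Rightarrow> (1 - w * (cr q - 1)) / casimir_ev 1 | _ \<Rightarrow> 0)
        + (case e of Zed \<Rightarrow> - 1 | Zero \<Rightarrow> w * (cr q - 1) / casimir_ev 1 | _ \<Rightarrow> 0))) *\<^sub>C 1"
      by (simp only: scaleC_add_left scaleC_add_right scaleC_scaleC distrib_left)
    also have "casimir_ev 1 * ((case e of Zed \<Rightarrow> 1 | Zero \<Rightarrow> (1 - w * (cr q - 1)) / casimir_ev 1 | _ \<Rightarrow> 0)
        + (case e of Zed \<Rightarrow> - 1 | Zero \<Rightarrow> w * (cr q - 1) / casimir_ev 1 | _ \<Rightarrow> 0)) = (if e = b then 1 else 0)"
      using casimir_ev_1_nonzero Zero by (cases e) (simp_all add: distrib_left del: of_real_divide One_nat_def)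
    finally show ?thesis by (simp add: scaleC_one)
  next
    case Zed
    have "(\<Sum>g\<in>UNIV. dual_coeff e g * (L b \<triangleright> suq2_gen a c g))
      = (w * (cr q - 1)) *\<^sub>C ((case e of Zed \<Rightarrow> 1 | Zero \<Rightarrow> (1 - w * (cr q - 1)) / casimir_ev 1 | _ \<Rightarrow> 0) *\<^sub>C 1)
        + (w * (cr (1 / q) - 1)) *\<^sub>C ((case e of Zed \<Rightarrow> - 1 | Zero \<Rightarrow> w * (cr q - 1) / casimir_ev 1 | _ \<Rightarrow> 0) *\<^sub>C 1)"
      unfolding expand unfolding Zed L_gen scaleC_mult_right lin dual_coeff_blocks ..
    also have "\<dots> = ((w * (cr q - 1)) * (case e of Zed \<Rightarrow> 1 | Zero \<Rightarrow> (1 - w * (cr q - 1)) / casimir_ev 1 | _ \<Rightarrow> 0)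
        + (w * (cr (1 / q) - 1)) * (case e of Zed \<Rightarrow> - 1 | Zero \<Rightarrow> w * (cr q - 1) / casimir_ev 1 | _ \<Rightarrow> 0)) *\<^sub>C 1"
      by (simp only: scaleC_add_left scaleC_scaleC)
    also have "(w * (cr q - 1)) * (case e of Zed \<Rightarrow> 1 | Zero \<Rightarrow> (1 - w * (cr q - 1)) / casimir_ev 1 | _ \<Rightarrow> 0)
        + (w * (cr (1 / q) - 1)) * (case e of Zed \<Rightarrow> - 1 | Zero \<Rightarrow> w * (cr q - 1) / casimir_ev 1 | _ \<Rightarrow> 0)
      = (if e = b then 1 else 0)"
    proof -
      \<comment> \<open>Here x and y are the eigenvalues of \<open>L Zed\<close> on the two blocks,
        and their difference is 1.\<close>
      have "x * ((1 - x) / k) + y * (x / k) = 0" if "x - y = 1" for x y k :: complex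
      proof -
        have "x = y + 1" using that by (simp add: algebra_simps)
        then show ?thesis by (simp add: field_simps)
      qed
      from this[OF w] show ?thesis using w Zed by (cases e) (simp_all del: of_real_divide One_nat_def)
    qed
    finally show ?thesis by (simp add: scaleC_one)
  qed
qed

end

lemma antisym_lincomb:
  assumes q: "q \<noteq> 0" and \<xi>: "\<And>i. i \<in> I \<Longrightarrow> \<xi> i \<in> tensors k"
  shows "antisym q k (\<lambda>w. \<Sum>i\<in>I. c i *\<^sub>C \<xi> i w) = (\<lambda>w. \<Sum>i\<in>I. c i *\<^sub>C antisym q k (\<xi> i) w)"
proof (rule tensors_eqI)
  show "antisym q k (\<lambda>w. \<Sum>i\<in>I. c i *\<^sub>C \<xi> i w) \<in> tensors k"
    by (rule antisym_tensors) (use \<xi> in \<open>simp add: tensors_def\<close>)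
  show "(\<lambda>w. \<Sum>i\<in>I. c i *\<^sub>C antisym q k (\<xi> i) w) \<in> tensors k"
    using antisym_tensors[OF \<xi>, of _ q] by (simp add: tensors_def)
qed (rule antisym_sum[OF q])

lemma antisym_add:
  assumes q: "q \<noteq> 0" and "\<xi> \<in> tensors k" "\<xi>' \<in> tensors k"
  shows "antisym q k (\<lambda>w. \<xi> w + \<xi>' w) = (\<lambda>w. antisym q k \<xi> w + antisym q k \<xi>' w)"
proof -
  have "(if b then \<xi> else \<xi>') \<in> tensors k" for b using assms(2,3) by simp
  from antisym_lincomb[where I = UNIV and c = "\<lambda>_. 1" and \<xi> = "\<lambda>b. if b then \<xi> else \<xi>'", OF q this] show ?thesis
    by (simp add: UNIV_bool scaleC_one add.commute)
qed

lemma antisym_zero: "q \<noteq> 0 \<Longrightarrow> antisym q k (\<lambda>w. 0) = (\<lambda>w. 0)"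
  using antisym_lincomb[of q "{}"] by simp

lemma clinear_mult_left: "clinear ((*) x)" for x :: "'a::complex_algebra_1"
  by (simp add: clinear_iff distrib_left scaleC_mult_right)

lemma forms_antisym: "\<xi> \<in> tensors k \<Longrightarrow> antisym q k \<xi> \<in> forms q k"
  by (simp add: forms_def)

lemma forms_mult_left:
  fixes x :: "'a::complex_algebra_1"
  assumes q: "q \<noteq> 0" and "\<theta> \<in> forms q k"
  shows "(\<lambda>w. x * \<theta> w) \<in> forms q k"
proof -
  obtain \<xi> where \<xi>: "\<xi> \<in> tensors k" "\<theta> = antisym q k \<xi>" using assms(2) by (auto simp: forms_def)
  have "antisym q k (\<lambda>w. x * \<xi> w) \<in> forms q k"
    by (rule forms_antisym) (use \<xi> in \<open>simp add: tensors_def\<close>)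
  then show ?thesis by (simp only: antisym_map[OF q clinear_mult_left \<xi>(1)] \<xi>(2))
qed

lemma form0_tensors: "form0 x \<in> tensors 0"
  by (simp add: form0_def tensors_def words_0)

lemma form1_tensors: "form1 X \<in> tensors (Suc 0)"
  by (auto simp: form1_def tensors_def words_iff split: list.splits)

lemma left_mult_tensors: "\<eta> \<in> tensors k \<Longrightarrow> left_mult x \<eta> \<in> tensors k"
  by (simp add: tensors_def left_mult_def)

lemma forms_form0: "q \<noteq> 0 \<Longrightarrow> form0 x \<in> forms q 0"
  by (simp add: forms_low_degree form0_tensors)

section \<open>Maurer-Cartan equations and closed 3-forms\<close>

context suq2_calculus
begin

lemma L_unit: "L e \<triangleright> 1 = 0"
  by (cases e; simp only: Lvec.simps P.lact_scaleC clinearD[OF P.clinear_lact_left] P.lact_mult P.lact_one lact_unit_gen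
      P.lact_linear) simp_all

text \<open>The twisted Leibniz rule with second factor 1 expresses each L_e through all L_b with
  coefficients \<epsilon>(f_be); \<open>dual_coeff\<close> separates the L_b and identifies these
  coefficients.\<close>

lemma f_unit: "f b e \<triangleright> 1 = (if b = e then 1 else 0)"
proof -
  have one: "(1::'a) \<noteq> 0" by simp
  have "L e \<triangleright> x = (\<Sum>b'\<in>UNIV. \<epsilon>U (f b' e) *\<^sub>C (L b' \<triangleright> x))" for x
    using L_lact_prod[of e x 1] unfolding L_unit by (simp add: P.lact_unit scaleC_mult_right)
  then have "(\<Sum>g\<in>UNIV. dual_coeff b g * (L e \<triangleright> suq2_gen a c g))
    = (\<Sum>g\<in>UNIV. dual_coeff b g * (\<Sum>b'\<in>UNIV. \<epsilon>U (f b' e) *\<^sub>C (L b' \<triangleright> suq2_gen a c g)))"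
    by simp
  also have "\<dots> = (\<Sum>b'\<in>UNIV. \<epsilon>U (f b' e) *\<^sub>C (\<Sum>g\<in>UNIV. dual_coeff b g * (L b' \<triangleright> suq2_gen a c g)))"
    unfolding sum_distrib_left cv.scale_sum_right scaleC_mult_right by (rule sum.swap)
  also have "\<dots> = \<epsilon>U (f b e) *\<^sub>C 1"
    unfolding dual_coeff_sum by (simp add: if_distrib cong: if_cong)
  finally show ?thesis unfolding dual_coeff_sum P.lact_unit by simp
qed

lemma wedge_0:
  assumes "\<theta> \<in> forms q l"
  shows "wedge q act f 0 l (form0 x) \<theta> = (\<lambda>w. x * \<theta> w)"
proof -
  note p = preimage_forms[OF assms]
  have "tensor_forms act f 0 (form0 x) (preimage q l \<theta>) = (\<lambda>w. x * preimage q l \<theta> w)"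
    by (rule ext) (simp add: tensor_forms_def words_0 form0_def P.lact_one)
  then show ?thesis
    by (simp add: wedge_def preimage_low_degree[OF q_nonzero _ form0_tensors] antisym_map[OF q_nonzero clinear_mult_left p(1)] p(2))
qed

lemma wedge_1:
  assumes \<xi>: "\<xi> \<in> tensors l"
  shows "wedge q act f (Suc 0) l (form1 X) (antisym q l \<xi>)
    = antisym q (Suc l) (tensor_cons (\<lambda>a z. \<Sum>b\<in>UNIV. X b * (f b a \<triangleright> z)) \<xi>)"
proof -
  note p = preimage_forms[OF forms_antisym[OF \<xi>, of q]]
  let ?G = "\<lambda>a z. \<Sum>b\<in>UNIV. X b * (f b a \<triangleright> z)"
  have "tensor_forms act f (Suc 0) (form1 X) \<zeta> = tensor_cons ?G \<zeta>" for \<zeta>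
  proof
    fix w
    show "tensor_forms act f (Suc 0) (form1 X) \<zeta> w = tensor_cons ?G \<zeta> w"
      by (cases w) (simp_all add: tensor_forms_def tensor_cons_def sum_words_Suc sum_words_0 form1_def)
  qed
  moreover have "clinear (?G a)" for a
    by (simp add: clinear_iff P.lact_linear distrib_left sum.distrib scaleC_mult_right cv.scale_sum_right)
  ultimately show ?thesis
    using antisym_tensor_cons_cong[OF q_nonzero, of ?G "preimage q l (antisym q l \<xi>)" l \<xi>] p \<xi>
    by (simp add: wedge_def preimage_low_degree[OF q_nonzero _ form1_tensors])
qed

lemma d_sum:
  assumes "finite I" and "\<And>i. i \<in> I \<Longrightarrow> G i \<in> forms q k"
  shows "d (\<lambda>w. \<Sum>i\<in>I. r i *\<^sub>C G i w) = (\<lambda>w. \<Sum>i\<in>I. r i *\<^sub>C d (G i) w)"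
  using assms
proof (induction I rule: finite_induct)
  case empty
  show ?case using d_linear[OF zero_forms[OF q_nonzero, of k] zero_forms[OF q_nonzero, of k], where r = 0 and s = 0] by simp
next
  case (insert i I)
  have "d (\<lambda>w. r i *\<^sub>C G i w + 1 *\<^sub>C (\<Sum>i\<in>I. r i *\<^sub>C G i w))
    = (\<lambda>w. r i *\<^sub>C d (G i) w + 1 *\<^sub>C d (\<lambda>w. \<Sum>i\<in>I. r i *\<^sub>C G i w) w)"
    using insert.prems by (intro d_linear[of _ k] forms_lincomb[OF q_nonzero]) auto
  then show ?case using insert by (simp add: scaleC_one)
qed

lemma d_mult:
  assumes "\<theta> \<in> forms q l"
  shows "d (\<lambda>w. x * \<theta> w) = (\<lambda>w. wedge q act f (Suc 0) l (form1 (\<lambda>a. L a \<triangleright> x)) \<theta> w + x * d \<theta> w)"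
  using d_wedge[OF forms_form0[OF q_nonzero, of x] assms]
  by (simp add: wedge_0[OF assms] wedge_0[OF d_degree[OF assms]] d_function)

definition d_cons :: "'a \<Rightarrow> complex coeffs \<Rightarrow> 'a coeffs" where
  "d_cons x = tensor_cons (\<lambda>a r. r *\<^sub>C (L a \<triangleright> x))"

lemma d_cons_tensors: "\<eta> \<in> tensors l \<Longrightarrow> d_cons x \<eta> \<in> tensors (Suc l)"
  unfolding d_cons_def by (rule tensor_cons_tensors) simp_all

text \<open>Scalar coefficients move through 1-forms untwisted, because f_ba acts on 1 as a
  Kronecker symbol. The wedge of dx with an invariant form is thus the plain concatenation
  \<open>d_cons\<close>.\<close>

lemma wedge_d_cons:
  assumes \<eta>: "\<eta> \<in> tensors l"
  shows "wedge q act f (Suc 0) l (form1 (\<lambda>a. L a \<triangleright> x)) (antisym q l (left_mult 1 \<eta>)) = antisym q (Suc l) (d_cons x \<eta>)"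
proof -
  have "tensor_cons (\<lambda>a z. \<Sum>b\<in>UNIV. (L b \<triangleright> x) * (f b a \<triangleright> z)) (left_mult 1 \<eta>) = d_cons x \<eta>"
  proof
    fix w
    show "tensor_cons (\<lambda>a z. \<Sum>b\<in>UNIV. (L b \<triangleright> x) * (f b a \<triangleright> z)) (left_mult 1 \<eta>) w = d_cons x \<eta> w"
      by (cases w) (simp_all add: tensor_cons_def d_cons_def left_mult_def P.lact_linear f_unit scaleC_mult_right
          if_distrib[of "(*) _"] if_distrib[of "(*\<^sub>C) _"] cong: if_cong)
  qed
  then show ?thesis by (simp add: wedge_1 left_mult_tensors \<eta>)
qed

definition pair_cons :: "(idx \<Rightarrow> idx \<Rightarrow> 'a) \<Rightarrow> complex coeffs \<Rightarrow> 'a coeffs" where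
  "pair_cons N \<eta> = (\<lambda>w. case w of a # b # u \<Rightarrow> \<eta> u *\<^sub>C N a b | _ \<Rightarrow> 0)"

lemma pair_cons_tensors: "\<eta> \<in> tensors l \<Longrightarrow> pair_cons N \<eta> \<in> tensors (Suc (Suc l))"
  by (auto simp: pair_cons_def tensors_def words_iff split: list.splits)

lemma L_Zero_commute: "L Zero * L e = L e * L Zero"
proof (cases e)
  case Plus
  have "L Zero * (E * Ki) = E * Ki * L Zero" by (metis L_Zero_central(1,4) mult.assoc)
  then show ?thesis unfolding Plus Lvec.simps(2) by (simp only: scaleC_mult_left scaleC_mult_right)
next
  case Minus
  have "L Zero * (F * Ki) = F * Ki * L Zero" by (metis L_Zero_central(2,4) mult.assoc)
  then show ?thesis unfolding Minus Lvec.simps(1) by (simp only: scaleC_mult_left scaleC_mult_right)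
next
  case Zed
  have "L Zero * (Ki * Ki) = Ki * Ki * L Zero" by (metis L_Zero_central(4) mult.assoc)
  then show ?thesis unfolding Zed Lvec.simps
    by (simp only: scaleC_mult_left scaleC_mult_right right_diff_distrib left_diff_distrib mult_1_left mult_1_right)
qed simp

text \<open>The first-order terms complete the products L_a L_b to a solution of the equations in
  \<open>sig_fixed\<close>, so the tensor is fixed by the first braid and killed by the
  antisymmetriser.\<close>

lemma maurer_cartan:
  "antisym q (Suc (Suc l)) (pair_cons (\<lambda>a b. (L a \<triangleright> L b \<triangleright> y) + (\<Sum>e\<in>UNIV. mc q e a b *\<^sub>C (L e \<triangleright> y))) \<eta>) = (\<lambda>w. 0)"
  if \<eta>: "\<eta> \<in> tensors l"
proof (rule tensors_eqI)
  let ?N = "\<lambda>a b. (L a \<triangleright> L b \<triangleright> y) + (\<Sum>e\<in>UNIV. mc q e a b *\<^sub>C (L e \<triangleright> y))"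
  have rel: "L Zero \<triangleright> L Minus \<triangleright> y = L Minus \<triangleright> L Zero \<triangleright> y" "L Zero \<triangleright> L Plus \<triangleright> y = L Plus \<triangleright> L Zero \<triangleright> y"
    "L Zero \<triangleright> L Zed \<triangleright> y = L Zed \<triangleright> L Zero \<triangleright> y"
    "L Zed \<triangleright> L Minus \<triangleright> y = cr (q\<^sup>2) *\<^sub>C (L Minus \<triangleright> L Zed \<triangleright> y) + cr q *\<^sub>C (L Minus \<triangleright> y)"
    "L Zed \<triangleright> L Plus \<triangleright> y = cr (1 / q\<^sup>2) *\<^sub>C (L Plus \<triangleright> L Zed \<triangleright> y) - cr (1 / q) *\<^sub>C (L Plus \<triangleright> y)"
    "L Plus \<triangleright> L Minus \<triangleright> y = (L Minus \<triangleright> L Plus \<triangleright> y) - cr (q\<^sup>2 - 1 / q\<^sup>2) *\<^sub>C (L Zed \<triangleright> L Zed \<triangleright> y)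
      + cr ((q - 1 / q)\<^sup>2) *\<^sub>C (L Zero \<triangleright> L Zed \<triangleright> y) - cr (q + 1 / q) *\<^sub>C (L Zed \<triangleright> y) + cr (q - 1 / q) *\<^sub>C (L Zero \<triangleright> y)"
    using L_Zero_commute[of Minus] L_Zero_commute[of Plus] L_Zero_commute[of Zed] L_relations
    by (simp_all only: P.lact_mult[symmetric] P.lact_add[symmetric] P.lact_scaleC[symmetric] clinearD(5)[OF P.clinear_lact_left, symmetric])
  have qq: "cr q * cr q * cr (1 / q) = cr q" "cr (1 / q) * cr (1 / q) * cr q = cr (1 / q)"
    using scalar_relations(1) by (simp_all only: mult.assoc mult.commute[of "cr (1 / q)" "cr q"] mult_1_right)
  have fixed: "sig q ?N x z = ?N x z" for x z
    by (rule sig_fixed[OF q_nonzero])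
      (simp_all only: sum_idx mc_def prod.inject idx.simps simp_thms if_True if_False cv.scale_zero_left add_0_right add_0_left rel,
       simp_all only: scalars cv.scale_minus_left cv.scale_minus_right cv.scale_left_diff_distrib cv.scale_right_diff_distrib
         scaleC_add_left scaleC_add_right scaleC_scaleC qq, simp_all)
  have "braid_at q 0 (pair_cons ?N \<eta>) w = pair_cons ?N \<eta> w" if w: "w \<in> words (Suc (Suc l))" for w
  proof -
    obtain a b u where w: "w = a # b # u" using w by (auto simp: words_iff length_Suc_conv)
    have "braid_at q 0 (pair_cons ?N \<eta>) w = sig q (\<lambda>a b. \<eta> u *\<^sub>C ?N a b) a b"
      unfolding w by (simp add: braid_at_sig pair_cons_def)
    also have "\<dots> = \<eta> u *\<^sub>C sig q ?N a b" by (simp add: sig_def cv.scale_sum_right split_beta mult.commute scaleC_scaleC)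
    finally show ?thesis unfolding fixed by (simp add: w pair_cons_def)
  qed
  then show "antisym q (Suc (Suc l)) (pair_cons ?N \<eta>) w = 0" if "w \<in> words (Suc (Suc l))" for w
    using that by (intro antisym_kernel[OF q_nonzero, of 0]) auto
qed (use \<eta> in \<open>simp_all add: antisym_tensors pair_cons_tensors, simp add: tensors_def\<close>)

text \<open>The formal Leibniz expansion of \<open>d\<close> on the sum over b of x (L_b acting on
  y) \<omega>_b \<and> \<eta>, where d \<omega>_e is read through \<open>mc\<close> and d \<eta>
  through \<zeta>.\<close>

definition d_pair :: "complex coeffs \<Rightarrow> complex coeffs \<Rightarrow> 'a \<Rightarrow> 'a \<Rightarrow> 'a coeffs" where
  "d_pair \<eta> \<zeta> x y = (\<lambda>w. case w of a # b # u \<Rightarrow>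
      \<eta> u *\<^sub>C ((L a \<triangleright> (x * (L b \<triangleright> y))) + (\<Sum>e\<in>UNIV. mc q e a b *\<^sub>C (x * (L e \<triangleright> y))))
      - \<zeta> (b # u) *\<^sub>C (x * (L a \<triangleright> y)) | _ \<Rightarrow> 0)"

lemma d_pair_tensors: "\<eta> \<in> tensors l \<Longrightarrow> \<zeta> \<in> tensors (Suc l) \<Longrightarrow> d_pair \<eta> \<zeta> x y \<in> tensors (Suc (Suc l))"
  by (auto simp: d_pair_def tensors_def words_iff split: list.splits)

text \<open>Apply \<open>d\<close> to d(y\<psi>) = dy \<and> \<psi> + y d\<psi>: as d^2 vanishes on
  y\<psi> and on \<psi>, it follows that d(dy \<and> \<psi>) = - dy \<and> d\<psi>.\<close>

lemma d_antisym_d_cons: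
  assumes \<eta>: "\<eta> \<in> tensors l" and \<zeta>: "\<zeta> \<in> tensors (Suc l)"
    and d: "d (antisym q l (left_mult 1 \<eta>)) = antisym q (Suc l) (left_mult 1 \<zeta>)"
  shows "d (antisym q (Suc l) (d_cons y \<eta>)) = (\<lambda>w. - antisym q (Suc (Suc l)) (d_cons y \<zeta>) w)"
proof -
  let ?\<psi> = "antisym q l (left_mult (1::'a) \<eta>)"
  have \<psi>: "?\<psi> \<in> forms q l" by (intro forms_antisym left_mult_tensors \<eta>)
  have W: "antisym q (Suc l) (d_cons y \<eta>) \<in> forms q (Suc l)" by (intro forms_antisym d_cons_tensors \<eta>)
  have y\<psi>: "(\<lambda>w. y * ?\<psi> w) \<in> forms q l" by (rule forms_mult_left[OF q_nonzero \<psi>])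
  have yd\<psi>: "(\<lambda>w. y * d ?\<psi> w) \<in> forms q (Suc l)" by (intro forms_mult_left q_nonzero d_degree \<psi>)
  have d1: "d (\<lambda>w. y * ?\<psi> w) = (\<lambda>w. antisym q (Suc l) (d_cons y \<eta>) w + y * d ?\<psi> w)"
    unfolding d_mult[OF \<psi>] wedge_d_cons[OF \<eta>] ..
  have d2: "d (\<lambda>w. y * d ?\<psi> w) = antisym q (Suc (Suc l)) (d_cons y \<zeta>)"
    unfolding d_mult[OF d_degree[OF \<psi>]] d_square[OF \<psi>] unfolding d wedge_d_cons[OF \<zeta>] by simp
  have "(\<lambda>w. 0) = d (\<lambda>w. 1 *\<^sub>C antisym q (Suc l) (d_cons y \<eta>) w + 1 *\<^sub>C (y * d ?\<psi> w))"
    using d_square[OF y\<psi>] unfolding d1 by (simp add: scaleC_one)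
  also have "\<dots> = (\<lambda>w. d (antisym q (Suc l) (d_cons y \<eta>)) w + antisym q (Suc (Suc l)) (d_cons y \<zeta>) w)"
    unfolding d_linear[OF W yd\<psi>] d2 by (simp add: scaleC_one)
  finally show ?thesis by (metis (no_types, lifting) add_eq_0_iff2 eq_neg_iff_add_eq_0 ext)
qed

text \<open>Leibniz and d^2 = 0 give dx \<and> dy \<and> \<psi> - x dy \<and> d\<psi>. By the
  twisted Leibniz rule \<open>d_pair\<close> differs from a tensor for this by x times the tensor in
  \<open>maurer_cartan\<close>, which antisymmetrises to zero.\<close>

lemma d_mult_d_cons:
  assumes \<eta>: "\<eta> \<in> tensors l" and \<zeta>: "\<zeta> \<in> tensors (Suc l)"
    and d: "d (antisym q l (left_mult 1 \<eta>)) = antisym q (Suc l) (left_mult 1 \<zeta>)"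
  shows "d (\<lambda>w. x * antisym q (Suc l) (d_cons y \<eta>) w) = antisym q (Suc (Suc l)) (d_pair \<eta> \<zeta> x y)"
proof -
  let ?A = "tensor_cons (\<lambda>a z. \<Sum>b\<in>UNIV. (L b \<triangleright> x) * (f b a \<triangleright> z)) (d_cons y \<eta>)"
  let ?M = "pair_cons (\<lambda>a b. (L a \<triangleright> L b \<triangleright> y) + (\<Sum>e\<in>UNIV. mc q e a b *\<^sub>C (L e \<triangleright> y))) \<eta>"
  let ?Z = "d_cons y \<zeta>"
  note q = q_nonzero
  have A: "?A \<in> tensors (Suc (Suc l))"
    by (rule tensor_cons_tensors[OF _ d_cons_tensors[OF \<eta>]]) (simp add: P.lact_linear)
  have M: "(\<lambda>w. x * ?M w) \<in> tensors (Suc (Suc l))" using pair_cons_tensors[OF \<eta>] by (simp add: tensors_def)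
  have Z: "(\<lambda>w. - x * ?Z w) \<in> tensors (Suc (Suc l))" using d_cons_tensors[OF \<zeta>] by (simp add: tensors_def)
  have "d_pair \<eta> \<zeta> x y w = ?A w + (x * ?M w + - x * ?Z w)" if v: "w \<in> words (Suc (Suc l))" for w
  proof -
    obtain a b u where w: "w = a # b # u" using v by (auto simp: words_iff length_Suc_conv)
    have p: "(L a \<triangleright> (x * (L b \<triangleright> y))) = x * (L a \<triangleright> L b \<triangleright> y) + (\<Sum>c\<in>UNIV. (L c \<triangleright> x) * (f c a \<triangleright> L b \<triangleright> y))"
      by (rule L_lact_prod)
    show ?thesis
      unfolding w by (simp add: d_pair_def tensor_cons_def d_cons_def pair_cons_def p P.lact_linear scaleC_mult_right
        scaleC_add_right distrib_left sum_distrib_left cv.scale_sum_right)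
  qed
  then have split: "d_pair \<eta> \<zeta> x y = (\<lambda>w. ?A w + (x * ?M w + - x * ?Z w))"
    by (intro tensors_eqI[OF d_pair_tensors[OF \<eta> \<zeta>], of "\<lambda>w. ?A w + (x * ?M w + - x * ?Z w)"])
      (use A M Z in \<open>auto simp: tensors_def\<close>)
  have MZ: "(\<lambda>w. x * ?M w + - x * ?Z w) \<in> tensors (Suc (Suc l))" using M Z by (simp add: tensors_def)
  have "antisym q (Suc (Suc l)) (d_pair \<eta> \<zeta> x y) = (\<lambda>w. antisym q (Suc (Suc l)) ?A w - x * antisym q (Suc (Suc l)) ?Z w)"
    unfolding split antisym_add[OF q A MZ] antisym_add[OF q M Z]
      antisym_map[OF q clinear_mult_left pair_cons_tensors[OF \<eta>]] antisym_map[OF q clinear_mult_left d_cons_tensors[OF \<zeta>]]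
      maurer_cartan[OF \<eta>] by simp
  moreover have "d (\<lambda>w. x * antisym q (Suc l) (d_cons y \<eta>) w)
    = (\<lambda>w. antisym q (Suc (Suc l)) ?A w - x * antisym q (Suc (Suc l)) ?Z w)"
    unfolding d_mult[OF forms_antisym[OF d_cons_tensors[OF \<eta>]]] wedge_1[OF d_cons_tensors[OF \<eta>]]
      d_antisym_d_cons[OF \<eta> \<zeta> d] by simp
  ultimately show ?thesis by simp
qed

lemma sum_dual_coeff_d_cons:
  "(\<Sum>g\<in>UNIV. dual_coeff e g * d_cons (suq2_gen a c g) \<eta> v) = left_mult 1 (\<lambda>v. case v of [] \<Rightarrow> 0 | x # u \<Rightarrow> if x = e then \<eta> u else 0) v"
proof (cases v)
  case (Cons x u)
  have "(\<Sum>g\<in>UNIV. dual_coeff e g * d_cons (suq2_gen a c g) \<eta> v)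
    = \<eta> u *\<^sub>C (\<Sum>g\<in>UNIV. dual_coeff e g * (L x \<triangleright> suq2_gen a c g))"
    by (simp add: Cons d_cons_def tensor_cons_def scaleC_mult_right cv.scale_sum_right)
  then show ?thesis unfolding dual_coeff_sum by (simp add: Cons left_mult_def)
qed (simp add: d_cons_def tensor_cons_def left_mult_def)

text \<open>Summing over the generators first gives the constant 0 or 1 inside \<open>L x\<close>,
  which annihilates constants. Only the Maurer-Cartan term and the term with \<zeta> survive, and
  they make up \<open>d_word\<close>.\<close>

lemma sum_d_pair:
  "(\<Sum>g\<in>UNIV. d_pair \<eta> \<zeta> (dual_coeff e g) (suq2_gen a c g) (x # y # u))
    = (mc q e x y * \<eta> u - (if x = e then \<zeta> (y # u) else 0)) *\<^sub>C 1"
proof -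
  let ?u = "suq2_gen a c" and ?X = "dual_coeff e"
  have 1: "(\<Sum>g\<in>UNIV. L x \<triangleright> (?X g * (L y \<triangleright> ?u g))) = 0"
  proof -
    have "(\<Sum>g\<in>UNIV. L x \<triangleright> (?X g * (L y \<triangleright> ?u g))) = L x \<triangleright> (\<Sum>g\<in>UNIV. ?X g * (L y \<triangleright> ?u g))"
      by (simp add: UNIV_suq2_letter P.lact_linear)
    also have "\<dots> = 0" unfolding dual_coeff_sum by (simp only: L_unit P.lact_linear split: if_split) simp
    finally show ?thesis .
  qed
  have 2: "(\<Sum>g\<in>UNIV. \<Sum>e'\<in>UNIV. mc q e' x y *\<^sub>C (?X g * (L e' \<triangleright> ?u g))) = mc q e x y *\<^sub>C 1"
  proof -
    have "(\<Sum>g\<in>UNIV. \<Sum>e'\<in>UNIV. mc q e' x y *\<^sub>C (?X g * (L e' \<triangleright> ?u g)))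
      = (\<Sum>e'\<in>UNIV. mc q e' x y *\<^sub>C (\<Sum>g\<in>UNIV. ?X g * (L e' \<triangleright> ?u g)))"
      by (subst sum.swap) (simp add: cv.scale_sum_right)
    then show ?thesis unfolding dual_coeff_sum by (simp add: if_distrib cong: if_cong)
  qed
  have "(\<Sum>g\<in>UNIV. d_pair \<eta> \<zeta> (?X g) (?u g) (x # y # u))
    = \<eta> u *\<^sub>C ((\<Sum>g\<in>UNIV. L x \<triangleright> (?X g * (L y \<triangleright> ?u g))) + (\<Sum>g\<in>UNIV. \<Sum>e'\<in>UNIV. mc q e' x y *\<^sub>C (?X g * (L e' \<triangleright> ?u g))))
      - \<zeta> (y # u) *\<^sub>C (\<Sum>g\<in>UNIV. ?X g * (L x \<triangleright> ?u g))"
    by (simp add: d_pair_def sum_subtractf sum.distrib cv.scale_sum_right scaleC_add_right)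
  then show ?thesis unfolding 1 2 dual_coeff_sum
    by (simp add: scaleC_scaleC cv.scale_left_diff_distrib mult.commute)
qed

text \<open>For the word \<open>e # v\<close> the induction hypothesis supplies the tensor \<zeta> =
  \<open>d_word q v\<close> for \<open>d\<close> of the tail in \<open>d_mult_d_cons\<close>; the
  case of one letter is the Maurer-Cartan equation.\<close>

lemma d_antisym_basis_vec:
  "d (antisym q (length v) (left_mult 1 (basis_vec v))) = antisym q (Suc (length v)) (left_mult 1 (d_word q v))"
proof (induction v)
  case Nil
  have "left_mult (1::'a) (basis_vec []) = form0 1"
    by (rule ext) (simp add: left_mult_def basis_vec_def form0_def scaleC_one)
  moreover have "form1 (\<lambda>a. L a \<triangleright> 1) = (\<lambda>w. 0)"
    unfolding L_unit by (rule ext) (simp add: form1_def split: list.splits)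
  moreover have "left_mult (1::'a) (d_word q []) = (\<lambda>w. 0)" by (rule ext) (simp add: left_mult_def)
  ultimately show ?case
    by (simp add: antisym_id[OF q_nonzero] form0_tensors d_function antisym_zero[OF q_nonzero])
next
  case (Cons e v)
  let ?l = "length v" and ?\<eta> = "basis_vec v" and ?\<zeta> = "d_word q v"
  let ?u = "suq2_gen a c" and ?X = "dual_coeff e"
  note q = q_nonzero
  have \<eta>: "?\<eta> \<in> tensors ?l" by (auto simp: tensors_def basis_vec_def words_iff)
  note \<zeta> = d_word_tensors[of q v]
  have W: "antisym q (Suc ?l) (d_cons y ?\<eta>) \<in> forms q (Suc ?l)" for y by (intro forms_antisym d_cons_tensors \<eta>)
  have Xu: "(\<lambda>w. ?X g * d_cons (?u g) ?\<eta> w) \<in> tensors (Suc ?l)" for g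
    using d_cons_tensors[OF \<eta>] by (simp add: tensors_def)
  have "left_mult 1 (basis_vec (e # v)) = (\<lambda>w. \<Sum>g\<in>UNIV. 1 *\<^sub>C (?X g * d_cons (?u g) ?\<eta> w))"
    unfolding scaleC_one sum_dual_coeff_d_cons
    by (rule ext) (auto simp: left_mult_def basis_vec_def split: list.split)
  then have "antisym q (Suc ?l) (left_mult 1 (basis_vec (e # v)))
    = (\<lambda>w. \<Sum>g\<in>UNIV. 1 *\<^sub>C (?X g * antisym q (Suc ?l) (d_cons (?u g) ?\<eta>) w))"
    by (simp only: antisym_lincomb[where I = UNIV, OF q Xu] antisym_map[OF q clinear_mult_left d_cons_tensors[OF \<eta>]])
  moreover have "d (\<lambda>w. \<Sum>g\<in>UNIV. 1 *\<^sub>C (?X g * antisym q (Suc ?l) (d_cons (?u g) ?\<eta>) w))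
    = (\<lambda>w. \<Sum>g\<in>UNIV. 1 *\<^sub>C antisym q (Suc (Suc ?l)) (d_pair ?\<eta> ?\<zeta> (?X g) (?u g)) w)"
  proof -
    have fin: "finite (UNIV :: suq2_letter set)" by (simp add: UNIV_suq2_letter)
    show ?thesis
      using d_sum[OF fin, of "\<lambda>g w. ?X g * antisym q (Suc ?l) (d_cons (?u g) ?\<eta>) w" "Suc ?l" "\<lambda>_. 1"]
        forms_mult_left[OF q W] unfolding d_mult_d_cons[OF \<eta> \<zeta> Cons] by blast
  qed
  moreover have "(\<lambda>w. \<Sum>g\<in>UNIV. 1 *\<^sub>C antisym q (Suc (Suc ?l)) (d_pair ?\<eta> ?\<zeta> (?X g) (?u g)) w)
    = antisym q (Suc (Suc ?l)) (\<lambda>w. \<Sum>g\<in>UNIV. 1 *\<^sub>C d_pair ?\<eta> ?\<zeta> (?X g) (?u g) w)"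
    by (rule antisym_lincomb[OF q d_pair_tensors[OF \<eta> \<zeta>], symmetric])
  moreover have "(\<lambda>w. \<Sum>g\<in>UNIV. 1 *\<^sub>C d_pair ?\<eta> ?\<zeta> (?X g) (?u g) w) = left_mult 1 (d_word q (e # v))"
  proof (rule tensors_eqI[of _ "Suc (Suc ?l)"])
    show "(\<lambda>w. \<Sum>g\<in>UNIV. 1 *\<^sub>C d_pair ?\<eta> ?\<zeta> (?X g) (?u g) w) \<in> tensors (Suc (Suc ?l))"
      using d_pair_tensors[OF \<eta> \<zeta>] by (simp add: tensors_def)
    show "left_mult 1 (d_word q (e # v)) \<in> tensors (Suc (Suc ?l))"
      using left_mult_tensors[OF d_word_tensors[of q "e # v"]] by simp
    fix w :: "idx list" assume "w \<in> words (Suc (Suc ?l))"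
    then obtain x y u where w: "w = x # y # u" by (auto simp: words_iff length_Suc_conv)
    show "(\<Sum>g\<in>UNIV. 1 *\<^sub>C d_pair ?\<eta> ?\<zeta> (?X g) (?u g) w) = left_mult 1 (d_word q (e # v)) w"
      unfolding scaleC_one w sum_d_pair by (simp add: left_mult_def)
  qed
  ultimately show ?case by simp
qed

lemma d_antisym_3:
  assumes \<eta>: "\<eta> \<in> tensors 3"
  shows "d (antisym q 3 (left_mult 1 \<eta>)) = (\<lambda>w. 0)"
proof -
  have basis: "left_mult (1::'a) (basis_vec v) \<in> tensors 3" if "v \<in> words 3" for v
    using that by (intro left_mult_tensors) (auto simp: tensors_def basis_vec_def)
  have "left_mult (1::'a) \<eta> = (\<lambda>w. \<Sum>v\<in>words 3. \<eta> v *\<^sub>C left_mult 1 (basis_vec v) w)"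
  proof (rule tensors_eqI[OF left_mult_tensors[OF \<eta>]])
    show "(\<lambda>w. \<Sum>v\<in>words 3. \<eta> v *\<^sub>C left_mult (1::'a) (basis_vec v) w) \<in> tensors 3"
      using basis by (simp add: tensors_def)
    show "left_mult (1::'a) \<eta> w = (\<Sum>v\<in>words 3. \<eta> v *\<^sub>C left_mult 1 (basis_vec v) w)" if "w \<in> words 3" for w
      using basis_vec_expand[OF that, of \<eta>]
      by (simp add: left_mult_def scaleC_scaleC scaleC_complex_def flip: cv.scale_sum_left)
  qed
  then have "antisym q 3 (left_mult (1::'a) \<eta>) = (\<lambda>w. \<Sum>v\<in>words 3. \<eta> v *\<^sub>C antisym q 3 (left_mult 1 (basis_vec v)) w)"
    using antisym_lincomb[OF q_nonzero basis, where c = \<eta>] by simp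
  moreover have "d (\<lambda>w. \<Sum>v\<in>words 3. \<eta> v *\<^sub>C antisym q 3 (left_mult 1 (basis_vec v)) w)
    = (\<lambda>w. \<Sum>v\<in>words 3. \<eta> v *\<^sub>C d (antisym q 3 (left_mult 1 (basis_vec v))) w)"
    by (rule d_sum[OF finite_words forms_antisym[OF basis]])
  moreover have "d (antisym q 3 (left_mult 1 (basis_vec v))) = (\<lambda>w. 0)" if v: "v \<in> words 3" for v
  proof -
    have l: "length v = 3" "Suc 3 = 4" using v by (simp_all add: words_iff)
    have "left_mult (1::'a) (d_word q v) \<in> tensors 4"
      using left_mult_tensors[OF d_word_tensors[of q v]] by (simp add: l)
    from antisym_4[OF q_nonzero this]
    have "antisym q 4 (left_mult (1::'a) (d_word q v))
      = (\<lambda>u. vol_form q u *\<^sub>C ((\<Sum>w\<in>words 4. vol_coeff q w * d_word q v w) *\<^sub>C 1))"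
      by (simp add: left_mult_def scaleC_scaleC cv.scale_sum_left)
    then show ?thesis
      using d_antisym_basis_vec[of v] by (simp add: l vol_coeff_d_word[OF q_nonzero v])
  qed
  ultimately show ?thesis by simp
qed

lemma d_mult_antisym_3:
  assumes \<eta>: "\<eta> \<in> tensors 3"
  shows "d (\<lambda>w. y * antisym q 3 (left_mult 1 \<eta>) w)
    = (\<lambda>w. vol_form q w *\<^sub>C (\<Sum>b\<in>UNIV. (\<Sum>u\<in>words 3. vol_coeff q (b # u) * \<eta> u) *\<^sub>C (L b \<triangleright> y)))"
proof -
  have s: "Suc 3 = 4" by simp
  have t: "d_cons y \<eta> \<in> tensors 4" using d_cons_tensors[OF \<eta>] by simp
  have "(\<Sum>w\<in>words 4. vol_coeff q w *\<^sub>C d_cons y \<eta> w) = (\<Sum>w\<in>words (Suc 3). vol_coeff q w *\<^sub>C d_cons y \<eta> w)"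
    by simp
  also have "\<dots> = (\<Sum>b\<in>UNIV. (\<Sum>u\<in>words 3. vol_coeff q (b # u) * \<eta> u) *\<^sub>C (L b \<triangleright> y))"
    unfolding sum_words_Suc by (simp add: d_cons_def tensor_cons_def scaleC_scaleC cv.scale_sum_left)
  finally show ?thesis
    unfolding d_mult[OF forms_antisym[OF left_mult_tensors[OF \<eta>]]] wedge_d_cons[OF \<eta>] s d_antisym_3[OF \<eta>]
      antisym_4[OF q_nonzero t] by simp
qed

lemma d_hodge_left_1:
  "d (hodge_left q (contraction_coeff q \<alpha>) m 1 (form1 X)) = (\<lambda>w. vol_form q w *\<^sub>C
     (\<Sum>a\<in>UNIV. \<Sum>b\<in>UNIV. (\<Sum>u\<in>words 3. vol_coeff q (b # u) * tau q \<alpha> m a u) *\<^sub>C (L b \<triangleright> X a)))"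
proof -
  let ?\<theta> = "\<lambda>a w. X a * antisym q 3 (left_mult 1 (tau q \<alpha> m a)) w"
  have "hodge_left q (contraction_coeff q \<alpha>) m 1 (form1 X) = (\<lambda>w. \<Sum>a\<in>UNIV. 1 *\<^sub>C ?\<theta> a w)"
    unfolding hodge_left_1[OF q_nonzero] left_mult_def antisym_map[OF q_nonzero P.clinear_scaleC_const tau_tensors]
    by (simp add: scaleC_mult_right scaleC_one)
  moreover have "d (\<lambda>w. \<Sum>a\<in>UNIV. 1 *\<^sub>C ?\<theta> a w) = (\<lambda>w. \<Sum>a\<in>UNIV. 1 *\<^sub>C d (?\<theta> a) w)"
    by (rule d_sum[where k = 3]) (simp_all add: forms_mult_left q_nonzero forms_antisym left_mult_tensors tau_tensors)
  ultimately show ?thesis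
    by (simp add: d_mult_antisym_3[OF tau_tensors] scaleC_one cv.scale_sum_right)
qed

lemma minus_form0: "(\<lambda>w. - form0 x w) = form0 (- x)" for x :: 'a
  by (rule ext) (simp add: form0_def)

text \<open>The factor -\<i> m \<alpha> of \<open>pairing_tau\<close> and the factor \<i> m q^2
  \<alpha>^2 \<epsilon>^2 of the duality on 4-forms, with \<epsilon> = (1 - q^2) \<alpha>, multiply
  to +\<alpha> by the normalisation of m. The minus sign in \<open>laplacian\<close> therefore
  survives.\<close>

lemma laplacian_eq:
  assumes m: "m\<^sup>2 * q\<^sup>2 * \<alpha>\<^sup>2 * ((1 - q\<^sup>2) * \<alpha>)\<^sup>2 = 1"
  shows "laplacian q (contraction_coeff q \<alpha>) m d x = form0 (- (cr (2 * q * \<alpha>) *\<^sub>C (L Zero \<triangleright> x)))"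
proof -
  let ?s = "- \<i> * cr (m * \<alpha>)"
  have D: "(L Plus \<triangleright> L Minus \<triangleright> x) + cr (q\<^sup>2) *\<^sub>C (L Minus \<triangleright> L Plus \<triangleright> x) + cr (1 + q\<^sup>2) *\<^sub>C (L Zed \<triangleright> L Zed \<triangleright> x)
     - cr (2 * (q\<^sup>2 - 1)) *\<^sub>C (L Zero \<triangleright> L Zed \<triangleright> x) = cr (2 * q) *\<^sub>C (L Zero \<triangleright> x)"
    using arg_cong[OF Laplace_element, of "\<lambda>h. h \<triangleright> x"]
    by (simp only: P.lact_add P.lact_scaleC clinearD(5)[OF P.clinear_lact_left] P.lact_mult)
  \<comment> \<open>The pairings of (0, z) and (z, 0) are equal, and centrality of
    \<open>L Zero\<close> merges them into the single term with coefficient 2 (1 - q^2).\<close>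
  have comm: "L Zed \<triangleright> L Zero \<triangleright> x = L Zero \<triangleright> L Zed \<triangleright> x"
    by (simp only: P.lact_mult[symmetric] L_Zero_commute)
  have two: "cr (2 * (q\<^sup>2 - 1)) = - ((1 - qs q) + (1 - qs q))" "cr (1 + q\<^sup>2) = 1 + qs q" "cr (q\<^sup>2) = qs q"
    by (simp_all add: qs_def)
  have "(\<Sum>a\<in>UNIV. \<Sum>b\<in>UNIV. (\<Sum>u\<in>words 3. vol_coeff q (b # u) * tau q \<alpha> m a u) *\<^sub>C (L b \<triangleright> L a \<triangleright> x))
    = ?s *\<^sub>C ((L Plus \<triangleright> L Minus \<triangleright> x) + qs q *\<^sub>C (L Minus \<triangleright> L Plus \<triangleright> x) + (1 + qs q) *\<^sub>C (L Zed \<triangleright> L Zed \<triangleright> x)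
        + ((1 - qs q) + (1 - qs q)) *\<^sub>C (L Zero \<triangleright> L Zed \<triangleright> x))"
    unfolding pairing_tau[OF q_nonzero] scaleC_scaleC[symmetric] cv.scale_sum_right[symmetric]
    by (simp only: sum_idx prod.case idx.case cv.scale_zero_left scaleC_one comm scaleC_add_left[of "1 - qs q"])
      (simp only: add_0_left add_0_right add_ac)
  also have "\<dots> = ?s *\<^sub>C (cr (2 * q) *\<^sub>C (L Zero \<triangleright> x))"
    unfolding D[symmetric] two by (simp only: cv.scale_minus_left diff_minus_eq_add)
  finally have sum: "(\<Sum>a\<in>UNIV. \<Sum>b\<in>UNIV. (\<Sum>u\<in>words 3. vol_coeff q (b # u) * tau q \<alpha> m a u) *\<^sub>C (L b \<triangleright> L a \<triangleright> x))
    = ?s *\<^sub>C (cr (2 * q) *\<^sub>C (L Zero \<triangleright> x))" .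
  have "d (hodge_left q (contraction_coeff q \<alpha>) m 1 (d (form0 x)))
    = (\<lambda>w. vol_form q w *\<^sub>C (?s *\<^sub>C (cr (2 * q) *\<^sub>C (L Zero \<triangleright> x))))"
    unfolding d_function d_hodge_left_1 sum ..
  then have "laplacian q (contraction_coeff q \<alpha>) m d x
    = (\<lambda>w. - form0 (star_4_factor q \<alpha> m *\<^sub>C (?s *\<^sub>C (cr (2 * q) *\<^sub>C (L Zero \<triangleright> x)))) w)"
    by (simp only: laplacian_def hodge_left_4[OF q_nonzero])
  moreover have "star_4_factor q \<alpha> m * (?s * cr (2 * q)) = cr (2 * q * \<alpha>)"
  proof -
    have i: "\<i> * x * (- \<i> * y * z) = x * y * z" for x y z :: complex
    proof -
      have "\<i> * x * (- \<i> * y * z) = - (\<i> * \<i>) * (x * y * z)" by algebra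
      then show ?thesis by simp
    qed
    have "star_4_factor q \<alpha> m * (?s * cr (2 * q)) = cr ((m\<^sup>2 * q\<^sup>2 * \<alpha>\<^sup>2 * ((1 - q\<^sup>2) * \<alpha>)\<^sup>2) * (2 * q * \<alpha>))"
      unfolding star_4_factor_def i of_real_mult[symmetric] by (rule arg_cong[of _ _ cr]) algebra
    then show ?thesis by (simp only: m mult_1_left)
  qed
  ultimately show ?thesis
    by (simp only: scaleC_scaleC minus_form0)
qed

end

(* Sign of the Laplacian: with this volume form, involution and contraction the Hodge duality
   squares to -1 on functions, and x |-> - * d * d x comes out as minus the operator given by D. *)

theorem mainTheorem4:
  fixes q \<alpha> m :: real
    and \<Delta>U :: "'u::complex_algebra_1 \<Rightarrow> ('u, 'u) tensor"
    and \<Delta>A :: "'a::complex_star_algebra \<Rightarrow> ('a, 'a) tensor"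
    and K Ki E F :: 'u
    and a c :: 'a
    and pair :: "'u \<Rightarrow> 'a \<Rightarrow> complex"
    and f :: "idx \<Rightarrow> idx \<Rightarrow> 'u"
    and d :: "'a coeffs \<Rightarrow> 'a coeffs"
  assumes "suq2_duality q \<Delta>U \<epsilon>U SU K Ki E F \<Delta>A \<epsilon>A SA a c pair"
    and "structure_elements \<Delta>U (Lvec q K Ki E F) f"
    and "exterior_derivative q (left_action \<Delta>A pair) (Lvec q K Ki E F) f d"
    and "\<alpha> \<noteq> 0" and "m \<noteq> 0"
    and "m\<^sup>2 * q\<^sup>2 * \<alpha>\<^sup>2 * ((1 - q\<^sup>2) * \<alpha>)\<^sup>2 = 1"
  shows "let L = Lvec q K Ki E F; act = left_action \<Delta>A pair; \<phi> = phi \<Delta>A pair a c E;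
             D = cr \<alpha> *\<^sub>C (L Plus * L Minus + cr (q\<^sup>2) *\<^sub>C (L Minus * L Plus)
                   + cr (1 + q\<^sup>2) *\<^sub>C (L Zed * L Zed)
                   - cr (2 * (q\<^sup>2 - 1)) *\<^sub>C (L Zero * L Zed))
         in (\<forall>x. laplacian q (contraction_coeff q \<alpha>) m d x = form0 (- act D x)
               \<and> act D x = cr (2 * q * \<alpha>) *\<^sub>C act (L Zero) x)
          \<and> casimir q K Ki E F = L Zero + cr ((qnum q (1 / 2))\<^sup>2 - 1 / 4) *\<^sub>C 1
          \<and> inj_on \<phi> phi_index \<and> cv.independent (\<phi> ` phi_index) \<and> cv.span (\<phi> ` phi_index) = UNIV
          \<and> (\<forall>(n, J, l)\<in>phi_index.
               act (L Zero) (\<phi> (n, J, l)) = cr (qnum q J * qnum q (J + 1)) *\<^sub>C \<phi> (n, J, l))"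
proof -
  interpret suq2_calculus q \<Delta>U \<epsilon>U SU K Ki E F \<Delta>A \<epsilon>A SA a c pair f d
    using assms(1-3) by (intro suq2_calculus.intro suq2_calculus_axioms.intro)
  have scalar: "cr \<alpha> * cr (2 * q) = cr (2 * q * \<alpha>)" by simp
  have D: "(cr \<alpha> *\<^sub>C (L Plus * L Minus + cr (q\<^sup>2) *\<^sub>C (L Minus * L Plus) + cr (1 + q\<^sup>2) *\<^sub>C (L Zed * L Zed)
      - cr (2 * (q\<^sup>2 - 1)) *\<^sub>C (L Zero * L Zed))) \<triangleright> x = cr (2 * q * \<alpha>) *\<^sub>C (L Zero \<triangleright> x)" for x
    unfolding Laplace_element P.lact_scaleC scaleC_scaleC scalar ..
  show ?thesis
    unfolding Let_def D laplacian_eq[OF assms(6)]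
    by (intro conjI allI HOL.refl casimir_L_Zero phi_basis) (clarify, rule L_Zero_phi)
qed

end
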